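(* Consider skew higher algebroids of order two over a point $M=\{\mathrm{pt}\}$; put $\mathfrak g=E^1$, $C=\widehat{E^2}$ and use the canonical splitting $E^2=\mathfrak g_{[1]}\times C_{[2]}$. The structure of such a higher algebroid is fully determined by the linear maps $[\cdot,\cdot]:\bigwedge^2\mathfrak g\to\mathfrak g$, $\partial:\mathfrak g\to C$, $\beta:\bigwedge^2\mathfrak g\to C$, $\Box:\mathfrak g\otimes C\to C$, $\omega^{\mathrm{sym}}:\mathfrak g\otimes\mathrm{Sym}^2\mathfrak g\to C$. The associated algebroid lifts $e\mapsto e^{\langle-\alpha\rangle}\in\mathfrak X_{-\alpha}(E^2)$ are given, with respect to the isomorphisms $\mathfrak X_0\simeq\mathrm{End}(\mathfrak g)\oplus\mathrm{End}(C)\oplus\mathrm{Hom}(\mathrm{Sym}^2\mathfrak g,C)$, $\mathfrak X_{-1}\simeq\mathfrak g\oplus\mathrm{Hom}(\mathfrak g,C)$, $\mathfrak X_{-2}\simeq C$, by $$e^{\langle0\rangle}=[\cdot,e]\oplus\Box_{-e}(\cdot)\oplus2\,\omega^{\mathrm{sym}}_e(\cdot,\cdot),\qquad e^{\langle-1\rangle}=e\oplus\beta(\cdot,e),\qquad e^{\langle-2\rangle}=2\,\partial(e).$$ A skew higher algebroid $(\mathfrak g\times C,[\cdot,\cdot],\partial,\beta,\Box,\omega^{\mathrm{sym}})$ is Lie if and only if $\mathfrak g$ is a Lie algebra, $\Box$ equips $C$ with a $\mathfrak g$-module structure, $\partial:\mathfrak g\to C$ is a $\mathfrak g$-module morphism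 ($\mathfrak g$ with the adjoint module structure), $\omega^{\mathrm{sym}}=0$, and $$\beta(x_1,x_2)=\partial([x_1,x_2]).$$ Hence order-two Lie higher algebroids over a point are in one-to-one correspondence with $\mathfrak g$-module morphisms $\partial:\mathfrak g\to C$ (from the adjoint module of a Lie algebra $\mathfrak g$ to a $\mathfrak g$-module $C$).
   Context: **Graded bundles.** A graded bundle of order $k$ is a smooth fibre bundle $\sigma^k:E^k\to M$ with an atlas of coordinates $(x^a,y^i_w)$, where $x^a$ (weight $0$) are coordinates on $M$ and each fibre coordinate $y^i_w$ (ranging over $\mathbb R$) has a weight $w\in\{1,\dots,k\}$, such that fibre coordinates of weight $w$ transform by polynomials homogeneous of weight $w$ in the fibre coordinates with coefficients smooth on $M$. The weight vector field is $\Delta=\sum w\,y^i_w\partial_{y^i_w}$; it corresponds to the action $h_t$ ($t\in\mathbb R$) multiplying $y^i_w$ by $t^w$. Morphisms are smooth maps commuting with $h_t$. $\mathfrak X_w(E^k)$ is the space of vector fields $X$ with $[\Delta,X]=wX$. Removing coordinates of weight $>j$ gives the order-$j$ reduction $E^j$; $\sigma^1:E^1\to M$ is a vector bundle. The core $\widehat{E^k}\subset E^k$ is given by vanishing of all fibre coordinates of weight $<k$; it is a vector bundle over $M$, and $E^k\to E^{k-1}$ is an affine bundle modelled on the pullback of the core, with addition $a\dotplus v$. For a vector bundle $F$, $F_{[k]}$ denotes $F$ with linear coordinates of weight $k$. **Higher tangent bundles and comorphisms.** $[\gamma]_k\in\mathrm T^kM$ is the $k$-th order tangency class at $0$ of a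 curve $\gamma$. For a vector bundle $\sigma:E\to M$, $\mathrm T^k\sigma:\mathrm T^kE\to\mathrm T^kM$ is a vector bundle and $\mathrm T^kE$ is a graded bundle over $E$ with $h_s[a]_k=[t\mapsto a(st)]_k$; $\mathrm TE^k$ is a vector bundle $\tau_{E^k}$ over $E^k$ and a graded bundle with action $\mathrm Th_t$. A VB comorphism from $\sigma_1:E_1\to M_1$ to $\sigma_2:E_2\to M_2$ covering $\underline r:M_2\to M_1$ is a relation $r\subset E_1\times E_2$ that is the union of graphs of linear maps $r_y:(E_1)_{\underline r(y)}\to(E_2)_y$, $y\in M_2$, depending smoothly on $y$; it induces a map of sections $\overrightarrow r(s)(y)=r_y(s(\underline r(y)))$. **Higher algebroids.** A higher algebroid (HA) of order $k$ is a graded bundle $E^k$ of order $k$ with a VB comorphism $\kappa^k\subset\mathrm T^kE^1\times\mathrm TE^k$ from $\mathrm T^k\sigma^1$ to $\tau_{E^k}$ that is a graded subbundle of the product, covering a graded bundle morphism $\sharp^k:E^k\to\mathrm T^kM$ over $\mathrm{id}_M$ (the anchor), whose order-one reduction $\kappa^1\subset\mathrm TE^1\times\mathrm TE^1$ is an algebroid structure on $E^1$ (it is the identity between the cores $\cong E^1$). When $M$ is a point, $\kappa^k$ is just a smooth family of linear maps $\mathrm T^k\mathfrak g\to\mathrm T_aE^k$, $a\in E^k$, equivalently a weight-respecting linear map $\mathrm T^k\mathfrak g\to\mathfrak X_{\le0}(E^k)$. For $s\in\Gamma(E^1)$, $0\le\alpha\le k$, the algebroid lift $s^{\langle-\alpha\rangle}\in\mathfrak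 X_{-\alpha}(E^k)$ is $\overrightarrow{\kappa^k}$ applied to the section $[\gamma]_k\mapsto[t\mapsto t^\alpha s(\gamma(t))]_k$ of $\mathrm T^k\sigma^1$. The HA is skew if $\kappa^1$ is a symmetric relation; over a point this means that the bilinear bracket on $\mathfrak g=E^1$ determined by $\kappa^1$ through $[x,y]^{\langle-1\rangle}=[x^{\langle0\rangle},y^{\langle-1\rangle}]$ (lifts with respect to $\kappa^1$) is skew-symmetric. The HA is Lie if it is skew and $\kappa^k$ is a subalgebroid of the product of the $k$-th tangent lift algebroid $\mathrm T^k\sigma^1$ and the tangent algebroid $\tau_{E^k}$; equivalently (over a point, where every skew HA is almost Lie) $[x^{\langle-\alpha\rangle},y^{\langle-\beta\rangle}]=[x,y]^{\langle-\alpha-\beta\rangle}$ for $\alpha,\beta\ge0$, $\alpha+\beta\le k$. **Structure maps, $k=2$.** Identify $\Gamma(C)\simeq\mathfrak X_{-2}(E^2)$, $v$ corresponding to the field represented at $a$ by $t\mapsto a\dotplus tv$. Then $\partial(s)=\frac12s^{\langle-2\rangle}$; $\beta(s_1,s_2)=\frac12[s_1^{\langle-1\rangle},s_2^{\langle-1\rangle}]$; $\Box_sv=[s^{\langle0\rangle},v]$; $\omega(s_1,s_2,s)=\frac12[s_1^{\langle-1\rangle},[s_2^{\langle-1\rangle},s^{\langle0\rangle}]]-\beta(s_1,[s_2,s])$; $\omega^{\mathrm{sym}}_s(s_1,s_2)=\frac12\omega(s_1,s_2,s)+\frac12\omega(s_2,s_1,s)$. **Canonical splitting.** Over a point there is the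 canonical graded map $\Theta^2:\mathrm T\mathfrak g=\mathfrak g_{[1]}\oplus\mathfrak g_{[2]}\to E^2$, inducing $\mathrm{id}_{\mathfrak g}$ in order one: $\Theta^2([a]_1)=V$ iff $\kappa^2_V([t\mapsto t\,a(t)]_2)=\Delta(V)$. The splitting $E^2=\mathfrak g_{[1]}\times C_{[2]}$ is the one for which $\Theta^2(x,0)=(x,0)$, $x\in\mathfrak g$, i.e. $(x,c)\leftrightarrow\Theta^2(x,0)\dotplus c$. **Isomorphisms.** In linear coordinates $(y^i,z^\mu)$ on $\mathfrak g\times C$, $\phi\in\mathrm{End}(\mathfrak g)$, $\eta\in\mathrm{End}(C)$, $\chi\in\mathrm{Hom}(\mathrm{Sym}^2\mathfrak g,C)$ correspond to $\phi^i_jy^j\partial_{y^i}$, $\eta^\mu_\nu z^\nu\partial_{z^\mu}$, $\frac12\chi^\mu_{ij}y^iy^j\partial_{z^\mu}$; $x\in\mathfrak g$, $F\in\mathrm{Hom}(\mathfrak g,C)$ to $x^i\partial_{y^i}$, $F^\mu_iy^i\partial_{z^\mu}$; $v\in C$ to $v^\mu\partial_{z^\mu}$. All vector spaces are finite dimensional and real. *)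

theory Defs
  imports "HOL-Analysis.Analysis"
begin

section \<open>Finite-dimensional spaces and smooth maps\<close>

text \<open>
  Finite-dimensional real vector spaces, the zero space included (which \<^class>\<open>euclidean_space\<close>
  excludes). The inner product is auxiliary: it only supplies the topology.
\<close>

class findim = real_inner +
  assumes finite_spanning_set: "\<exists>B. finite B \<and> (\<forall>x. \<exists>u. x = (\<Sum>b\<in>B. u b *\<^sub>R b))"

subclass (in euclidean_space) findim
  by standard (metis finite_Basis euclidean_representation)

primrec Ck :: "nat \<Rightarrow> ('a::real_normed_vector \<Rightarrow> 'b::real_normed_vector) \<Rightarrow> bool" where
  "Ck 0 f \<longleftrightarrow> continuous_on UNIV f"
| "Ck (Suc n) f \<longleftrightarrow>
    (\<forall>x. f differentiable (at x)) \<and> (\<forall>v. Ck n (\<lambda>x. frechet_derivative f (at x) v))"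

definition smooth :: "('a::real_normed_vector \<Rightarrow> 'b::real_normed_vector) \<Rightarrow> bool" where
  "smooth f \<longleftrightarrow> (\<forall>n. Ck n f)"

text \<open>
  For a vector space \<open>V\<close> the tangency classes \<open>[a]\<^sub>1\<close>, \<open>[a]\<^sub>2\<close> of smooth curves are recorded by the
  derivatives at \<open>0\<close>; this identifies \<open>T V\<close> with \<open>V \<times> V\<close> and \<open>T\<^sup>2 V\<close> with \<open>V \<times> V \<times> V\<close>,
  as vector bundles over a point (addition and scaling of curves).
\<close>

definition jet1 :: "(real \<Rightarrow> 'a::real_normed_vector) \<Rightarrow> 'a \<times> 'a" where
  "jet1 a = (a 0, vector_derivative a (at 0))"

definition jet2 :: "(real \<Rightarrow> 'a::real_normed_vector) \<Rightarrow> 'a \<times> 'a \<times> 'a" where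
  "jet2 a = (a 0, vector_derivative a (at 0),
     vector_derivative (\<lambda>t. vector_derivative a (at t)) (at 0))"


section \<open>Graded bundles of order two over a point\<close>

text \<open>
  A chart collects the coordinates of weight \<open>1\<close> in \<open>'g\<close> and those of weight \<open>2\<close> in \<open>'c\<close>. Over a
  point charts are global. The map \<open>proj\<close> is the projection onto the order-one reduction \<open>E\<^sup>1\<close>, which
  is identified with the vector space \<open>'g\<close>; \<open>core\<close> is the inclusion of the core, which is
  identified with the vector space \<open>'c\<close>.
\<close>

record ('e, 'g, 'c) graded2 =
  charts :: "('e \<Rightarrow> 'g \<times> 'c) set"
  proj :: "'e \<Rightarrow> 'g"
  core :: "'c \<Rightarrow> 'e"

definition graded_poly ::
  "('g::real_vector \<times> 'c::real_vector \<Rightarrow> 'h::real_vector \<times> 'd::real_vector) \<Rightarrow> bool" where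
  "graded_poly T \<longleftrightarrow> (\<exists>A B Q. linear A \<and> linear B \<and> bilinear Q \<and>
     (\<forall>y z. T (y, z) = (A y, B z + Q y y)))"

definition graded_bundle2 :: "('e, 'g::findim, 'c::findim, 'z) graded2_scheme \<Rightarrow> bool" where
  "graded_bundle2 E \<longleftrightarrow>
     charts E \<noteq> {} \<and> (\<forall>\<psi>\<in>charts E. bij \<psi>) \<and>
     (\<forall>\<psi>\<in>charts E. \<forall>\<phi>\<in>charts E. graded_poly (\<phi> \<circ> inv \<psi>)) \<and>
     (\<forall>\<psi>\<in>charts E. \<exists>A. linear A \<and> bij A \<and> (\<forall>e. fst (\<psi> e) = A (proj E e))) \<and>
     (\<forall>\<psi>\<in>charts E. \<exists>B. linear B \<and> bij B \<and> (\<forall>v. \<psi> (core E v) = (0, B v)))"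

definition act :: "('e, 'g::findim, 'c::findim, 'z) graded2_scheme \<Rightarrow> real \<Rightarrow> 'e \<Rightarrow> 'e" where
  "act E t e = (THE e'. \<forall>\<psi>\<in>charts E. \<psi> e' = (t *\<^sub>R fst (\<psi> e), t\<^sup>2 *\<^sub>R snd (\<psi> e)))"

text \<open>The addition \<open>e \<dotplus> v\<close> of a core element in the affine bundle \<open>E\<^sup>2 \<rightarrow> E\<^sup>1\<close>.\<close>

definition add_core ::
  "('e, 'g::findim, 'c::findim, 'z) graded2_scheme \<Rightarrow> 'e \<Rightarrow> 'c \<Rightarrow> 'e" where
  "add_core E e v = (THE e'. \<forall>\<psi>\<in>charts E. \<psi> e' = \<psi> e + \<psi> (core E v))"

definition smooth_fun :: "('e, 'g::findim, 'c::findim, 'z) graded2_scheme \<Rightarrow> ('e \<Rightarrow> real) set" where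
  "smooth_fun E = {f. \<forall>\<psi>\<in>charts E. smooth (f \<circ> inv \<psi>)}"

definition smooth_curve :: "('e, 'g::findim, 'c::findim, 'z) graded2_scheme \<Rightarrow> (real \<Rightarrow> 'e) set" where
  "smooth_curve E = {c. \<forall>\<psi>\<in>charts E. smooth (\<psi> \<circ> c)}"

text \<open>
  Tangent vectors are velocities of curves, represented by the derivations they induce on smooth
  functions (and by \<open>0\<close> on all other functions).
\<close>

type_synonym 'e tvec = "('e \<Rightarrow> real) \<Rightarrow> real"
type_synonym 'e vfield = "'e \<Rightarrow> 'e tvec"

definition velocity ::
  "('e, 'g::findim, 'c::findim, 'z) graded2_scheme \<Rightarrow> (real \<Rightarrow> 'e) \<Rightarrow> 'e tvec" where
  "velocity E c = (\<lambda>f. if f \<in> smooth_fun E then deriv (f \<circ> c) 0 else 0)"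

definition tangent_space ::
  "('e, 'g::findim, 'c::findim, 'z) graded2_scheme \<Rightarrow> 'e \<Rightarrow> 'e tvec set" where
  "tangent_space E e = {velocity E c | c. c \<in> smooth_curve E \<and> c 0 = e}"

text \<open>The tangent map of \<open>\<Phi>\<close>, where \<open>E\<close> is the target of \<open>\<Phi>\<close>.\<close>

definition push ::
  "('f, 'g::findim, 'c::findim, 'z) graded2_scheme \<Rightarrow> ('e \<Rightarrow> 'f) \<Rightarrow> 'e tvec \<Rightarrow> 'f tvec" where
  "push E \<Phi> v = (\<lambda>f. if f \<in> smooth_fun E then v (f \<circ> \<Phi>) else 0)"

definition vector_fields ::
  "('e, 'g::findim, 'c::findim, 'z) graded2_scheme \<Rightarrow> 'e vfield set" where
  "vector_fields E = {X. (\<forall>e. X e \<in> tangent_space E e) \<and>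
     (\<forall>f\<in>smooth_fun E. (\<lambda>e. X e f) \<in> smooth_fun E)}"

definition lie_bracket ::
  "('e, 'g::findim, 'c::findim, 'z) graded2_scheme \<Rightarrow> 'e vfield \<Rightarrow> 'e vfield \<Rightarrow> 'e vfield" where
  "lie_bracket E X Y = (\<lambda>e f. if f \<in> smooth_fun E
     then X e (\<lambda>b. Y b f) - Y e (\<lambda>b. X b f) else 0)"

definition scale_vf :: "real \<Rightarrow> 'e vfield \<Rightarrow> 'e vfield" where
  "scale_vf r X = (\<lambda>e f. r * X e f)"

text \<open>The weight vector field \<open>\<Delta>\<close> is the derivative of the action \<open>h\<^sub>s\<close> at \<open>s = 1\<close>.\<close>

definition weight_vf :: "('e, 'g::findim, 'c::findim, 'z) graded2_scheme \<Rightarrow> 'e vfield" where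
  "weight_vf E = (\<lambda>e. velocity E (\<lambda>t. act E (1 + t) e))"

definition vf_of_weight ::
  "('e, 'g::findim, 'c::findim, 'z) graded2_scheme \<Rightarrow> real \<Rightarrow> 'e vfield set" where
  "vf_of_weight E w = {X \<in> vector_fields E. lie_bracket E (weight_vf E) X = scale_vf w X}"


section \<open>Algebroids over a point\<close>

text \<open>
  An algebroid structure on a vector space: a VB comorphism \<open>K \<subseteq> T g \<times> T g\<close> (a relation that is
  the union of the graphs of linear maps \<open>r y\<close> from \<open>T g\<close> to \<open>T\<^sub>y g\<close>) which is a graded subbundle
  and the identity between the cores.
\<close>

definition algebroid_pt :: "(('g::findim \<times> 'g) \<times> ('g \<times> 'g)) set \<Rightarrow> bool" where
  "algebroid_pt K \<longleftrightarrow> (\<exists>r. (\<forall>y. linear (r y)) \<and> (\<forall>A. smooth (\<lambda>y. r y A)) \<and>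
     K = {(A, (y, r y A)) | A y. True} \<and>
     (\<forall>s y a b. r (s *\<^sub>R y) (a, s *\<^sub>R b) = s *\<^sub>R r y (a, b)) \<and>
     (\<forall>b. r 0 (0, b) = b))"

definition lift_pt ::
  "(('g::findim \<times> 'g) \<times> ('g \<times> 'g)) set \<Rightarrow> nat \<Rightarrow> 'g \<Rightarrow> 'g \<Rightarrow> 'g" where
  "lift_pt K \<alpha> x = (\<lambda>y. THE w. (jet1 (\<lambda>t. t ^ \<alpha> *\<^sub>R x), (y, w)) \<in> K)"

definition vs_bracket :: "('g::findim \<Rightarrow> 'g) \<Rightarrow> ('g \<Rightarrow> 'g) \<Rightarrow> 'g \<Rightarrow> 'g" where
  "vs_bracket X Y = (\<lambda>p. frechet_derivative Y (at p) (X p) - frechet_derivative X (at p) (Y p))"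

definition bracket_pt :: "(('g::findim \<times> 'g) \<times> ('g \<times> 'g)) set \<Rightarrow> 'g \<Rightarrow> 'g \<Rightarrow> 'g" where
  "bracket_pt K x y = (THE z. lift_pt K 1 z = vs_bracket (lift_pt K 0 x) (lift_pt K 1 y))"


section \<open>Higher algebroids of order two over a point\<close>

text \<open>
  \<open>kappa H e\<close> is the linear map from \<open>T\<^sup>2 g\<close> to \<open>T\<^sub>e E\<^sup>2\<close>; the relation \<open>\<kappa>\<^sup>2\<close> is the union of their
  graphs. The anchor is trivial.
\<close>

record ('e, 'g, 'c) ha2 = "('e, 'g, 'c) graded2" +
  kappa :: "'e \<Rightarrow> 'g \<times> 'g \<times> 'g \<Rightarrow> ('e \<Rightarrow> real) \<Rightarrow> real"

definition reduction1 :: "('e, 'g::findim, 'c::findim) ha2 \<Rightarrow> (('g \<times> 'g) \<times> ('g \<times> 'g)) set" where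
  "reduction1 H = {(jet1 a, jet1 (proj H \<circ> c)) | a c.
     smooth a \<and> c \<in> smooth_curve H \<and> kappa H (c 0) (jet2 a) = velocity H c}"

definition higher_algebroid2 :: "('e, 'g::findim, 'c::findim) ha2 \<Rightarrow> bool" where
  "higher_algebroid2 H \<longleftrightarrow>
     graded_bundle2 H \<and>
     (\<forall>e A. kappa H e A \<in> tangent_space H e) \<and>
     (\<forall>e f. linear (\<lambda>A. kappa H e A f)) \<and>
     (\<forall>A. \<forall>f\<in>smooth_fun H. (\<lambda>e. kappa H e A f) \<in> smooth_fun H) \<and>
     (\<forall>s e a. smooth a \<longrightarrow>
        kappa H (act H s e) (jet2 (\<lambda>t. a (s * t))) = push H (act H s) (kappa H e (jet2 a))) \<and>
     algebroid_pt (reduction1 H)"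

definition skew_ha2 :: "('e, 'g::findim, 'c::findim) ha2 \<Rightarrow> bool" where
  "skew_ha2 H \<longleftrightarrow> higher_algebroid2 H \<and> sym (reduction1 H)"

definition ha_bracket :: "('e, 'g::findim, 'c::findim) ha2 \<Rightarrow> 'g \<Rightarrow> 'g \<Rightarrow> 'g" where
  "ha_bracket H = bracket_pt (reduction1 H)"

text \<open>\<open>ha_lift H \<alpha> x\<close> is the algebroid lift of \<open>x\<close> of weight \<open>-\<alpha>\<close>.\<close>

definition ha_lift :: "('e, 'g::findim, 'c::findim) ha2 \<Rightarrow> nat \<Rightarrow> 'g \<Rightarrow> 'e vfield" where
  "ha_lift H \<alpha> x = (\<lambda>e. kappa H e (jet2 (\<lambda>t. t ^ \<alpha> *\<^sub>R x)))"

definition lie_ha2 :: "('e, 'g::findim, 'c::findim) ha2 \<Rightarrow> bool" where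
  "lie_ha2 H \<longleftrightarrow> skew_ha2 H \<and>
     (\<forall>x y \<alpha> \<beta>. \<alpha> + \<beta> \<le> 2 \<longrightarrow>
        lie_bracket H (ha_lift H \<alpha> x) (ha_lift H \<beta> y) = ha_lift H (\<alpha> + \<beta>) (ha_bracket H x y))"

subsection \<open>Structure maps\<close>

definition core_vf :: "('e, 'g::findim, 'c::findim, 'z) graded2_scheme \<Rightarrow> 'c \<Rightarrow> 'e vfield" where
  "core_vf E v = (\<lambda>e. velocity E (\<lambda>t. add_core E e (t *\<^sub>R v)))"

definition vf_core :: "('e, 'g::findim, 'c::findim, 'z) graded2_scheme \<Rightarrow> 'e vfield \<Rightarrow> 'c" where
  "vf_core E X = (THE v. core_vf E v = X)"

definition ha_del :: "('e, 'g::findim, 'c::findim) ha2 \<Rightarrow> 'g \<Rightarrow> 'c" where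
  "ha_del H s = vf_core H (scale_vf (1/2) (ha_lift H 2 s))"

definition ha_beta :: "('e, 'g::findim, 'c::findim) ha2 \<Rightarrow> 'g \<Rightarrow> 'g \<Rightarrow> 'c" where
  "ha_beta H s1 s2 = vf_core H (scale_vf (1/2) (lie_bracket H (ha_lift H 1 s1) (ha_lift H 1 s2)))"

definition ha_box :: "('e, 'g::findim, 'c::findim) ha2 \<Rightarrow> 'g \<Rightarrow> 'c \<Rightarrow> 'c" where
  "ha_box H s v = vf_core H (lie_bracket H (ha_lift H 0 s) (core_vf H v))"

definition ha_omega :: "('e, 'g::findim, 'c::findim) ha2 \<Rightarrow> 'g \<Rightarrow> 'g \<Rightarrow> 'g \<Rightarrow> 'c" where
  "ha_omega H s1 s2 s =
     vf_core H (scale_vf (1/2)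
       (lie_bracket H (ha_lift H 1 s1) (lie_bracket H (ha_lift H 1 s2) (ha_lift H 0 s))))
     - ha_beta H s1 (ha_bracket H s2 s)"

definition ha_omega_sym :: "('e, 'g::findim, 'c::findim) ha2 \<Rightarrow> 'g \<Rightarrow> 'g \<Rightarrow> 'g \<Rightarrow> 'c" where
  "ha_omega_sym H s s1 s2 = (1/2) *\<^sub>R ha_omega H s1 s2 s + (1/2) *\<^sub>R ha_omega H s2 s1 s"

subsection \<open>The canonical splitting\<close>

definition Theta :: "('e, 'g::findim, 'c::findim) ha2 \<Rightarrow> 'g \<times> 'g \<Rightarrow> 'e" where
  "Theta H A = (THE V. \<exists>a. smooth a \<and> jet1 a = A \<and>
     kappa H V (jet2 (\<lambda>t. t *\<^sub>R a t)) = weight_vf H V)"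

definition splitting :: "('e, 'g::findim, 'c::findim) ha2 \<Rightarrow> 'g \<times> 'c \<Rightarrow> 'e" where
  "splitting H = (\<lambda>(x, c). add_core H (Theta H (x, 0)) c)"

definition graded_splitting ::
  "('e, 'g::findim, 'c::findim, 'z) graded2_scheme \<Rightarrow> ('g \<times> 'c \<Rightarrow> 'e) \<Rightarrow> bool" where
  "graded_splitting E S \<longleftrightarrow> bij S \<and> (\<forall>\<psi>\<in>charts E. graded_poly (\<psi> \<circ> S)) \<and>
     (\<forall>x c. proj E (S (x, c)) = x) \<and> (\<forall>c. S (0, c) = core E c)"

text \<open>Transport of a vector field \<open>X\<close> on \<open>'g \<times> 'c\<close> along the splitting.\<close>

definition split_vf ::
  "('e, 'g::findim, 'c::findim) ha2 \<Rightarrow> ('g \<times> 'c \<Rightarrow> 'g \<times> 'c) \<Rightarrow> 'e vfield" where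
  "split_vf H X = (\<lambda>e. let p = inv (splitting H) e
     in velocity H (\<lambda>t. splitting H (p + t *\<^sub>R X p)))"

text \<open>
  The vector fields of weight \<open>0\<close>, \<open>-1\<close>, \<open>-2\<close> that correspond to elements of
  \<open>End g \<oplus> End C \<oplus> Hom (Sym\<^sup>2 g) C\<close>, \<open>g \<oplus> Hom g C\<close> and \<open>C\<close>; a symmetric form \<open>q\<close> stands for
  the field with coefficient \<open>q(y, y) / 2\<close>.
\<close>

definition field0 :: "('e, 'g::findim, 'c::findim) ha2 \<Rightarrow>
    ('g \<Rightarrow> 'g) \<Rightarrow> ('c \<Rightarrow> 'c) \<Rightarrow> ('g \<Rightarrow> 'g \<Rightarrow> 'c) \<Rightarrow> 'e vfield" where
  "field0 H \<phi> \<eta> q = split_vf H (\<lambda>(y, z). (\<phi> y, \<eta> z + (1/2) *\<^sub>R q y y))"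

definition field1 :: "('e, 'g::findim, 'c::findim) ha2 \<Rightarrow> 'g \<Rightarrow> ('g \<Rightarrow> 'c) \<Rightarrow> 'e vfield" where
  "field1 H x F = split_vf H (\<lambda>(y, z). (x, F y))"

definition field2 :: "('e, 'g::findim, 'c::findim) ha2 \<Rightarrow> 'c \<Rightarrow> 'e vfield" where
  "field2 H v = split_vf H (\<lambda>(y, z). (0, v))"

subsection \<open>Isomorphisms\<close>

definition smooth_map ::
  "('e, 'g::findim, 'c::findim, 'z) graded2_scheme \<Rightarrow>
   ('f, 'h::findim, 'd::findim, 'y) graded2_scheme \<Rightarrow> ('e \<Rightarrow> 'f) \<Rightarrow> bool" where
  "smooth_map E F \<Phi> \<longleftrightarrow> (\<forall>f\<in>smooth_fun F. f \<circ> \<Phi> \<in> smooth_fun E)"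

text \<open>
  \<open>\<Phi>\<close> is an isomorphism of higher algebroids that induces \<open>A\<close> on the order-one reductions and \<open>B\<close>
  on the cores.
\<close>

definition ha2_iso ::
  "('e, 'g::findim, 'c::findim) ha2 \<Rightarrow> ('f, 'h::findim, 'd::findim) ha2 \<Rightarrow>
   ('g \<Rightarrow> 'h) \<Rightarrow> ('c \<Rightarrow> 'd) \<Rightarrow> ('e \<Rightarrow> 'f) \<Rightarrow> bool" where
  "ha2_iso H H' A B \<Phi> \<longleftrightarrow>
     bij \<Phi> \<and> smooth_map H H' \<Phi> \<and> smooth_map H' H (inv \<Phi>) \<and>
     (\<forall>t e. \<Phi> (act H t e) = act H' t (\<Phi> e)) \<and>
     (\<forall>e. proj H' (\<Phi> e) = A (proj H e)) \<and> (\<forall>c. \<Phi> (core H c) = core H' (B c)) \<and>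
     (\<forall>e a. smooth a \<longrightarrow> kappa H' (\<Phi> e) (jet2 (A \<circ> a)) = push H' \<Phi> (kappa H e (jet2 a)))"

definition same_structure_maps ::
  "('e, 'g::findim, 'c::findim) ha2 \<Rightarrow> ('f, 'h::findim, 'd::findim) ha2 \<Rightarrow>
   ('g \<Rightarrow> 'h) \<Rightarrow> ('c \<Rightarrow> 'd) \<Rightarrow> bool" where
  "same_structure_maps H H' A B \<longleftrightarrow>
     (\<forall>x y. A (ha_bracket H x y) = ha_bracket H' (A x) (A y)) \<and>
     (\<forall>x. B (ha_del H x) = ha_del H' (A x)) \<and>
     (\<forall>x y. B (ha_beta H x y) = ha_beta H' (A x) (A y)) \<and>
     (\<forall>x c. B (ha_box H x c) = ha_box H' (A x) (B c)) \<and>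
     (\<forall>x y z. B (ha_omega_sym H x y z) = ha_omega_sym H' (A x) (A y) (A z))"

text \<open>
  The total space is literally the product with its standard grading, and the canonical splitting is
  the identity.
\<close>

definition canonically_split :: "('g \<times> 'c, 'g::findim, 'c::findim) ha2 \<Rightarrow> bool" where
  "canonically_split K \<longleftrightarrow> charts K = {id} \<and> proj K = fst \<and> core K = Pair 0 \<and> splitting K = id"


section \<open>Lie algebras and modules\<close>

definition skew_bilin :: "('a::real_vector \<Rightarrow> 'a \<Rightarrow> 'b::real_vector) \<Rightarrow> bool" where
  "skew_bilin f \<longleftrightarrow> bilinear f \<and> (\<forall>x y. f x y = - f y x)"

definition sym_bilin :: "('a::real_vector \<Rightarrow> 'a \<Rightarrow> 'b::real_vector) \<Rightarrow> bool" where
  "sym_bilin f \<longleftrightarrow> bilinear f \<and> (\<forall>x y. f x y = f y x)"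

definition lie_algebra :: "('g::real_vector \<Rightarrow> 'g \<Rightarrow> 'g) \<Rightarrow> bool" where
  "lie_algebra b \<longleftrightarrow> skew_bilin b \<and>
     (\<forall>x y z. b x (b y z) + b y (b z x) + b z (b x y) = 0)"

definition lie_module ::
  "('g::real_vector \<Rightarrow> 'g \<Rightarrow> 'g) \<Rightarrow> ('g \<Rightarrow> 'c::real_vector \<Rightarrow> 'c) \<Rightarrow> bool" where
  "lie_module b \<rho> \<longleftrightarrow> bilinear \<rho> \<and> (\<forall>x y v. \<rho> (b x y) v = \<rho> x (\<rho> y v) - \<rho> y (\<rho> x v))"

definition module_morphism ::
  "('g \<Rightarrow> 'v::real_vector \<Rightarrow> 'v) \<Rightarrow> ('g \<Rightarrow> 'w::real_vector \<Rightarrow> 'w) \<Rightarrow> ('v \<Rightarrow> 'w) \<Rightarrow> bool" where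
  "module_morphism \<rho> \<sigma> d \<longleftrightarrow> linear d \<and> (\<forall>x v. d (\<rho> x v) = \<sigma> x (d v))"

end

theory Submission
  imports Defs
begin

text \<open>
  A graded splitting \<open>S : g \<times> C \<rightarrow> E\<^sup>2\<close> turns every object over a point into calculus on the vector space
  \<open>g \<times> C\<close>: a vector field on \<open>E\<^sup>2\<close> is a map \<open>\<xi>\<close> from \<open>g \<times> C\<close> to itself, and the commutator of
  derivations is \<open>D\<eta>(\<xi>) - D\<xi>(\<eta>)\<close> (\<open>lie_bracket_vf\<close>). The relation \<open>\<kappa>\<^sup>2\<close> becomes a smooth family of linear
  maps from \<open>T\<^sup>2 g\<close> to \<open>g \<times> C\<close> that is equivariant under the scalings. A smooth function that is
  homogeneous for the action \<open>(y, z) \<mapsto> (s y, s\<^sup>2 z)\<close> is a polynomial: differentiate the homogeneity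
  relation at \<open>s = 0\<close>. Hence \<open>\<kappa>\<^sup>2\<close> is given by finitely many multilinear coefficients
  (\<open>higher_algebroid2_coords\<close>): its value on the 2-jet \<open>(a\<^sub>0, a\<^sub>1, a\<^sub>2)\<close> is the vector field
  \<open>(y, z) \<mapsto> (b(y, a\<^sub>0) + a\<^sub>1, - \<rho>(a\<^sub>0, z) + \<omega>(a\<^sub>0; y, y) + \<beta>(y, a\<^sub>1) + d(a\<^sub>2))\<close>,
  where the coefficient \<open>1\<close> of \<open>a\<^sub>1\<close> in the first component says that \<open>\<kappa>\<^sup>1\<close> is the identity
  between the cores.

  In these coordinates \<open>\<kappa>\<^sup>1\<close> is symmetric exactly when \<open>b\<close> is skew, and \<open>\<Theta>\<^sup>2(x, 0)\<close> is the point
  \<open>(x, \<beta>(x, x) / 2)\<close>. The canonical splitting is therefore the one for which \<open>\<beta>\<close> is alternating.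
  In this normal form (\<open>ha_normal\<close>) the brackets that define the structure maps are brackets of
  polynomial fields, and they return the coefficients: \<open>[\<cdot>,\<cdot>] = b\<close>, \<open>\<partial> = d\<close>, \<open>\<box> = \<rho>\<close>, and \<open>\<beta>\<close>
  and \<open>\<omega>\<^sup>s\<^sup>y\<^sup>m = \<omega>\<close> themselves. The formulas for the lifts are the display above, and conversely all
  such coefficients define a skew higher algebroid.

  An isomorphism has the form \<open>(y, z) \<mapsto> (A y, B z + Q(y, y))\<close>, again by homogeneity. Compatibility
  with the lifts of weight \<open>-1\<close> reads \<open>\<beta>'(A y, A x) = B \<beta>(y, x) + 2 Q(y, x)\<close>; for \<open>x = y\<close> both
  \<open>\<beta>\<close>-terms vanish, so \<open>Q = 0\<close> and isomorphisms are just pairs \<open>(A, B)\<close> that intertwine the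
  structure maps (\<open>iso_in_coordinates\<close>).

  The Lie condition is a comparison of coefficients (\<open>lie_ha2_iff\<close>). The weights \<open>(0, 0)\<close>, \<open>(0, -2)\<close>
  and \<open>(-1, -1)\<close> give the Jacobi and module identities, the equivariance of \<open>\<partial>\<close>, and \<open>\<beta> = \<partial>[\<cdot>,\<cdot>]\<close>.
  The weights \<open>(0, -1)\<close> give an identity that equates the failure of \<open>\<beta>\<close> to be equivariant, which is
  skew in its arguments, with \<open>2 \<omega>\<close>, which is symmetric; so both vanish. Conversely the equivariance
  of \<open>\<partial>[\<cdot>,\<cdot>]\<close> follows from that of \<open>\<partial>\<close> and the Jacobi identity.
\<close>

section \<open>Linear algebra of finite-dimensional spaces\<close>

text \<open>
  An orthogonal spanning set has coordinate functionals given by inner products, which are visibly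
  bounded. Boundedness of linear maps and smoothness of compositions are reduced to such coordinates.
\<close>

lemma findim_coordinates:
  obtains B :: "'a::findim set" and c :: "'a \<Rightarrow> 'a \<Rightarrow> real"
  where "finite B" "\<And>b. bounded_linear (c b)" "\<And>x. (\<Sum>b\<in>B. c b x *\<^sub>R b) = x"
proof -
  obtain B0 :: "'a set" where B0: "finite B0" "\<And>x. \<exists>u. x = (\<Sum>b\<in>B0. u b *\<^sub>R b)"
    using finite_spanning_set by blast
  have sp0: "span B0 = UNIV"
    using B0 by (auto simp: span_finite)
  obtain B :: "'a set" where B: "finite B" "span B = UNIV" "pairwise orthogonal B"
    using basis_orthogonal[OF B0(1)] unfolding sp0 by blast
  define c where "c b x = (x \<bullet> b) / (b \<bullet> b)" for b x :: 'a
  have rep: "(\<Sum>b\<in>B. c b x *\<^sub>R b) = x" for x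
  proof -
    define w where "w = x - (\<Sum>b\<in>B. c b x *\<^sub>R b)"
    have "orthogonal w b" if b: "b \<in> B" for b
    proof -
      have "(\<Sum>a\<in>B. c a x *\<^sub>R a) \<bullet> b = (\<Sum>a\<in>B. if a = b then c b x * (b \<bullet> b) else 0)"
        unfolding inner_sum_left
        by (intro sum.cong refl) (use B(3) b in \<open>auto simp: pairwise_def orthogonal_def\<close>)
      also have "\<dots> = x \<bullet> b"
        using B(1) b by (simp add: c_def)
      finally show ?thesis by (simp add: orthogonal_def w_def inner_diff_left)
    qed
    then have "orthogonal w w"
      using orthogonal_to_span[of w B] B(2) by auto
    then show ?thesis by (simp add: orthogonal_def w_def)
  qed
  have "bounded_linear (c b)" for b
    unfolding c_def by (rule bounded_linear_compose[OF bounded_linear_divide bounded_linear_inner_left])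
  with B(1) rep show ?thesis by (intro that)
qed

lemma linear_eq_sum_coordinates:
  assumes "\<And>x. (\<Sum>b\<in>B. c b x *\<^sub>R b) = x" and f: "linear f"
  shows "(\<Sum>b\<in>B. c b x *\<^sub>R f b) = f x"
proof -
  have "(\<Sum>b\<in>B. c b x *\<^sub>R f b) = f (\<Sum>b\<in>B. c b x *\<^sub>R b)"
    by (simp only: linear_sum[OF f] linear_scale[OF f])
  then show ?thesis by (simp only: assms(1))
qed

lemma findim_linear_bounded:
  fixes f :: "'a::findim \<Rightarrow> 'b::real_normed_vector"
  assumes "linear f" shows "bounded_linear f"
proof -
  obtain B :: "'a set" and c where c: "finite B" "\<And>b. bounded_linear (c b)"
    "\<And>x. (\<Sum>b\<in>B. c b x *\<^sub>R b) = x"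
    by (rule findim_coordinates) blast
  have "(\<Sum>b\<in>B. c b x *\<^sub>R f b) = f x" for x
    by (rule linear_eq_sum_coordinates[OF c(3) assms])
  moreover have "bounded_linear (\<lambda>x. \<Sum>b\<in>B. c b x *\<^sub>R f b)"
    by (intro bounded_linear_sum bounded_linear_scaleR_const c)
  ultimately show ?thesis by (simp only:)
qed

lemma findim_bilinear_bounded:
  fixes f :: "'a::findim \<Rightarrow> 'b::findim \<Rightarrow> 'c::real_normed_vector"
  assumes "bilinear f" shows "bounded_bilinear f"
proof -
  have l: "\<And>x. linear (f x)" "\<And>y. linear (\<lambda>x. f x y)"
    using assms by (auto simp: bilinear_def)
  obtain B :: "'a set" and c where c: "finite B" "\<And>b. bounded_linear (c b)"
    "\<And>x. (\<Sum>b\<in>B. c b x *\<^sub>R b) = x"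
    by (rule findim_coordinates) blast
  have "\<forall>b. \<exists>K. \<forall>x. norm (c b x) \<le> norm x * K"
    using bounded_linear.bounded[OF c(2)] by blast
  then obtain K where K: "\<And>b x. norm (c b x) \<le> norm x * K b"
    by metis
  have "\<forall>b. \<exists>K. \<forall>y. norm (f b y) \<le> norm y * K"
    using bounded_linear.bounded[OF findim_linear_bounded[OF l(1)]] by blast
  then obtain L where L: "\<And>b y. norm (f b y) \<le> norm y * L b"
    by metis
  have "norm (f x y) \<le> norm x * norm y * (\<Sum>b\<in>B. K b * L b)" for x y
  proof -
    have "norm (\<Sum>b\<in>B. c b x *\<^sub>R f b y) \<le> (\<Sum>b\<in>B. norm (c b x) * norm (f b y))"
      using norm_sum[of "\<lambda>b. c b x *\<^sub>R f b y" B] by simp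
    then have "norm (f x y) \<le> (\<Sum>b\<in>B. norm (c b x) * norm (f b y))"
      by (simp only: linear_eq_sum_coordinates[OF c(3) l(2)])
    also have "\<dots> \<le> (\<Sum>b\<in>B. (norm x * K b) * (norm y * L b))"
      by (intro sum_mono mult_mono K L norm_ge_zero order_trans[OF norm_ge_zero K])
    finally show ?thesis by (simp add: sum_distrib_left mult_ac)
  qed
  then show ?thesis
    by (intro bounded_bilinear.intro exI[of _ "\<Sum>b\<in>B. K b * L b"] allI linear_add[OF l(1)]
        linear_scale[OF l(1)] linear_add[OF l(2)] linear_scale[OF l(2)])
qed

instance prod :: (findim, findim) findim
proof
  obtain B :: "'a set" and c where c: "finite B" "\<And>b. bounded_linear (c b)"
    "\<And>x. (\<Sum>b\<in>B. c b x *\<^sub>R b) = x"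
    by (rule findim_coordinates) blast
  obtain B' :: "'b set" and c' where c': "finite B'" "\<And>b. bounded_linear (c' b)"
    "\<And>x. (\<Sum>b\<in>B'. c' b x *\<^sub>R b) = x"
    by (rule findim_coordinates) blast
  define D where "D = (\<lambda>x. (x, 0::'b)) ` B \<union> Pair 0 ` B'"
  have "x \<in> span D" for x
  proof -
    have "(fst x, snd x) = (\<Sum>b\<in>B. c b (fst x) *\<^sub>R (b, 0)) + (\<Sum>b\<in>B'. c' b (snd x) *\<^sub>R (0, b))"
      by (simp add: prod_eq_iff fst_sum snd_sum c c')
    moreover have "\<dots> \<in> span D"
      by (intro span_add span_sum span_scale span_base) (auto simp: D_def)
    ultimately show ?thesis by simp
  qed
  then have "range (\<lambda>u. \<Sum>v\<in>D. u v *\<^sub>R v) = UNIV"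
    using span_finite[of D] c(1) c'(1) by (auto simp: D_def)
  then have "\<forall>x. \<exists>u. x = (\<Sum>b\<in>D. u b *\<^sub>R b)" by blast
  moreover have "finite D" using c(1) c'(1) by (simp add: D_def)
  ultimately show "\<exists>B::('a \<times> 'b) set. finite B \<and> (\<forall>x. \<exists>u. x = (\<Sum>b\<in>B. u b *\<^sub>R b))"
    by blast
qed

lemma skew_if_alternating:
  assumes f: "bilinear f" and alt: "\<And>x. f x x = 0"
  shows "f x y = - f y x"
proof -
  have "f x y + f y x = f (x + y) (x + y) - f x x - f y y"
    by (simp only: bilinear_ladd[OF f] bilinear_radd[OF f]) simp
  then show ?thesis by (simp add: alt eq_neg_iff_add_eq_0)
qed

lemma sym_bilin_eq_if_diagonal_eq:
  assumes "sym_bilin f" "sym_bilin g" "\<And>x. f x x = g x x"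
  shows "f x y = g x y"
proof -
  have "2 *\<^sub>R h x y = h (x + y) (x + y) - h x x - h y y" if "sym_bilin h" for h :: "'a \<Rightarrow> 'a \<Rightarrow> 'b"
  proof -
    have h: "bilinear h" "h y x = h x y" using that by (auto simp: sym_bilin_def)
    show ?thesis
      by (simp add: bilinear_ladd[OF h(1)] bilinear_radd[OF h(1)] h(2) scaleR_2)
  qed
  from this[OF assms(1)] this[OF assms(2)] have "2 *\<^sub>R f x y = 2 *\<^sub>R g x y"
    by (simp only: assms(3))
  then show ?thesis by simp
qed

lemma bilinear_linearI:
  "(\<And>x. linear (f x)) \<Longrightarrow> (\<And>y. linear (\<lambda>x. f x y)) \<Longrightarrow> bilinear f"
  by (simp add: bilinear_def)

lemma linear_fst_comp: "linear f \<Longrightarrow> linear (\<lambda>x. fst (f x))"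
  and linear_snd_comp: "linear f \<Longrightarrow> linear (\<lambda>x. snd (f x))"
  by (simp_all add: linear_iff)

lemma linear_inv_of_bij: "linear A \<Longrightarrow> bij A \<Longrightarrow> linear (inv A)"
  unfolding linear_iff by (metis bij_inv_eq_iff)

section \<open>Smooth maps\<close>

lemma Ck_SucD: "Ck (Suc n) f \<Longrightarrow> Ck n f"
  by (induction n arbitrary: f)
    (auto intro: differentiable_imp_continuous_on simp: differentiable_on_def)

lemma Ck_SucI:
  assumes "\<And>x. (f has_derivative f' x) (at x)" "\<And>v. Ck n (\<lambda>x. f' x v)"
  shows "Ck (Suc n) f"
proof -
  have "frechet_derivative f (at x) = f' x" for x
    using frechet_derivative_at[OF assms(1)] by simp
  then show ?thesis using assms by (auto simp: differentiable_def)
qed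

lemma Ck_has_derivative:
  "Ck (Suc n) f \<Longrightarrow> (f has_derivative frechet_derivative f (at x)) (at x)"
  by (rule iffD1[OF frechet_derivative_works]) simp

lemma Ck_const: "Ck n (\<lambda>x. c)"
  by (induction n arbitrary: c) (auto simp: frechet_derivative_const)

lemma Ck_bounded_linear: "bounded_linear f \<Longrightarrow> Ck n f"
proof (cases n)
  case (Suc m)
  assume f: "bounded_linear f"
  show ?thesis unfolding Suc
    by (rule Ck_SucI[OF bounded_linear_imp_has_derivative[OF f]]) (rule Ck_const)
qed (simp add: linear_continuous_on)

lemma Ck_bounded_linear_comp:
  "bounded_linear L \<Longrightarrow> Ck n f \<Longrightarrow> Ck n (\<lambda>x. L (f x))"
proof (induction n arbitrary: f)
  case 0
  then show ?case by (auto intro: bounded_linear.continuous_on)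
next
  case (Suc n)
  show ?case
    by (rule Ck_SucI[OF bounded_linear.has_derivative[OF Suc.prems(1) Ck_has_derivative[OF Suc.prems(2)]]])
      (use Suc in auto)
qed

lemma Ck_add: "Ck n f \<Longrightarrow> Ck n g \<Longrightarrow> Ck n (\<lambda>x. f x + g x)"
proof (induction n arbitrary: f g)
  case 0
  then show ?case by (auto intro: continuous_intros)
next
  case (Suc n)
  show ?case
    by (rule Ck_SucI[OF has_derivative_add[OF Ck_has_derivative Ck_has_derivative], OF Suc.prems])
      (use Suc in auto)
qed

lemma Ck_sum: "(\<And>i. i \<in> I \<Longrightarrow> Ck n (f i)) \<Longrightarrow> Ck n (\<lambda>x. \<Sum>i\<in>I. f i x)"
  by (induction I rule: infinite_finite_induct) (auto intro: Ck_const Ck_add)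

lemma Ck_bounded_bilinear:
  assumes "bounded_bilinear h"
  shows "Ck n f \<Longrightarrow> Ck n g \<Longrightarrow> Ck n (\<lambda>x. h (f x) (g x))"
proof (induction n arbitrary: f g)
  case 0
  then show ?case using bounded_bilinear.continuous_on[OF assms] by auto
next
  case (Suc n)
  show ?case
    by (rule Ck_SucI[OF bounded_bilinear.FDERIV[OF assms Ck_has_derivative Ck_has_derivative], OF Suc.prems])
      (intro Ck_add Suc.IH; use Suc.prems in \<open>auto simp: Ck_SucD\<close>)
qed

text \<open>
  The chain rule applies \<open>Df(g x)\<close> to a vector that moves with \<open>x\<close>, whereas the definition of \<open>Ck\<close>
  only controls derivatives in constant directions. Expanding the moving vector in coordinates
  leaves constant directions, to which the induction hypothesis applies.
\<close>

lemma Ck_compose: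
  fixes f :: "'b::findim \<Rightarrow> 'c::real_normed_vector" and g :: "'a::real_normed_vector \<Rightarrow> 'b"
  shows "Ck n f \<Longrightarrow> Ck n g \<Longrightarrow> Ck n (\<lambda>x. f (g x))"
proof (induction n arbitrary: f g)
  case 0
  then show ?case by (auto intro: continuous_on_compose2)
next
  case (Suc n)
  obtain B :: "'b set" and c where c: "finite B" "\<And>b. bounded_linear (c b)"
    "\<And>x. (\<Sum>b\<in>B. c b x *\<^sub>R b) = x"
    by (rule findim_coordinates) blast
  let ?f = "\<lambda>x. frechet_derivative f (at x)" and ?g = "\<lambda>x. frechet_derivative g (at x)"
  have "((\<lambda>x. f (g x)) has_derivative (\<lambda>v. ?f (g x) (?g x v))) (at x)" for x
    using has_derivative_compose[OF Ck_has_derivative[OF Suc.prems(2)] Ck_has_derivative[OF Suc.prems(1)]] .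
  moreover have "Ck n (\<lambda>x. ?f (g x) (?g x v))" for v
  proof -
    have lin: "linear (?f y)" for y
      using Suc.prems(1) by (auto intro: linear_frechet_derivative)
    have "(\<Sum>b\<in>B. c b (?g x v) *\<^sub>R ?f (g x) b) = ?f (g x) (?g x v)" for x
      by (rule linear_eq_sum_coordinates[OF c(3) lin])
    moreover have "Ck n (\<lambda>x. \<Sum>b\<in>B. c b (?g x v) *\<^sub>R ?f (g x) b)"
      by (intro Ck_sum Ck_bounded_bilinear[OF bounded_bilinear_scaleR] Ck_bounded_linear_comp[OF c(2)] Suc.IH)
        (use Suc.prems in \<open>auto simp: Ck_SucD\<close>)
    ultimately show ?thesis by simp
  qed
  ultimately show ?case by (rule Ck_SucI)
qed

lemma smooth_has_derivative:
  "smooth f \<Longrightarrow> (f has_derivative frechet_derivative f (at x)) (at x)"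
  unfolding smooth_def by (rule Ck_has_derivative[of 0]) blast

lemma smooth_linear_derivative: "smooth f \<Longrightarrow> linear (frechet_derivative f (at x))"
  by (rule has_derivative_linear[OF smooth_has_derivative])

lemma smooth_continuous: "smooth f \<Longrightarrow> isCont f x"
  using has_derivative_continuous smooth_has_derivative by blast

lemma smooth_frechet: "smooth f \<Longrightarrow> smooth (\<lambda>x. frechet_derivative f (at x) v)"
  unfolding smooth_def using Ck.simps(2) by blast

lemma smooth_const: "smooth (\<lambda>x. c)"
  by (simp add: smooth_def Ck_const)

lemma smooth_linear: "linear f \<Longrightarrow> smooth (f :: 'a::findim \<Rightarrow> 'b::real_normed_vector)"
  by (simp add: smooth_def Ck_bounded_linear findim_linear_bounded)

lemma smooth_ident: "smooth (\<lambda>x. x)"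
  by (simp add: smooth_def Ck_bounded_linear)

lemma smooth_linear_comp:
  "linear L \<Longrightarrow> smooth f \<Longrightarrow> smooth (\<lambda>x. (L :: 'b::findim \<Rightarrow> 'c::real_normed_vector) (f x))"
  unfolding smooth_def using Ck_bounded_linear_comp[OF findim_linear_bounded] by blast

lemma smooth_add: "smooth f \<Longrightarrow> smooth g \<Longrightarrow> smooth (\<lambda>x. f x + g x)"
  by (simp add: smooth_def Ck_add)

lemma smooth_sum: "(\<And>i. i \<in> I \<Longrightarrow> smooth (f i)) \<Longrightarrow> smooth (\<lambda>x. \<Sum>i\<in>I. f i x)"
  by (auto simp: smooth_def intro: Ck_sum)

lemma smooth_bilinear:
  "bilinear h \<Longrightarrow> smooth f \<Longrightarrow> smooth g \<Longrightarrow>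
   smooth (\<lambda>x. (h :: 'a::findim \<Rightarrow> 'b::findim \<Rightarrow> 'c::real_normed_vector) (f x) (g x))"
  unfolding smooth_def using Ck_bounded_bilinear[OF findim_bilinear_bounded] by blast

lemma smooth_scaleR: "smooth f \<Longrightarrow> smooth g \<Longrightarrow> smooth (\<lambda>x. f x *\<^sub>R g x)"
  by (simp add: smooth_def Ck_bounded_bilinear bounded_bilinear_scaleR)

lemma smooth_compose:
  fixes f :: "'b::findim \<Rightarrow> 'c::real_normed_vector"
  shows "smooth f \<Longrightarrow> smooth g \<Longrightarrow> smooth (\<lambda>x. f (g x))"
  by (simp add: smooth_def Ck_compose)

lemma smooth_bounded_linear_comp:
  "bounded_linear L \<Longrightarrow> smooth f \<Longrightarrow> smooth (\<lambda>x. L (f x))"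
  unfolding smooth_def using Ck_bounded_linear_comp by blast

lemma smooth_fst: "smooth f \<Longrightarrow> smooth (\<lambda>x. fst (f x))"
  by (rule smooth_bounded_linear_comp[OF bounded_linear_fst])

lemma smooth_snd: "smooth f \<Longrightarrow> smooth (\<lambda>x. snd (f x))"
  by (rule smooth_bounded_linear_comp[OF bounded_linear_snd])

lemma smooth_Pair: "smooth f \<Longrightarrow> smooth g \<Longrightarrow> smooth (\<lambda>x. (f x, g x))"
proof -
  assume f: "smooth f" and g: "smooth g"
  have "smooth (\<lambda>x. (f x, 0) + (0, g x))"
    by (intro smooth_add smooth_bounded_linear_comp[OF _ f] smooth_bounded_linear_comp[OF _ g]
        bounded_linear_Pair bounded_linear_ident bounded_linear_zero)
  then show ?thesis by simp
qed

lemma smooth_power: "smooth f \<Longrightarrow> smooth (\<lambda>x. (f x :: real) ^ n)"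
  by (induction n) (auto intro: smooth_const smooth_bilinear simp: bilinear_def linear_conv_bounded_linear
      bounded_linear_mult_left bounded_linear_mult_right)

lemmas smooth_intros = smooth_const smooth_ident smooth_add smooth_scaleR smooth_fst smooth_snd
  smooth_Pair smooth_power

lemma smooth_derivative_along:
  fixes f :: "'a::findim \<Rightarrow> 'b::real_normed_vector"
  assumes f: "smooth f" and g: "smooth g" and h: "smooth h"
  shows "smooth (\<lambda>x. frechet_derivative f (at (g x)) (h x))"
proof -
  obtain B :: "'a set" and c where c: "finite B" "\<And>b. bounded_linear (c b)"
    "\<And>x. (\<Sum>b\<in>B. c b x *\<^sub>R b) = x"
    by (rule findim_coordinates) blast
  have "(\<Sum>b\<in>B. c b (h x) *\<^sub>R frechet_derivative f (at (g x)) b)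
      = frechet_derivative f (at (g x)) (h x)" for x
    by (rule linear_eq_sum_coordinates[OF c(3) smooth_linear_derivative[OF f]])
  moreover have "smooth (\<lambda>x. \<Sum>b\<in>B. c b (h x) *\<^sub>R frechet_derivative f (at (g x)) b)"
    by (intro smooth_sum smooth_scaleR smooth_bounded_linear_comp[OF c(2)] h
        smooth_compose[OF smooth_frechet[OF f] g])
  ultimately show ?thesis by simp
qed

lemma smooth_if_functionals_smooth:
  fixes f :: "'a::real_normed_vector \<Rightarrow> 'b::findim"
  assumes "\<And>l :: 'b \<Rightarrow> real. linear l \<Longrightarrow> smooth (\<lambda>x. l (f x))"
  shows "smooth f"
proof -
  obtain B :: "'b set" and c where c: "finite B" "\<And>b. bounded_linear (c b)"
    "\<And>x. (\<Sum>b\<in>B. c b x *\<^sub>R b) = x"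
    by (rule findim_coordinates) blast
  have "smooth (\<lambda>x. \<Sum>b\<in>B. c b (f x) *\<^sub>R b)"
    by (intro smooth_sum smooth_scaleR smooth_const assms bounded_linear.linear c)
  then show ?thesis by (simp add: c(3))
qed

lemma findim_eq_if_functionals_eq:
  fixes x y :: "'b::findim"
  assumes "\<And>l :: 'b \<Rightarrow> real. linear l \<Longrightarrow> l x = l y"
  shows "x = y"
proof -
  obtain B :: "'b set" and c where c: "finite B" "\<And>b. bounded_linear (c b)"
    "\<And>x. (\<Sum>b\<in>B. c b x *\<^sub>R b) = x"
    by (rule findim_coordinates) blast
  have "c b x = c b y" for b
    by (intro assms bounded_linear.linear c)
  then have "(\<Sum>b\<in>B. c b x *\<^sub>R b) = (\<Sum>b\<in>B. c b y *\<^sub>R b)"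
    by (simp only:)
  then show ?thesis by (simp only: c(3))
qed

lemma smooth_has_vector_derivative:
  "smooth a \<Longrightarrow> (a has_vector_derivative vector_derivative a (at t)) (at t)"
  using smooth_has_derivative differentiable_def vector_derivative_works by blast

lemma smooth_vector_derivative: "smooth a \<Longrightarrow> smooth (\<lambda>t. vector_derivative a (at t))"
proof -
  assume a: "smooth a"
  have "vector_derivative a (at t) = frechet_derivative a (at t) 1" for t
  proof -
    have "a differentiable (at t)"
      using smooth_has_derivative[OF a] unfolding differentiable_def by blast
    then show ?thesis
      by (simp add: frechet_derivative_eq_vector_derivative)
  qed
  then show ?thesis using smooth_frechet[OF a] by simp
qed

lemma frechet_derivative_eqI: "(f has_derivative f') (at x) \<Longrightarrow> frechet_derivative f (at x) = f'"
  using frechet_derivative_at by force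

lemma smooth_comp_has_vector_derivative:
  assumes f: "smooth f" and g: "(g has_vector_derivative g') (at t)"
  shows "((\<lambda>t. f (g t)) has_vector_derivative frechet_derivative f (at (g t)) g') (at t)"
  using vector_derivative_diff_chain_within[OF g has_derivative_at_withinI[OF smooth_has_derivative[OF f]]]
  by (simp add: o_def)

lemma smooth_line_derivative:
  assumes "smooth f"
  shows "((\<lambda>t. f (p + t *\<^sub>R v)) has_vector_derivative frechet_derivative f (at (p + t *\<^sub>R v)) v) (at t)"
  by (rule smooth_comp_has_vector_derivative[OF assms]) (auto intro!: derivative_eq_intros)

text \<open>
  The mean value theorem is applied once in the direction \<open>u\<close> and once in the direction \<open>v\<close>. The left
  hand side is symmetric in \<open>u\<close> and \<open>v\<close>, which is how the symmetry of the second derivative enters.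
\<close>

lemma second_difference_mean_value:
  fixes f :: "'a::findim \<Rightarrow> real"
  assumes f: "smooth f" and t: "t > 0"
  obtains r s where "0 < r" "r < t" "0 < s" "s < t"
    "f (p + t *\<^sub>R u + t *\<^sub>R v) - f (p + t *\<^sub>R u) - f (p + t *\<^sub>R v) + f p
      = t\<^sup>2 * frechet_derivative (\<lambda>x. frechet_derivative f (at x) u) (at (p + r *\<^sub>R u + s *\<^sub>R v)) v"
proof -
  let ?D = "\<lambda>x. frechet_derivative f (at x) u"
  have "\<exists>r. 0 < r \<and> r < t \<and> (f (p + t *\<^sub>R v + t *\<^sub>R u) - f (p + t *\<^sub>R u)) - (f (p + t *\<^sub>R v + 0 *\<^sub>R u) - f (p + 0 *\<^sub>R u))
       = (t - 0) * (?D (p + t *\<^sub>R v + r *\<^sub>R u) - ?D (p + r *\<^sub>R u))"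
    by (rule MVT2[OF t]) (intro DERIV_diff smooth_line_derivative[OF f, unfolded has_real_derivative_iff_has_vector_derivative[symmetric]])
  then obtain r where r: "0 < r" "r < t"
    "f (p + t *\<^sub>R v + t *\<^sub>R u) - f (p + t *\<^sub>R u) - (f (p + t *\<^sub>R v) - f p)
       = t * (?D (p + t *\<^sub>R v + r *\<^sub>R u) - ?D (p + r *\<^sub>R u))"
    by auto
  have "\<exists>s. 0 < s \<and> s < t \<and> ?D (p + r *\<^sub>R u + t *\<^sub>R v) - ?D (p + r *\<^sub>R u + 0 *\<^sub>R v)
      = (t - 0) * frechet_derivative ?D (at (p + r *\<^sub>R u + s *\<^sub>R v)) v"
    by (rule MVT2[OF t]) (intro smooth_line_derivative[OF smooth_frechet[OF f], unfolded has_real_derivative_iff_has_vector_derivative[symmetric]])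
  then obtain s where s: "0 < s" "s < t"
    "?D (p + r *\<^sub>R u + t *\<^sub>R v) - ?D (p + r *\<^sub>R u) = t * frechet_derivative ?D (at (p + r *\<^sub>R u + s *\<^sub>R v)) v"
    by auto
  have "f (p + t *\<^sub>R u + t *\<^sub>R v) - f (p + t *\<^sub>R u) - f (p + t *\<^sub>R v) + f p
      = t * (?D (p + r *\<^sub>R u + t *\<^sub>R v) - ?D (p + r *\<^sub>R u))"
    using r(3) by (simp add: ac_simps)
  also have "\<dots> = t\<^sup>2 * frechet_derivative ?D (at (p + r *\<^sub>R u + s *\<^sub>R v)) v"
    unfolding s(3) by (simp add: power2_eq_square)
  finally show ?thesis using r s that by blast
qed

lemma second_difference_limit:
  fixes f :: "'a::findim \<Rightarrow> real"
  assumes f: "smooth f"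
  shows "((\<lambda>t. (f (p + t *\<^sub>R u + t *\<^sub>R v) - f (p + t *\<^sub>R u) - f (p + t *\<^sub>R v) + f p) / t\<^sup>2)
      \<longlongrightarrow> frechet_derivative (\<lambda>x. frechet_derivative f (at x) u) (at p) v) (at_right 0)"
proof -
  let ?H = "\<lambda>x. frechet_derivative (\<lambda>x. frechet_derivative f (at x) u) (at x) v"
  let ?q = "\<lambda>t. (f (p + t *\<^sub>R u + t *\<^sub>R v) - f (p + t *\<^sub>R u) - f (p + t *\<^sub>R v) + f p) / t\<^sup>2"
  have "\<exists>r s. 0 < r \<and> r < t \<and> 0 < s \<and> s < t \<and> ?q t = ?H (p + r *\<^sub>R u + s *\<^sub>R v)" if t: "t > 0" for t
    by (rule second_difference_mean_value[OF f t, of p u v]) (use t in auto)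
  then obtain r s where rs: "\<And>t. t > 0 \<Longrightarrow> 0 < r t \<and> r t < t \<and> 0 < s t \<and> s t < t
      \<and> ?q t = ?H (p + r t *\<^sub>R u + s t *\<^sub>R v)"
    by metis
  have ev: "eventually (\<lambda>t::real. t > 0) (at_right 0)"
    by (simp add: eventually_at_right_less)
  have "(r \<longlongrightarrow> 0) (at_right 0)"
    by (rule tendsto_sandwich[OF eventually_mono[OF ev] eventually_mono[OF ev] tendsto_const tendsto_ident_at])
      (use rs in \<open>auto intro: less_imp_le\<close>)
  moreover have "(s \<longlongrightarrow> 0) (at_right 0)"
    by (rule tendsto_sandwich[OF eventually_mono[OF ev] eventually_mono[OF ev] tendsto_const tendsto_ident_at])
      (use rs in \<open>auto intro: less_imp_le\<close>)
  ultimately have "((\<lambda>t. p + r t *\<^sub>R u + s t *\<^sub>R v) \<longlongrightarrow> p + 0 *\<^sub>R u + 0 *\<^sub>R v) (at_right 0)"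
    by (intro tendsto_intros)
  then have "((\<lambda>t. p + r t *\<^sub>R u + s t *\<^sub>R v) \<longlongrightarrow> p) (at_right 0)" by simp
  then have "((\<lambda>t. ?H (p + r t *\<^sub>R u + s t *\<^sub>R v)) \<longlongrightarrow> ?H p) (at_right 0)"
    using isCont_tendsto_compose[OF smooth_continuous[OF smooth_frechet[OF smooth_frechet[OF f]]]] by blast
  then show ?thesis
    by (rule Lim_transform_eventually[OF _ eventually_mono[OF ev]]) (use rs in metis)
qed

lemma second_derivative_symmetric:
  fixes f :: "'a::findim \<Rightarrow> real"
  assumes "smooth f"
  shows "frechet_derivative (\<lambda>x. frechet_derivative f (at x) u) (at p) v
       = frechet_derivative (\<lambda>x. frechet_derivative f (at x) v) (at p) u"
proof (rule tendsto_unique[OF _ second_difference_limit[OF assms]])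
  show "((\<lambda>t. (f (p + t *\<^sub>R u + t *\<^sub>R v) - f (p + t *\<^sub>R u) - f (p + t *\<^sub>R v) + f p) / t\<^sup>2)
      \<longlongrightarrow> frechet_derivative (\<lambda>x. frechet_derivative f (at x) v) (at p) u) (at_right 0)"
    using second_difference_limit[OF assms, of p v u] by (simp add: algebra_simps)
qed simp

text \<open>
  The second-order part, isolated as the first summand, is what cancels in a commutator of vector
  fields.
\<close>

lemma frechet_derivative_along:
  fixes f :: "'a::findim \<Rightarrow> real"
  assumes f: "smooth f" and g: "smooth (g :: 'a \<Rightarrow> 'a)"
  shows "frechet_derivative (\<lambda>x. frechet_derivative f (at x) (g x)) (at p) v
    = frechet_derivative (\<lambda>x. frechet_derivative f (at x) (g p)) (at p) v
      + frechet_derivative f (at p) (frechet_derivative g (at p) v)"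
proof -
  obtain B :: "'a set" and c where c: "finite B" "\<And>b. bounded_linear (c b)"
    "\<And>x. (\<Sum>b\<in>B. c b x *\<^sub>R b) = x"
    by (rule findim_coordinates) blast
  let ?D = "\<lambda>x. frechet_derivative f (at x)"
  have lin: "linear (?D x)" for x by (rule smooth_linear_derivative[OF f])
  have eq: "(\<lambda>x. ?D x (h x)) = (\<lambda>x. \<Sum>b\<in>B. c b (h x) *\<^sub>R ?D x b)" for h :: "'a \<Rightarrow> 'a"
    using linear_eq_sum_coordinates[OF c(3) lin] by (metis (no_types))
  have "((\<lambda>x. \<Sum>b\<in>B. c b (h x) *\<^sub>R ?D x b) has_derivative
      (\<lambda>v. \<Sum>b\<in>B. c b (h p) *\<^sub>R frechet_derivative (\<lambda>x. ?D x b) (at p) v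
        + c b (frechet_derivative h (at p) v) *\<^sub>R ?D p b)) (at p)" if "smooth h" for h
    by (intro has_derivative_sum has_derivative_scaleR smooth_has_derivative smooth_frechet f
        bounded_linear.has_derivative[OF c(2)] that)
  note d = frechet_derivative_eqI[OF this, folded eq]
  show ?thesis
    using d[OF g] d[OF smooth_const, of "g p"] linear_eq_sum_coordinates[OF c(3) lin[of p]]
    by (simp add: sum.distrib linear_0[OF bounded_linear.linear[OF c(2)]])
qed

section \<open>Homogeneous smooth functions on a graded vector space\<close>

text \<open>
  The point \<open>0\<close> lies in the closure of every orbit of the scaling action.
\<close>

lemma homogeneous_weight_0:
  fixes F :: "'g::findim \<times> 'c::findim \<Rightarrow> 'w::real_normed_vector"
  assumes F: "smooth F" and h: "\<And>s y z. s \<noteq> 0 \<Longrightarrow> F (s *\<^sub>R y, s\<^sup>2 *\<^sub>R z) = F (y, z)"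
  shows "F p = F 0"
proof -
  obtain y z where p: "p = (y, z)" by fastforce
  have "((\<lambda>s. (s *\<^sub>R y, s\<^sup>2 *\<^sub>R z)) \<longlongrightarrow> (0 *\<^sub>R y, 0\<^sup>2 *\<^sub>R z)) (at (0::real))"
    by (intro tendsto_intros)
  then have "((\<lambda>s. F (s *\<^sub>R y, s\<^sup>2 *\<^sub>R z)) \<longlongrightarrow> F 0) (at (0::real))"
    using isCont_tendsto_compose[OF smooth_continuous[OF F]] by (auto simp: zero_prod_def)
  then have "((\<lambda>s::real. F p) \<longlongrightarrow> F 0) (at 0)"
    by (rule Lim_transform_eventually) (auto simp: eventually_at_filter h p)
  then show ?thesis by (simp add: tendsto_const_iff)
qed

lemma homogeneous_weight_minus_1:
  fixes F :: "'g::findim \<times> 'c::findim \<Rightarrow> 'w::real_normed_vector"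
  assumes F: "smooth F" and h: "\<And>s y z. s \<noteq> 0 \<Longrightarrow> s *\<^sub>R F (s *\<^sub>R y, s\<^sup>2 *\<^sub>R z) = F (y, z)"
  shows "F p = 0"
proof -
  obtain y z where p: "p = (y, z)" by fastforce
  have "((\<lambda>s. (s *\<^sub>R y, s\<^sup>2 *\<^sub>R z)) \<longlongrightarrow> (0 *\<^sub>R y, 0\<^sup>2 *\<^sub>R z)) (at (0::real))"
    by (intro tendsto_intros)
  then have "((\<lambda>s. (s *\<^sub>R y, s\<^sup>2 *\<^sub>R z)) \<longlongrightarrow> 0) (at (0::real))" by (simp add: zero_prod_def)
  from isCont_tendsto_compose[OF smooth_continuous[OF F] this]
  have "((\<lambda>s. s *\<^sub>R F (s *\<^sub>R y, s\<^sup>2 *\<^sub>R z)) \<longlongrightarrow> 0 *\<^sub>R F 0) (at (0::real))"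
    by (intro tendsto_intros)
  then have "((\<lambda>s::real. F p) \<longlongrightarrow> 0 *\<^sub>R F 0) (at 0)"
    by (rule Lim_transform_eventually) (auto simp: eventually_at_filter h p)
  then show ?thesis by (simp add: tendsto_const_iff)
qed

lemma graded_line_derivative:
  fixes F :: "'g::findim \<times> 'c::findim \<Rightarrow> 'w::real_normed_vector"
  assumes F: "smooth F"
  shows "((\<lambda>s. F (s *\<^sub>R y, s\<^sup>2 *\<^sub>R z)) has_vector_derivative
     frechet_derivative F (at (s *\<^sub>R y, s\<^sup>2 *\<^sub>R z)) (y, (2 * s) *\<^sub>R z)) (at s)"
  by (rule smooth_comp_has_vector_derivative[OF F])
    (auto intro!: derivative_eq_intros simp: has_vector_derivative_def algebra_simps)

text \<open>
  At \<open>s = 0\<close> the derivative of \<open>s \<mapsto> F (s y, s\<^sup>2 z)\<close> only involves \<open>y\<close>. In the homogeneity lemmas the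
  coefficients of the polynomial are expressed by values of the function and not by derivatives, so
  that linear dependence of the function on a parameter is inherited by the coefficients.
\<close>

lemma homogeneous_weight_1:
  fixes F :: "'g::findim \<times> 'c::findim \<Rightarrow> 'w::real_normed_vector"
  assumes F: "smooth F" and h: "\<And>s y z. s \<noteq> 0 \<Longrightarrow> F (s *\<^sub>R y, s\<^sup>2 *\<^sub>R z) = s *\<^sub>R F (y, z)"
  shows "linear (\<lambda>y. F (y, 0))" "F (y, z) = F (y, 0)"
proof -
  let ?A = "\<lambda>y. frechet_derivative F (at 0) (y, 0)"
  have lin: "linear ?A"
    by (rule linear_compose[of "\<lambda>y. (y, 0)", unfolded o_def, OF _ smooth_linear_derivative[OF F]])
      (simp add: linear_iff)
  have "1 *\<^sub>R F (0, 0) = 2 *\<^sub>R F (0, 0)"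
    using h[of 2 0 0] by (simp only: scaleR_zero_right scaleR_one)
  then have F0: "F (0, 0) = 0"
    unfolding scaleR_cancel_right by simp
  have "F (y, z) = ?A y" for y z
  proof -
    have "(\<lambda>s. F (s *\<^sub>R y, s\<^sup>2 *\<^sub>R z)) = (\<lambda>s. s *\<^sub>R F (y, z))"
    proof
      show "F (s *\<^sub>R y, s\<^sup>2 *\<^sub>R z) = s *\<^sub>R F (y, z)" for s
        by (cases "s = 0") (simp_all add: F0 h)
    qed
    then have "((\<lambda>s. s *\<^sub>R F (y, z)) has_vector_derivative ?A y) (at 0)"
      using graded_line_derivative[OF F, of y z 0] by (simp add: zero_prod_def)
    moreover have "((\<lambda>s. s *\<^sub>R F (y, z)) has_vector_derivative F (y, z)) (at 0)"
      by (auto intro!: derivative_eq_intros)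
    ultimately show ?thesis by (metis vector_derivative_unique_at)
  qed
  with lin show "linear (\<lambda>y. F (y, 0))" "F (y, z) = F (y, 0)" by simp_all
qed

text \<open>
  The bilinear form with \<open>polar_form q u u = q u\<close> when \<open>q\<close> is quadratic.
\<close>

definition polar_form :: "('g::real_vector \<Rightarrow> 'w::real_vector) \<Rightarrow> 'g \<Rightarrow> 'g \<Rightarrow> 'w" where
  "polar_form q u v = (1/2) *\<^sub>R (q (u + v) - q u - q v)"

text \<open>
  The homogeneity relation is differentiated twice at \<open>s = 0\<close>.
\<close>

lemma homogeneous_weight_2:
  fixes G :: "'g::findim \<times> 'c::findim \<Rightarrow> 'w::real_normed_vector"
  assumes G: "smooth G" and h: "\<And>s y z. s \<noteq> 0 \<Longrightarrow> G (s *\<^sub>R y, s\<^sup>2 *\<^sub>R z) = s\<^sup>2 *\<^sub>R G (y, z)"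
  shows "linear (\<lambda>z. G (0, z))" "sym_bilin (polar_form (\<lambda>y. G (y, 0)))"
    "G (y, z) = G (0, z) + polar_form (\<lambda>y. G (y, 0)) y y"
proof -
  let ?B = "\<lambda>z. frechet_derivative G (at 0) (0, z)"
  let ?D = "\<lambda>y. frechet_derivative (\<lambda>p. frechet_derivative G (at p) (y, 0)) (at 0)"
  let ?Q = "\<lambda>y u. ?D y (u, 0)"
  have lin: "linear (frechet_derivative G (at p))" for p by (rule smooth_linear_derivative[OF G])
  have linB: "linear ?B"
    by (rule linear_compose[of "\<lambda>z. (0, z)", unfolded o_def, OF _ lin]) (simp add: linear_iff)
  have "1 *\<^sub>R G (0, 0) = 2\<^sup>2 *\<^sub>R G (0, 0)"
    using h[of 2 0 0] by (simp only: scaleR_zero_right scaleR_one)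
  then have G0: "G (0, 0) = 0"
    unfolding scaleR_cancel_right by simp
  have key: "2 *\<^sub>R G (y, z) = 2 *\<^sub>R ?B z + ?Q y y" for y z
  proof -
    have "(\<lambda>s. G (s *\<^sub>R y, s\<^sup>2 *\<^sub>R z)) = (\<lambda>s. s\<^sup>2 *\<^sub>R G (y, z))"
    proof
      show "G (s *\<^sub>R y, s\<^sup>2 *\<^sub>R z) = s\<^sup>2 *\<^sub>R G (y, z)" for s
        by (cases "s = 0") (simp_all add: G0 h)
    qed
    then have "((\<lambda>s. s\<^sup>2 *\<^sub>R G (y, z)) has_vector_derivative
        frechet_derivative G (at (s *\<^sub>R y, s\<^sup>2 *\<^sub>R z)) (y, (2 * s) *\<^sub>R z)) (at s)" for s
      using graded_line_derivative[OF G, of y z s] by simp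
    moreover have "((\<lambda>s. s\<^sup>2 *\<^sub>R G (y, z)) has_vector_derivative (2 * s) *\<^sub>R G (y, z)) (at s)" for s
      by (auto intro!: derivative_eq_intros simp: has_vector_derivative_def algebra_simps)
    ultimately have "(2 * s) *\<^sub>R G (y, z)
        = frechet_derivative G (at (s *\<^sub>R y, s\<^sup>2 *\<^sub>R z)) (y, (2 * s) *\<^sub>R z)" for s
      by (metis vector_derivative_unique_at)
    moreover have "(y, (2 * s) *\<^sub>R z) = (y, 0) + (2 * s) *\<^sub>R (0, z)" for s by simp
    ultimately have "(2 * s) *\<^sub>R G (y, z)
        = frechet_derivative G (at (s *\<^sub>R y, s\<^sup>2 *\<^sub>R z)) (y, 0)
          + (2 * s) *\<^sub>R frechet_derivative G (at (s *\<^sub>R y, s\<^sup>2 *\<^sub>R z)) (0, z)" for s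
      by (simp only: linear_add[OF lin] linear_scale[OF lin])
    then have eq: "(\<lambda>s. (2 * s) *\<^sub>R G (y, z)) = (\<lambda>s. frechet_derivative G (at (s *\<^sub>R y, s\<^sup>2 *\<^sub>R z)) (y, 0)
          + (2 * s) *\<^sub>R frechet_derivative G (at (s *\<^sub>R y, s\<^sup>2 *\<^sub>R z)) (0, z))"
      by (rule ext)
    have d: "((\<lambda>s. frechet_derivative G (at (s *\<^sub>R y, s\<^sup>2 *\<^sub>R z)) w) has_vector_derivative
        frechet_derivative (\<lambda>p. frechet_derivative G (at p) w) (at 0) (y, 0)) (at 0)" for w
      using graded_line_derivative[OF smooth_frechet[OF G, of w], of y z 0] by (simp add: zero_prod_def)
    have d2: "((\<lambda>s::real. 2 * s) has_field_derivative 2) (at 0)"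
      by (auto intro!: derivative_eq_intros)
    have "((\<lambda>s. frechet_derivative G (at (s *\<^sub>R y, s\<^sup>2 *\<^sub>R z)) (y, 0)
          + (2 * s) *\<^sub>R frechet_derivative G (at (s *\<^sub>R y, s\<^sup>2 *\<^sub>R z)) (0, z))
        has_vector_derivative ?D y (y, 0) + ((2 * 0) *\<^sub>R
          frechet_derivative (\<lambda>p. frechet_derivative G (at p) (0, z)) (at 0) (y, 0)
          + 2 *\<^sub>R frechet_derivative G (at (0 *\<^sub>R y, 0\<^sup>2 *\<^sub>R z)) (0, z))) (at 0)"
      by (intro has_vector_derivative_add has_vector_derivative_scaleR d d2)
    then have "((\<lambda>s. (2 * s) *\<^sub>R G (y, z)) has_vector_derivative 2 *\<^sub>R ?B z + ?D y (y, 0)) (at 0)"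
      unfolding eq by (simp add: add.commute zero_prod_def)
    moreover have "((\<lambda>s. (2 * s) *\<^sub>R G (y, z)) has_vector_derivative 2 *\<^sub>R G (y, z)) (at 0)"
      by (auto intro!: derivative_eq_intros simp: has_vector_derivative_def algebra_simps)
    ultimately show ?thesis by (metis vector_derivative_unique_at)
  qed
  have Q1: "linear (?Q y)" for y
    by (rule linear_compose[of "\<lambda>u. (u, 0)", unfolded o_def, OF _ smooth_linear_derivative[OF smooth_frechet[OF G]]])
      (simp add: linear_iff)
  have Q2: "linear (\<lambda>y. ?Q y u)" for u
  proof
    fix a b :: 'g and r :: real
    have "(\<lambda>p. frechet_derivative G (at p) (a + b, 0))
        = (\<lambda>p. frechet_derivative G (at p) (a, 0) + frechet_derivative G (at p) (b, 0))"
      by (simp add: linear_add[OF lin, symmetric])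
    moreover have "frechet_derivative \<dots> (at 0) = (\<lambda>v. ?D a v + ?D b v)"
      by (intro frechet_derivative_eqI has_derivative_add smooth_has_derivative smooth_frechet G)
    ultimately show "?Q (a + b) u = ?Q a u + ?Q b u" by simp
    have "(\<lambda>p. frechet_derivative G (at p) (r *\<^sub>R a, 0))
        = (\<lambda>p. r *\<^sub>R frechet_derivative G (at p) (a, 0))"
      by (simp add: linear_scale[OF lin, symmetric])
    moreover have "frechet_derivative \<dots> (at 0) = (\<lambda>v. r *\<^sub>R ?D a v)"
      by (intro frechet_derivative_eqI has_derivative_scaleR_right smooth_has_derivative smooth_frechet G)
    ultimately show "?Q (r *\<^sub>R a) u = r *\<^sub>R ?Q a u" by simp
  qed
  \<comment> \<open>the factor \<open>2\<close> in \<open>key\<close> is the second derivative of \<open>s\<^sup>2\<close>\<close>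
  have half: "G (y, z) = ?B z + (1/2) *\<^sub>R ?Q y y" for y z
  proof -
    have "G (y, z) = (1/2) *\<^sub>R (2 *\<^sub>R G (y, z))" by simp
    also have "\<dots> = ?B z + (1/2) *\<^sub>R ?Q y y" unfolding key by (simp add: scaleR_right_distrib)
    finally show ?thesis .
  qed
  have B0: "?B 0 = 0" using linear_0[OF linB] .
  have Q0: "?Q 0 0 = 0" using linear_0[OF Q1] .
  have pol: "polar_form (\<lambda>y. G (y, 0)) u v = (1/4) *\<^sub>R (?Q u v + ?Q v u)" for u v
    unfolding polar_form_def half B0
    by (simp add: linear_add[OF Q1] linear_add[OF Q2] scaleR_right_distrib scaleR_right_diff_distrib)
  show "linear (\<lambda>z. G (0, z))"
    unfolding half Q0 using linB by simp
  show "sym_bilin (polar_form (\<lambda>y. G (y, 0)))"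
    unfolding sym_bilin_def bilinear_def pol
    by (auto intro!: linear_compose_add linear_compose_scale_right Q1 Q2)
  show "G (y, z) = G (0, z) + polar_form (\<lambda>y. G (y, 0)) y y"
    unfolding pol unfolding half Q0 by (simp add: scaleR_2[symmetric])
qed

section \<open>Graded bundles in coordinates\<close>

text \<open>
  A splitting is a single global coordinate system. Objects that are defined by quantifying over all
  charts are computed through \<open>S\<close> alone.
\<close>

locale graded_coords =
  fixes E :: "('e, 'g::findim, 'c::findim, 'z) graded2_scheme" and S :: "'g \<times> 'c \<Rightarrow> 'e"
  assumes graded: "graded_bundle2 E" and splits: "graded_splitting E S"
begin

lemma bij_S: "bij S" and proj_S [simp]: "proj E (S (x, c)) = x" and S_core: "S (0, c) = core E c"
  using splits by (auto simp: graded_splitting_def)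

lemma proj_S_fst: "proj E (S p) = fst p"
  by (cases p) simp

lemma inv_S [simp]: "inv S (S p) = p"
  by (simp add: bij_S bij_is_inj)

lemma S_inv [simp]: "S (inv S e) = e"
  by (simp add: bij_S bij_is_surj surj_f_inv_f)

lemma S_eq_iff [simp]: "S p = S q \<longleftrightarrow> p = q"
  by (metis inv_S)

lemma transition:
  assumes "\<psi> \<in> charts E"
  obtains A B Q where "linear A" "bij A" "linear B" "bij B" "bilinear Q"
    "\<And>y z. \<psi> (S (y, z)) = (A y, B z + Q y y)"
proof -
  obtain A B Q where lin: "linear A" "linear B" "bilinear Q"
    and \<psi>: "\<And>y z. \<psi> (S (y, z)) = (A y, B z + Q y y)"
    using splits assms unfolding graded_splitting_def graded_poly_def o_def by blast
  obtain A' B' where A': "linear A'" "bij A'" "\<And>e. fst (\<psi> e) = A' (proj E e)"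
    and B': "linear B'" "bij B'" "\<And>v. \<psi> (core E v) = (0, B' v)"
    using graded assms unfolding graded_bundle2_def by blast
  have eq: "A y = A' y" for y using A'(3)[of "S (y, 0)"] by (simp add: \<psi>)
  moreover have "B v = B' v" for v
    using B'(3)[of v] \<psi>[of 0 v] lin(3) by (simp add: S_core bilinear_lzero)
  ultimately have "A = A'" "B = B'" by auto
  with A' B' lin \<psi> show thesis by (intro that[of A B Q]) simp_all
qed

lemma transition_smooth:
  assumes "\<psi> \<in> charts E"
  shows "smooth (\<psi> \<circ> S)" "smooth (inv S \<circ> inv \<psi>)"
proof -
  obtain A B Q where T: "linear A" "bij A" "linear B" "bij B" "bilinear Q"
    "\<And>y z. \<psi> (S (y, z)) = (A y, B z + Q y y)"
    using transition[OF assms] by metis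
  have eq: "\<psi> \<circ> S = (\<lambda>p. (A (fst p), B (snd p) + Q (fst p) (fst p)))"
    by (auto simp: T(6))
  show "smooth (\<psi> \<circ> S)"
    unfolding eq
    by (intro smooth_intros smooth_linear_comp[OF T(1)] smooth_linear_comp[OF T(3)] smooth_bilinear[OF T(5)])
  have inv: "inj \<psi>" "linear (inv A)" "linear (inv B)" "A (inv A u) = u" "B (inv B v) = v" for u v
    using graded assms T(1-4)
    by (auto simp: graded_bundle2_def linear_inv_of_bij bij_is_inj bij_is_surj surj_f_inv_f)
  have bl: "bilinear (\<lambda>u v. - Q (inv A u) (inv A v))"
    using T(5) inv(2) unfolding bilinear_def
    by (auto intro!: linear_compose_neg linear_compose[unfolded o_def, of "inv A"])
  have "inv S (inv \<psi> (u, v)) = (inv A u, inv B (v + - Q (inv A u) (inv A u)))" for u v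
  proof -
    have "\<psi> (S (inv A u, inv B (v + - Q (inv A u) (inv A u)))) = (u, v)"
      by (simp add: T(6) inv(4,5))
    then show ?thesis by (metis inv(1) inv_S inv_f_f)
  qed
  then have eq2: "inv S \<circ> inv \<psi> = (\<lambda>p. (inv A (fst p), inv B (snd p + - Q (inv A (fst p)) (inv A (fst p)))))"
    by auto
  show "smooth (inv S \<circ> inv \<psi>)"
    unfolding eq2
    by (intro smooth_intros smooth_linear_comp[OF inv(2)] smooth_linear_comp[OF inv(3)] smooth_bilinear[OF bl])
qed

lemma charts_nonempty: "charts E \<noteq> {}"
  and chart_bij: "\<psi> \<in> charts E \<Longrightarrow> bij \<psi>"
  using graded by (auto simp: graded_bundle2_def)

lemma chart_inj: "\<psi> \<in> charts E \<Longrightarrow> \<psi> e = \<psi> e' \<longleftrightarrow> e = e'"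
  using chart_bij bij_is_inj inj_eq by metis

lemma smooth_fun_iff: "f \<in> smooth_fun E \<longleftrightarrow> smooth (f \<circ> S)"
proof
  assume f: "f \<in> smooth_fun E"
  obtain \<psi> where \<psi>: "\<psi> \<in> charts E" using charts_nonempty by blast
  have eq: "f \<circ> S = (\<lambda>p. (f \<circ> inv \<psi>) ((\<psi> \<circ> S) p))"
    using chart_bij[OF \<psi>] by (auto simp: bij_is_inj)
  show "smooth (f \<circ> S)"
    unfolding eq
    by (rule smooth_compose[OF _ transition_smooth(1)[OF \<psi>]]) (use f \<psi> in \<open>simp add: smooth_fun_def o_def\<close>)
next
  assume f: "smooth (f \<circ> S)"
  have "smooth (f \<circ> inv \<psi>)" if \<psi>: "\<psi> \<in> charts E" for \<psi>
  proof -
    have eq: "f \<circ> inv \<psi> = (\<lambda>p. (f \<circ> S) ((inv S \<circ> inv \<psi>) p))" by auto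
    show ?thesis unfolding eq
      by (rule smooth_compose[OF f transition_smooth(2)[OF \<psi>]])
  qed
  then show "f \<in> smooth_fun E" by (simp add: smooth_fun_def)
qed

lemma smooth_curve_iff: "\<gamma> \<in> smooth_curve E \<longleftrightarrow> smooth (inv S \<circ> \<gamma>)"
proof
  assume g: "\<gamma> \<in> smooth_curve E"
  obtain \<psi> where \<psi>: "\<psi> \<in> charts E" using charts_nonempty by blast
  have eq: "inv S \<circ> \<gamma> = (\<lambda>t. (inv S \<circ> inv \<psi>) ((\<psi> \<circ> \<gamma>) t))"
    using chart_bij[OF \<psi>] by (auto simp: bij_is_inj)
  show "smooth (inv S \<circ> \<gamma>)"
    unfolding eq
    by (rule smooth_compose[OF transition_smooth(2)[OF \<psi>]]) (use g \<psi> in \<open>simp add: smooth_curve_def o_def\<close>)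
next
  assume g: "smooth (inv S \<circ> \<gamma>)"
  have "smooth (\<psi> \<circ> \<gamma>)" if \<psi>: "\<psi> \<in> charts E" for \<psi>
  proof -
    have eq: "\<psi> \<circ> \<gamma> = (\<lambda>t. (\<psi> \<circ> S) ((inv S \<circ> \<gamma>) t))" by auto
    show ?thesis unfolding eq
      by (rule smooth_compose[OF transition_smooth(1)[OF \<psi>] g])
  qed
  then show "\<gamma> \<in> smooth_curve E" by (simp add: smooth_curve_def)
qed

lemma act_S: "act E t (S (y, z)) = S (t *\<^sub>R y, t\<^sup>2 *\<^sub>R z)"
proof -
  have *: "\<psi> (S (t *\<^sub>R y, t\<^sup>2 *\<^sub>R z)) = (t *\<^sub>R fst (\<psi> (S (y, z))), t\<^sup>2 *\<^sub>R snd (\<psi> (S (y, z))))"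
    if \<psi>: "\<psi> \<in> charts E" for \<psi>
  proof -
    obtain A B Q where T: "linear A" "bij A" "linear B" "bij B" "bilinear Q"
      "\<And>y z. \<psi> (S (y, z)) = (A y, B z + Q y y)"
      using transition[OF \<psi>] by metis
    show ?thesis
      by (simp add: T(6) linear_scale[OF T(1)] linear_scale[OF T(3)] bilinear_lmul[OF T(5)]
          bilinear_rmul[OF T(5)] scaleR_right_distrib power2_eq_square)
  qed
  show ?thesis unfolding act_def
  proof (rule the_equality)
    fix e assume "\<forall>\<psi>\<in>charts E. \<psi> e = (t *\<^sub>R fst (\<psi> (S (y, z))), t\<^sup>2 *\<^sub>R snd (\<psi> (S (y, z))))"
    then show "e = S (t *\<^sub>R y, t\<^sup>2 *\<^sub>R z)"
      using * charts_nonempty chart_inj by (metis all_not_in_conv)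
  qed (use * in blast)
qed

lemma add_core_S: "add_core E (S (y, z)) v = S (y, z + v)"
proof -
  have *: "\<psi> (S (y, z + v)) = \<psi> (S (y, z)) + \<psi> (core E v)"
    if \<psi>: "\<psi> \<in> charts E" for \<psi>
  proof -
    obtain A B Q where T: "linear A" "bij A" "linear B" "bij B" "bilinear Q"
      "\<And>y z. \<psi> (S (y, z)) = (A y, B z + Q y y)"
      using transition[OF \<psi>] by metis
    show ?thesis
      unfolding S_core[symmetric]
      by (simp add: T(6) linear_0[OF T(1)] linear_add[OF T(3)] bilinear_lzero[OF T(5)])
  qed
  show ?thesis unfolding add_core_def
  proof (rule the_equality)
    fix e assume "\<forall>\<psi>\<in>charts E. \<psi> e = \<psi> (S (y, z)) + \<psi> (core E v)"
    then show "e = S (y, z + v)"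
      using * charts_nonempty chart_inj by (metis all_not_in_conv)
  qed (use * in blast)
qed

text \<open>
  The canonical splitting differs from an arbitrary one by such a shear.
\<close>

lemma shear_splitting:
  assumes Q: "bilinear Q"
  shows "graded_splitting E (\<lambda>(y, z). S (y, z + Q y y))"
proof -
  let ?S = "\<lambda>(y, z). S (y, z + Q y y)"
  have "bij ?S"
  proof (rule bij_betw_byWitness[where f' = "\<lambda>e. (fst (inv S e), snd (inv S e) - Q (fst (inv S e)) (fst (inv S e)))"])
  qed auto
  moreover have "graded_poly (\<psi> \<circ> ?S)" if \<psi>: "\<psi> \<in> charts E" for \<psi>
  proof -
    obtain A B R where T: "linear A" "bij A" "linear B" "bij B" "bilinear R"
      "\<And>y z. \<psi> (S (y, z)) = (A y, B z + R y y)"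
      using transition[OF \<psi>] by metis
    have "bilinear (\<lambda>u v. B (Q u v) + R u v)"
      using Q T(3,5) unfolding bilinear_def
      by (auto intro!: linear_compose_add linear_compose[unfolded o_def, of _ B])
    then show ?thesis
      unfolding graded_poly_def
      by (intro exI[of _ A] exI[of _ B] exI[of _ "\<lambda>u v. B (Q u v) + R u v"])
        (simp add: T linear_add[OF T(3)])
  qed
  ultimately show ?thesis
    using Q by (auto simp: graded_splitting_def S_core bilinear_lzero)
qed

end

text \<open>
  A chart becomes a splitting after composition with the linear isomorphisms by which it sees the
  order-one reduction and the core.
\<close>

lemma graded_bundle2_has_splitting:
  fixes E :: "('e, 'g::findim, 'c::findim, 'z) graded2_scheme"
  assumes E: "graded_bundle2 E"
  shows "\<exists>S. graded_splitting E S"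
proof -
  obtain \<psi> where \<psi>: "\<psi> \<in> charts E" using E by (auto simp: graded_bundle2_def)
  have "\<exists>A. linear A \<and> bij A \<and> (\<forall>e. fst (\<psi> e) = A (proj E e))"
    "\<exists>B. linear B \<and> bij B \<and> (\<forall>v. \<psi> (core E v) = (0, B v))"
    and b: "bij \<psi>" and gp: "\<And>\<phi>. \<phi> \<in> charts E \<Longrightarrow> graded_poly (\<phi> \<circ> inv \<psi>)"
    using E \<psi> by (simp_all add: graded_bundle2_def)
  then obtain A B where A: "linear A" "bij A" "\<And>e. fst (\<psi> e) = A (proj E e)"
    and B: "linear B" "bij B" "\<And>v. \<psi> (core E v) = (0, B v)"
    by auto
  define S where "S = (\<lambda>(y, z). inv \<psi> (A y, B z))"
  have inv: "\<psi> (inv \<psi> p) = p" "inv \<psi> (\<psi> e) = e" "A (inv A u) = u" "B (inv B v) = v"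
    "inv A (A u) = u" "inv B (B v) = v" for p e u v
    using b A(2) B(2) by (simp_all add: bij_is_inj bij_is_surj surj_f_inv_f)
  have "bij S"
  proof (rule bij_betw_byWitness[where f' = "\<lambda>e. (inv A (fst (\<psi> e)), inv B (snd (\<psi> e)))"])
  qed (auto simp: S_def inv)
  moreover have "graded_poly (\<phi> \<circ> S)" if \<phi>: "\<phi> \<in> charts E" for \<phi>
  proof -
    obtain A' B' Q where T: "linear A'" "linear B'" "bilinear Q"
      "\<And>y z. \<phi> (inv \<psi> (y, z)) = (A' y, B' z + Q y y)"
      using gp[OF \<phi>] unfolding graded_poly_def o_def by blast
    have "bilinear (\<lambda>u v. Q (A u) (A v))"
      using T(3) A(1) unfolding bilinear_def by (auto intro: linear_compose[unfolded o_def, of A])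
    moreover have "linear (\<lambda>y. A' (A y))" "linear (\<lambda>z. B' (B z))"
      using linear_compose[OF A(1) T(1)] linear_compose[OF B(1) T(2)] by (simp_all add: o_def)
    ultimately show ?thesis
      unfolding graded_poly_def
      by (intro exI[of _ "\<lambda>y. A' (A y)"] exI[of _ "\<lambda>z. B' (B z)"] exI[of _ "\<lambda>u v. Q (A u) (A v)"])
        (simp add: S_def T(4))
  qed
  moreover have "proj E (S (x, c)) = x" for x c
  proof -
    have "A (proj E (S (x, c))) = A x" unfolding A(3)[symmetric] by (simp add: S_def inv)
    then show ?thesis by (metis inv(5))
  qed
  moreover have "S (0, c) = core E c" for c
    using B(3)[of c] inv(2)[of "core E c"] by (simp add: S_def linear_0[OF A(1)])
  ultimately show ?thesis unfolding graded_splitting_def by blast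
qed

section \<open>Tangent vectors and vector fields in coordinates\<close>

text \<open>
  The tangent vector at \<open>S p\<close> with components \<open>w\<close>, as a derivation.
\<close>

definition tv :: "('p::real_normed_vector \<Rightarrow> 'e) \<Rightarrow> 'p \<Rightarrow> 'p \<Rightarrow> 'e tvec" where
  "tv S p w = (\<lambda>f. if smooth (f \<circ> S) then frechet_derivative (f \<circ> S) (at p) w else 0)"

text \<open>
  The vector field whose components at \<open>S p\<close> are \<open>\<xi> p\<close>.
\<close>

definition vf :: "('p::real_normed_vector \<Rightarrow> 'e) \<Rightarrow> ('p \<Rightarrow> 'p) \<Rightarrow> 'e vfield" where
  "vf S \<xi> = (\<lambda>e. tv S (inv S e) (\<xi> (inv S e)))"

context graded_coords begin

lemma tv_functional:
  assumes "linear (l :: 'g \<times> 'c \<Rightarrow> real)"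
  shows "tv S p w (l \<circ> inv S) = l w"
proof -
  have "l \<circ> inv S \<circ> S = l" by (auto simp: fun_eq_iff)
  then show ?thesis
    using smooth_linear[OF assms] bounded_linear_imp_has_derivative[OF findim_linear_bounded[OF assms], THEN frechet_derivative_eqI]
    by (simp add: tv_def)
qed

lemma tv_eqD: assumes eq: "tv S p w = tv S p w'" shows "w = w'"
proof (rule findim_eq_if_functionals_eq)
    fix l :: "'g \<times> 'c \<Rightarrow> real" assume l: "linear l"
    show "l w = l w'"
      using tv_functional[OF l, of p w] tv_functional[OF l, of p w'] by (simp only: eq)
qed

lemma tv_eq_iff [simp]: "tv S p w = tv S p w' \<longleftrightarrow> w = w'"
  by (auto dest: tv_eqD)

lemma linear_tv: "linear (\<lambda>w. tv S p w f)"
  unfolding tv_def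
  by (cases "smooth (f \<circ> S)") (simp_all add: smooth_linear_derivative linear_zero)

lemma velocity_S:
  assumes "(\<gamma> has_vector_derivative w) (at 0)"
  shows "velocity E (\<lambda>t. S (\<gamma> t)) = tv S (\<gamma> 0) w"
proof
  fix f
  have "deriv (f \<circ> (\<lambda>t. S (\<gamma> t))) 0 = frechet_derivative (f \<circ> S) (at (\<gamma> 0)) w" if "smooth (f \<circ> S)"
    using smooth_comp_has_vector_derivative[OF that assms]
    by (intro DERIV_imp_deriv) (simp add: o_def has_real_derivative_iff_has_vector_derivative)
  then show "velocity E (\<lambda>t. S (\<gamma> t)) f = tv S (\<gamma> 0) w f"
    by (simp add: velocity_def tv_def smooth_fun_iff)
qed

lemma velocity_line: "velocity E (\<lambda>t. S (p + t *\<^sub>R w)) = tv S p w"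
proof -
  have "((\<lambda>t. p + t *\<^sub>R w) has_vector_derivative w) (at 0)"
    by (auto intro!: derivative_eq_intros)
  from velocity_S[OF this] show ?thesis by simp
qed

lemma smooth_curve_S: "smooth \<gamma> \<Longrightarrow> (\<lambda>t. S (\<gamma> t)) \<in> smooth_curve E"
  by (simp add: smooth_curve_iff o_def)

lemma velocity_smooth_curve:
  assumes "\<gamma> \<in> smooth_curve E"
  shows "velocity E \<gamma> = tv S (inv S (\<gamma> 0)) (vector_derivative (inv S \<circ> \<gamma>) (at 0))"
  using velocity_S[OF smooth_has_vector_derivative[of "inv S \<circ> \<gamma>"]] assms
  by (simp add: smooth_curve_iff)

lemma tangent_space_S: "tangent_space E (S p) = range (tv S p)"
proof (intro equalityI subsetI)
  fix v assume "v \<in> tangent_space E (S p)"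
  then obtain \<gamma> where "\<gamma> \<in> smooth_curve E" "\<gamma> 0 = S p" "v = velocity E \<gamma>"
    by (auto simp: tangent_space_def)
  then show "v \<in> range (tv S p)" by (simp add: velocity_smooth_curve)
next
  fix v assume "v \<in> range (tv S p)"
  then obtain w where w: "v = tv S p w" by blast
  have "(\<lambda>t. S (p + t *\<^sub>R w)) \<in> smooth_curve E"
    by (intro smooth_curve_S smooth_intros)
  then show "v \<in> tangent_space E (S p)"
    unfolding tangent_space_def w
    by (intro CollectI exI[of _ "\<lambda>t. S (p + t *\<^sub>R w)"]) (simp add: velocity_line)
qed

lemma vf_S [simp]: "vf S \<xi> (S p) = tv S p (\<xi> p)"
  by (simp add: vf_def)

lemma vf_eqI: "(\<And>p. X (S p) = tv S p (\<xi> p)) \<Longrightarrow> X = vf S \<xi>"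
  by (rule ext) (metis S_inv vf_def)

lemma vf_eq_iff [simp]: "vf S \<xi> = vf S \<eta> \<longleftrightarrow> \<xi> = \<eta>"
proof
  assume "vf S \<xi> = vf S \<eta>"
  then have "vf S \<xi> (S p) = vf S \<eta> (S p)" for p by simp
  then show "\<xi> = \<eta>" unfolding vf_S tv_eq_iff by blast
qed simp

lemma smooth_fun_vf:
  assumes \<xi>: "smooth \<xi>" and f: "f \<in> smooth_fun E"
  shows "(\<lambda>e. vf S \<xi> e f) \<in> smooth_fun E"
    "(\<lambda>e. vf S \<xi> e f) \<circ> S = (\<lambda>p. frechet_derivative (f \<circ> S) (at p) (\<xi> p))"
proof -
  have f': "smooth (f \<circ> S)" using f by (simp add: smooth_fun_iff)
  then show *: "(\<lambda>e. vf S \<xi> e f) \<circ> S = (\<lambda>p. frechet_derivative (f \<circ> S) (at p) (\<xi> p))"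
    by (auto simp: tv_def)
  show "(\<lambda>e. vf S \<xi> e f) \<in> smooth_fun E"
    unfolding smooth_fun_iff * by (rule smooth_derivative_along[OF f' smooth_ident \<xi>])
qed

lemma vf_vector_field: "smooth \<xi> \<Longrightarrow> vf S \<xi> \<in> vector_fields E"
proof -
  assume "smooth \<xi>"
  moreover have "vf S \<xi> e \<in> tangent_space E e" for e
    using tangent_space_S[of "inv S e"] by (simp add: vf_def)
  ultimately show ?thesis by (simp add: vector_fields_def smooth_fun_vf(1))
qed

text \<open>
  The commutator of derivations has no second-order part because second derivatives are symmetric.
\<close>

lemma lie_bracket_vf:
  assumes \<xi>: "smooth \<xi>" and \<eta>: "smooth \<eta>"
  shows "lie_bracket E (vf S \<xi>) (vf S \<eta>) = vf S (vs_bracket \<xi> \<eta>)"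
proof (rule vf_eqI, rule ext)
  fix p f
  show "lie_bracket E (vf S \<xi>) (vf S \<eta>) (S p) f = tv S p (vs_bracket \<xi> \<eta> p) f"
  proof (cases "f \<in> smooth_fun E")
    case True
    then have f: "smooth (f \<circ> S)" by (simp add: smooth_fun_iff)
    let ?F = "f \<circ> S"
    have *: "vf S \<alpha> (S p) (\<lambda>b. vf S \<beta> b f)
      = frechet_derivative (\<lambda>x. frechet_derivative ?F (at x) (\<beta> p)) (at p) (\<alpha> p)
      + frechet_derivative ?F (at p) (frechet_derivative \<beta> (at p) (\<alpha> p))"
      if "smooth \<beta>" for \<alpha> \<beta>
    proof -
      have "vf S \<alpha> (S p) (\<lambda>b. vf S \<beta> b f)
        = frechet_derivative (\<lambda>p. frechet_derivative (f \<circ> S) (at p) (\<beta> p)) (at p) (\<alpha> p)"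
        using smooth_fun_vf[OF that True]
        by (simp only: vf_S tv_def smooth_fun_iff if_True)
      then show ?thesis
        by (simp only: frechet_derivative_along[OF f that])
    qed
    have "lie_bracket E (vf S \<xi>) (vf S \<eta>) (S p) f
       = frechet_derivative ?F (at p) (frechet_derivative \<eta> (at p) (\<xi> p))
       - frechet_derivative ?F (at p) (frechet_derivative \<xi> (at p) (\<eta> p))"
      using True by (simp only: lie_bracket_def *[OF \<xi>] *[OF \<eta>] if_True
          second_derivative_symmetric[OF f, of "\<xi> p" p "\<eta> p"])
    also have "\<dots> = tv S p (vs_bracket \<xi> \<eta> p) f"
      using f by (simp add: tv_def vs_bracket_def linear_diff[OF smooth_linear_derivative[OF f]])
    finally show ?thesis .
  qed (simp add: lie_bracket_def tv_def smooth_fun_iff)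
qed

lemma scale_vf_vf: "scale_vf r (vf S \<xi>) = vf S (\<lambda>p. r *\<^sub>R \<xi> p)"
  by (rule vf_eqI) (simp add: scale_vf_def fun_eq_iff linear_scale[OF linear_tv])

lemma weight_vf_eq: "weight_vf E = vf S (\<lambda>(y, z). (y, 2 *\<^sub>R z))"
proof (rule vf_eqI)
  fix p :: "'g \<times> 'c"
  obtain y z where p: "p = (y, z)" by fastforce
  have "((\<lambda>t. ((1 + t) *\<^sub>R y, (1 + t)\<^sup>2 *\<^sub>R z)) has_vector_derivative (y, 2 *\<^sub>R z)) (at 0)"
    by (auto intro!: derivative_eq_intros simp: has_vector_derivative_def algebra_simps)
  from velocity_S[OF this] show "weight_vf E (S p) = tv S p (case p of (y, z) \<Rightarrow> (y, 2 *\<^sub>R z))"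
    by (simp add: weight_vf_def p act_S)
qed

lemma core_vf_eq: "core_vf E v = vf S (\<lambda>_. (0, v))"
proof (rule vf_eqI)
  fix p :: "'g \<times> 'c"
  obtain y z where p: "p = (y, z)" by fastforce
  show "core_vf E v (S p) = tv S p (0, v)"
    using velocity_line[of p "(0, v)"] by (simp add: core_vf_def p add_core_S)
qed

lemma vf_core_vf [simp]: "vf_core E (vf S (\<lambda>p. (0, v))) = v"
  unfolding vf_core_def core_vf_eq by (rule the_equality) (auto dest: fun_cong)

lemma vf_of_weight_iff:
  assumes "smooth \<xi>"
  shows "vf S \<xi> \<in> vf_of_weight E w \<longleftrightarrow> vs_bracket (\<lambda>(y, z). (y, 2 *\<^sub>R z)) \<xi> = (\<lambda>p. w *\<^sub>R \<xi> p)"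
proof -
  have "smooth (\<lambda>p::'g \<times> 'c. (fst p, 2 *\<^sub>R snd p))" by (intro smooth_intros)
  then have W: "smooth (\<lambda>(y, z). (y, 2 *\<^sub>R z) :: 'g \<times> 'c)" by (simp add: case_prod_beta')
  show ?thesis
    unfolding vf_of_weight_def mem_Collect_eq weight_vf_eq lie_bracket_vf[OF W assms] scale_vf_vf vf_eq_iff
    using vf_vector_field[OF assms] by blast
qed

end

lemma push_tv:
  assumes E: "graded_coords E S" and E': "graded_coords E' S'"
    and F: "smooth F" and \<Phi>: "\<And>p. \<Phi> (S p) = S' (F p)"
  shows "push E' \<Phi> (tv S p w) = tv S' (F p) (frechet_derivative F (at p) w)"
proof
  fix f
  interpret E: graded_coords E S by fact
  interpret E': graded_coords E' S' by fact
  show "push E' \<Phi> (tv S p w) f = tv S' (F p) (frechet_derivative F (at p) w) f"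
  proof (cases "f \<in> smooth_fun E'")
    case True
    then have f: "smooth (f \<circ> S')" by (simp add: E'.smooth_fun_iff)
    have eq: "f \<circ> \<Phi> \<circ> S = (\<lambda>p. (f \<circ> S') (F p))" by (auto simp: \<Phi>)
    have sm: "smooth (f \<circ> \<Phi> \<circ> S)" unfolding eq by (rule smooth_compose[OF f F])
    have "frechet_derivative (f \<circ> \<Phi> \<circ> S) (at p) w
        = frechet_derivative (f \<circ> S') (at (F p)) (frechet_derivative F (at p) w)"
      unfolding eq
      by (subst frechet_derivative_eqI[OF has_derivative_compose[OF smooth_has_derivative[OF F] smooth_has_derivative[OF f]]]) simp
    with True sm f show ?thesis by (simp add: push_def tv_def)
  qed (simp add: push_def tv_def E'.smooth_fun_iff)
qed

lemma (in graded_coords) push_act: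
  "push E (act E s) (tv S (y, z) (u, w)) = tv S (s *\<^sub>R y, s\<^sup>2 *\<^sub>R z) (s *\<^sub>R u, s\<^sup>2 *\<^sub>R w)"
proof -
  let ?F = "\<lambda>p::'g \<times> 'c. (s *\<^sub>R fst p, s\<^sup>2 *\<^sub>R snd p)"
  have lin: "linear ?F" by (simp add: linear_iff scaleR_right_distrib mult.commute)
  have "frechet_derivative ?F (at p) = ?F" for p
    by (intro frechet_derivative_eqI bounded_linear_imp_has_derivative findim_linear_bounded lin)
  moreover have "act E s (S p) = S (?F p)" for p
    by (cases p) (simp add: act_S)
  ultimately show ?thesis
    using push_tv[OF graded_coords_axioms graded_coords_axioms smooth_linear[OF lin], of "act E s" "(y, z)" "(u, w)"]
    by simp
qed

lemma split_vf_eq: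
  assumes "graded_coords H (splitting H)"
  shows "split_vf H \<xi> = vf (splitting H) \<xi>"
proof -
  interpret graded_coords H "splitting H" by fact
  show ?thesis by (rule ext) (simp only: split_vf_def Let_def velocity_line vf_def)
qed

section \<open>Jets of curves\<close>

lemma jet1I: "(a has_vector_derivative a1) (at 0) \<Longrightarrow> jet1 a = (a 0, a1)"
  by (simp add: jet1_def vector_derivative_at)

lemma jet2I:
  assumes "\<And>t. (a has_vector_derivative a' t) (at t)" "(a' has_vector_derivative a2) (at 0)"
  shows "jet2 a = (a 0, a' 0, a2)"
  unfolding jet2_def vector_derivative_at[OF assms(1)] vector_derivative_at[OF assms(2)] ..

lemma jet2_linear_comp:
  assumes A: "linear (A :: 'g::findim \<Rightarrow> 'h::real_normed_vector)" and a: "smooth a" and j: "jet2 a = (a0, a1, a2)"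
  shows "jet2 (A \<circ> a) = (A a0, A a1, A a2)"
proof -
  note L = bounded_linear.has_vector_derivative[OF findim_linear_bounded[OF A]]
  have "((\<lambda>t. A (a t)) has_vector_derivative A (vector_derivative a (at t))) (at t)" for t
    by (intro L smooth_has_vector_derivative a)
  moreover have "((\<lambda>t. A (vector_derivative a (at t))) has_vector_derivative
      A (vector_derivative (\<lambda>t. vector_derivative a (at t)) (at 0))) (at 0)"
    by (intro L smooth_has_vector_derivative smooth_vector_derivative a)
  ultimately have "jet2 (\<lambda>t. A (a t)) = (A (a 0), A (vector_derivative a (at 0)),
      A (vector_derivative (\<lambda>t. vector_derivative a (at t)) (at 0)))"
    by (rule jet2I)
  with j show ?thesis by (simp add: jet2_def o_def)
qed

lemma jet2_reparam:
  assumes a: "smooth a" and j: "jet2 a = (a0, a1, a2)"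
  shows "jet2 (\<lambda>t. a (s * t)) = (a0, s *\<^sub>R a1, s\<^sup>2 *\<^sub>R a2)"
proof -
  have d: "((\<lambda>t. f (s * t)) has_vector_derivative s *\<^sub>R vector_derivative f (at (s * t))) (at t)"
    if "smooth f" for f :: "real \<Rightarrow> 'a" and t
  proof -
    have "((\<lambda>t. s * t) has_vector_derivative s) (at t)"
      by (auto intro!: derivative_eq_intros simp: has_vector_derivative_def mult.commute)
    from vector_diff_chain_at[OF this smooth_has_vector_derivative[OF that]]
    show ?thesis by (simp add: o_def)
  qed
  have "((\<lambda>t. s *\<^sub>R vector_derivative a (at (s * t))) has_vector_derivative
      s *\<^sub>R (s *\<^sub>R vector_derivative (\<lambda>t. vector_derivative a (at t)) (at (s * 0)))) (at 0)"
    by (intro bounded_linear.has_vector_derivative[OF bounded_linear_scaleR_right] d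
        smooth_vector_derivative a)
  from jet2I[OF d[OF a] this] j show ?thesis
    by (simp add: jet2_def power2_eq_square)
qed

lemma jet2_times:
  assumes a: "smooth a" and j: "jet1 a = (a0, a1)"
  shows "jet2 (\<lambda>t. t *\<^sub>R a t) = (0, a0, 2 *\<^sub>R a1)"
proof -
  let ?a' = "\<lambda>t. vector_derivative a (at t)"
  have id: "((\<lambda>t::real. t) has_field_derivative 1) (at t)" for t by simp
  have 1: "((\<lambda>t. t *\<^sub>R f t) has_vector_derivative t *\<^sub>R vector_derivative f (at t) + 1 *\<^sub>R f t) (at t)"
    if "smooth f" for f :: "real \<Rightarrow> 'a" and t
    by (intro has_vector_derivative_scaleR id smooth_has_vector_derivative that)
  have 2: "((\<lambda>t. t *\<^sub>R ?a' t + 1 *\<^sub>R a t) has_vector_derivative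
      (0 *\<^sub>R vector_derivative ?a' (at 0) + 1 *\<^sub>R ?a' 0) + 1 *\<^sub>R ?a' 0) (at 0)"
    by (intro has_vector_derivative_add 1[OF smooth_vector_derivative[OF a]]
        bounded_linear.has_vector_derivative[OF bounded_linear_scaleR_right]
        smooth_has_vector_derivative a)
  from jet2I[OF 1[OF a] 2] j show ?thesis
    by (simp add: jet1_def scaleR_2)
qed

definition quadratic_curve :: "'a::real_normed_vector \<Rightarrow> 'a \<Rightarrow> 'a \<Rightarrow> real \<Rightarrow> 'a" where
  "quadratic_curve a0 a1 a2 t = a0 + t *\<^sub>R a1 + (t\<^sup>2 / 2) *\<^sub>R a2"

lemma smooth_quadratic_curve: "smooth (quadratic_curve a0 a1 a2)"
proof -
  have "smooth (\<lambda>t. a0 + t *\<^sub>R a1 + ((1/2) *\<^sub>R t ^ 2) *\<^sub>R a2)" by (intro smooth_intros)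
  then show ?thesis by (simp add: quadratic_curve_def[abs_def])
qed

lemma jet2_quadratic_curve: "jet2 (quadratic_curve a0 a1 a2) = (a0, a1, a2)"
proof -
  have "jet2 (quadratic_curve a0 a1 a2) = (quadratic_curve a0 a1 a2 0, a1 + 0 *\<^sub>R a2, a2)"
    unfolding quadratic_curve_def[abs_def]
    by (rule jet2I) (auto intro!: derivative_eq_intros simp: has_vector_derivative_def algebra_simps)
  then show ?thesis by (simp add: quadratic_curve_def)
qed

lemma jet1_of_jet2: "jet2 a = (a0, a1, a2) \<Longrightarrow> jet1 a = (a0, a1)"
  by (simp add: jet1_def jet2_def)

lemma jet2_const: "jet2 (\<lambda>t. t ^ 0 *\<^sub>R x) = (x, 0, 0)"
  and jet2_linear: "jet2 (\<lambda>t. t ^ 1 *\<^sub>R x) = (0, x, 0)"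
  and jet2_square: "jet2 (\<lambda>t. t ^ 2 *\<^sub>R x) = (0, 0, 2 *\<^sub>R x)"
proof -
  have "quadratic_curve x 0 0 = (\<lambda>t. t ^ 0 *\<^sub>R x)" "quadratic_curve 0 x 0 = (\<lambda>t. t ^ 1 *\<^sub>R x)"
    "quadratic_curve 0 0 (2 *\<^sub>R x) = (\<lambda>t. t ^ 2 *\<^sub>R x)"
    by (auto simp: quadratic_curve_def)
  then show "jet2 (\<lambda>t. t ^ 0 *\<^sub>R x) = (x, 0, 0)" "jet2 (\<lambda>t. t ^ 1 *\<^sub>R x) = (0, x, 0)"
    "jet2 (\<lambda>t. t ^ 2 *\<^sub>R x) = (0, 0, 2 *\<^sub>R x)"
    by (metis jet2_quadratic_curve)+
qed

section \<open>Polynomial vector fields\<close>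

text \<open>
  The general sum of vector fields of weights \<open>0\<close>, \<open>-1\<close> and \<open>-2\<close>: the parameters \<open>A\<close>, \<open>\<eta>\<close>, \<open>q\<close> have
  weight \<open>0\<close>, the parameters \<open>x\<close>, \<open>F\<close> weight \<open>-1\<close>, and \<open>v\<close> weight \<open>-2\<close>. All lifts, the weight field
  and the fields of core elements have this form, so one bracket formula serves for all of them.
\<close>

definition poly_field where
  "poly_field A x \<eta> q F v = (\<lambda>(y, z). (A y + x, \<eta> z + q y y + F y + v))"

lemma poly_field_apply: "poly_field A x \<eta> q F v (y, z) = (A y + x, \<eta> z + q y y + F y + v)"
  by (simp add: poly_field_def)

lemma poly_field_has_derivative:
  fixes A :: "'g::findim \<Rightarrow> 'g" and \<eta> :: "'c::findim \<Rightarrow> 'c" and q :: "'g \<Rightarrow> 'g \<Rightarrow> 'c"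
  assumes "linear A" "linear \<eta>" "bilinear q" "linear F"
  shows "(poly_field A x \<eta> q F v has_derivative (\<lambda>(u, w). (A u, \<eta> w + (q y u + q u y) + F u))) (at (y, z))"
proof -
  note L = bounded_linear.has_derivative[OF findim_linear_bounded]
  have "((\<lambda>p. (A (fst p) + x, \<eta> (snd p) + q (fst p) (fst p) + F (fst p) + v)) has_derivative
     (\<lambda>p. (A (fst p) + 0, \<eta> (snd p) + (q (fst (y, z)) (fst p) + q (fst p) (fst (y, z))) + F (fst p) + 0))) (at (y, z))"
    by (intro has_derivative_Pair has_derivative_add has_derivative_const
        L[OF assms(1)] L[OF assms(2)] L[OF assms(4)] has_derivative_fst
        has_derivative_snd has_derivative_ident
        bounded_bilinear.FDERIV[OF findim_bilinear_bounded[OF assms(3)]])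
  then show ?thesis by (simp add: poly_field_def case_prod_beta')
qed

lemma smooth_poly_field:
  fixes A :: "'g::findim \<Rightarrow> 'g" and \<eta> :: "'c::findim \<Rightarrow> 'c" and q :: "'g \<Rightarrow> 'g \<Rightarrow> 'c"
  assumes "linear A" "linear \<eta>" "bilinear q" "linear F"
  shows "smooth (poly_field A x \<eta> q F v)"
proof -
  have "smooth (\<lambda>p. (A (fst p) + x, \<eta> (snd p) + q (fst p) (fst p) + F (fst p) + v))"
    by (intro smooth_intros smooth_linear_comp[OF assms(1)] smooth_linear_comp[OF assms(2)]
        smooth_bilinear[OF assms(3)] smooth_linear_comp[OF assms(4)])
  then show ?thesis by (simp add: poly_field_def case_prod_beta')
qed

lemma vs_bracket_poly_field:
  fixes A A' :: "'g::findim \<Rightarrow> 'g" and \<eta> \<eta>' :: "'c::findim \<Rightarrow> 'c" and q q' :: "'g \<Rightarrow> 'g \<Rightarrow> 'c"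
  assumes "linear A" "linear \<eta>" "bilinear q" "linear F"
    and "linear A'" "linear \<eta>'" "bilinear q'" "linear F'"
  shows "vs_bracket (poly_field A x \<eta> q F v) (poly_field A' x' \<eta>' q' F' v') (y, z) =
    (A' (A y + x) - A (A' y + x'),
     (\<eta>' (\<eta> z + q y y + F y + v) + (q' y (A y + x) + q' (A y + x) y) + F' (A y + x))
     - (\<eta> (\<eta>' z + q' y y + F' y + v') + (q y (A' y + x') + q (A' y + x') y) + F (A' y + x')))"
  unfolding vs_bracket_def
    frechet_derivative_eqI[OF poly_field_has_derivative[OF assms(1-4)]]
    frechet_derivative_eqI[OF poly_field_has_derivative[OF assms(5-8)]]
  by (simp add: poly_field_apply)

section \<open>Higher algebroids in coordinates\<close>

text \<open>
  The signs and the order of the arguments are chosen so that, in the canonical splitting of a skew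
  higher algebroid, \<open>b\<close>, \<open>\<rho>\<close>, \<open>d\<close>, \<open>\<beta>\<close> and \<open>\<omega>\<close> are the structure maps \<open>[\<cdot>,\<cdot>]\<close>, \<open>\<box>\<close>, \<open>\<partial>\<close>, \<open>\<beta>\<close> and
  \<open>\<omega>\<^sup>s\<^sup>y\<^sup>m\<close>.
\<close>

locale ha_coords = graded_coords H S
  for H :: "('e, 'g::findim, 'c::findim) ha2" and S :: "'g \<times> 'c \<Rightarrow> 'e" +
  fixes b :: "'g \<Rightarrow> 'g \<Rightarrow> 'g" and \<rho> :: "'g \<Rightarrow> 'c \<Rightarrow> 'c" and d :: "'g \<Rightarrow> 'c"
    and \<beta> :: "'g \<Rightarrow> 'g \<Rightarrow> 'c" and \<omega> :: "'g \<Rightarrow> 'g \<Rightarrow> 'g \<Rightarrow> 'c"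
  assumes bilinear_b: "bilinear b" and bilinear_\<rho>: "bilinear \<rho>" and linear_d: "linear d"
    and bilinear_\<beta>: "bilinear \<beta>" and sym_bilin_\<omega>: "sym_bilin (\<omega> x)" and linear_\<omega>: "linear (\<lambda>x. \<omega> x y z)"
    and kappa_S: "kappa H (S p) (a0, a1, a2) =
      tv S p (poly_field (\<lambda>y. b y a0) a1 (\<lambda>z. - \<rho> a0 z) (\<omega> a0) (\<lambda>y. \<beta> y a1) (d a2) p)"

text \<open>
  Splitting a 2-jet into its three entries splits \<open>\<kappa>\<^sup>2\<close> into three families of vector fields, whose two
  components are homogeneous of weights \<open>1, 2\<close>, of weights \<open>0, 1\<close> and of weights \<open>-1, 0\<close>. The
  homogeneity lemmas turn each of them into a polynomial.
\<close>

lemma higher_algebroid2_coords: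
  fixes H :: "('e, 'g::findim, 'c::findim) ha2"
  assumes H: "higher_algebroid2 H" and S: "graded_splitting H S"
  shows "\<exists>b \<rho> d \<beta> \<omega>. ha_coords H S b \<rho> d \<beta> \<omega>"
proof -
  have H': "graded_bundle2 H" "\<And>e A. kappa H e A \<in> tangent_space H e"
    "\<And>e f. linear (\<lambda>A. kappa H e A f)"
    "\<And>A f. f\<in>smooth_fun H \<Longrightarrow> (\<lambda>e. kappa H e A f) \<in> smooth_fun H"
    "\<And>s e a. smooth a \<Longrightarrow>
        kappa H (act H s e) (jet2 (\<lambda>t. a (s * t))) = push H (act H s) (kappa H e (jet2 a))"
    "algebroid_pt (reduction1 H)"
    using H unfolding higher_algebroid2_def by blast+
  interpret graded_coords H S
    by unfold_locales (fact H'(1) S)+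
  have "\<forall>p A. \<exists>w. kappa H (S p) A = tv S p w"
    using H'(2)[of "S _"] unfolding tangent_space_S by blast
  then obtain k where k: "\<And>p A. kappa H (S p) A = tv S p (k p A)" by metis
  have k_linear: "linear (k p)" for p
  proof
    note lin = H'(3)[of "S p", unfolded k]
    show "k p (A + B) = k p A + k p B" for A B
      by (rule tv_eqD[of p], rule ext) (simp add: linear_add[OF lin] linear_add[OF linear_tv])
    show "k p (r *\<^sub>R A) = r *\<^sub>R k p A" for r A
      by (rule tv_eqD[of p], rule ext) (simp add: linear_scale[OF lin] linear_scale[OF linear_tv])
  qed
  have k_smooth: "smooth (\<lambda>p. k p A)" for A
  proof (rule smooth_if_functionals_smooth)
    fix l :: "'g \<times> 'c \<Rightarrow> real" assume l: "linear l"
    have "l \<circ> inv S \<circ> S = l" by (auto simp: fun_eq_iff)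
    then have "l \<circ> inv S \<in> smooth_fun H"
      unfolding smooth_fun_iff using smooth_linear[OF l] by simp
    from H'(4)[OF this, of A] show "smooth (\<lambda>p. l (k p A))"
      by (simp add: smooth_fun_iff o_def k tv_functional[OF l, unfolded o_def])
  qed
  have k_equiv: "k (s *\<^sub>R y, s\<^sup>2 *\<^sub>R z) (a0, s *\<^sub>R a1, s\<^sup>2 *\<^sub>R a2)
      = (s *\<^sub>R fst (k (y, z) (a0, a1, a2)), s\<^sup>2 *\<^sub>R snd (k (y, z) (a0, a1, a2)))" for s y z a0 a1 a2
  proof -
    obtain u w where uw: "k (y, z) (a0, a1, a2) = (u, w)" by fastforce
    show ?thesis
      using H'(5)[OF smooth_quadratic_curve, of s "S (y, z)" a0 a1 a2]
      unfolding jet2_reparam[OF smooth_quadratic_curve jet2_quadratic_curve] jet2_quadratic_curve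
        act_S k uw push_act tv_eq_iff by simp
  qed
  define K0 where "K0 a p = k p (a, 0, 0)" for a p
  define K1 where "K1 a p = k p (0, a, 0)" for a p
  define K2 where "K2 a p = k p (0, 0, a)" for a p
  have k_sum: "k p (a0, a1, a2) = K0 a0 p + K1 a1 p + K2 a2 p" for p a0 a1 a2
    by (simp add: K0_def K1_def K2_def linear_add[OF k_linear, symmetric])
  have K_lin: "linear (\<lambda>a. K0 a p)" "linear (\<lambda>a. K1 a p)" "linear (\<lambda>a. K2 a p)" for p
    unfolding K0_def K1_def K2_def
    by (simp_all add: linear_iff linear_add[OF k_linear, symmetric] linear_scale[OF k_linear, symmetric])
  have K_smooth: "smooth (\<lambda>p. fst (K0 a p))" "smooth (\<lambda>p. snd (K0 a p))"
     "smooth (\<lambda>p. fst (K1 a p))" "smooth (\<lambda>p. snd (K1 a p))"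
     "smooth (\<lambda>p. fst (K2 a p))" "smooth (\<lambda>p. snd (K2 a p))" for a
    unfolding K0_def K1_def K2_def by (intro smooth_intros k_smooth)+
  have E0: "K0 a (s *\<^sub>R y, s\<^sup>2 *\<^sub>R z) = (s *\<^sub>R fst (K0 a (y, z)), s\<^sup>2 *\<^sub>R snd (K0 a (y, z)))" for a s y z
    using k_equiv[of s y z a 0 0] by (simp add: K0_def)
  have E1: "s *\<^sub>R K1 a (s *\<^sub>R y, s\<^sup>2 *\<^sub>R z) = (s *\<^sub>R fst (K1 a (y, z)), s\<^sup>2 *\<^sub>R snd (K1 a (y, z)))" for a s y z
    using k_equiv[of s y z 0 a 0] linear_scale[OF K_lin(2), of s a] by (simp add: K1_def)
  have E2: "s\<^sup>2 *\<^sub>R K2 a (s *\<^sub>R y, s\<^sup>2 *\<^sub>R z) = (s *\<^sub>R fst (K2 a (y, z)), s\<^sup>2 *\<^sub>R snd (K2 a (y, z)))" for a s y z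
    using k_equiv[of s y z 0 0 a] linear_scale[OF K_lin(3), of "s\<^sup>2" a] by (simp add: K2_def)
  have w01: "fst (K0 a (s *\<^sub>R y, s\<^sup>2 *\<^sub>R z)) = s *\<^sub>R fst (K0 a (y, z))" for a s y z
    by (simp add: E0)
  have w02: "snd (K0 a (s *\<^sub>R y, s\<^sup>2 *\<^sub>R z)) = s\<^sup>2 *\<^sub>R snd (K0 a (y, z))" for a s y z
    by (simp add: E0)
  have w11: "fst (K1 a (s *\<^sub>R y, s\<^sup>2 *\<^sub>R z)) = fst (K1 a (y, z))" if "s \<noteq> 0" for a s y z
    using arg_cong[OF E1, of fst s a y z] that by simp
  have w12: "snd (K1 a (s *\<^sub>R y, s\<^sup>2 *\<^sub>R z)) = s *\<^sub>R snd (K1 a (y, z))" if "s \<noteq> 0" for a s y z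
  proof -
    have "s *\<^sub>R snd (K1 a (s *\<^sub>R y, s\<^sup>2 *\<^sub>R z)) = s *\<^sub>R (s *\<^sub>R snd (K1 a (y, z)))"
      using arg_cong[OF E1, of snd s a y z] by (simp add: power2_eq_square)
    with that show ?thesis by (simp only: scaleR_cancel_left) simp
  qed
  have w21: "s *\<^sub>R fst (K2 a (s *\<^sub>R y, s\<^sup>2 *\<^sub>R z)) = fst (K2 a (y, z))" if "s \<noteq> 0" for a s y z
  proof -
    have "s *\<^sub>R (s *\<^sub>R fst (K2 a (s *\<^sub>R y, s\<^sup>2 *\<^sub>R z))) = s *\<^sub>R fst (K2 a (y, z))"
      using arg_cong[OF E2, of fst s a y z] by (simp add: power2_eq_square)
    with that show ?thesis by (simp only: scaleR_cancel_left) simp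
  qed
  have w22: "snd (K2 a (s *\<^sub>R y, s\<^sup>2 *\<^sub>R z)) = snd (K2 a (y, z))" if "s \<noteq> 0" for a s y z
    using arg_cong[OF E2, of snd s a y z] that by simp
  define b where "b y a = fst (K0 a (y, 0))" for y a
  define \<rho> where "\<rho> a z = - snd (K0 a (0, z))" for a z
  define \<omega> where "\<omega> a = polar_form (\<lambda>y. snd (K0 a (y, 0)))" for a
  define \<beta> where "\<beta> y a = snd (K1 a (y, 0))" for y a
  define d where "d a = snd (K2 a 0)" for a
  note h01 = homogeneous_weight_1[OF K_smooth(1) w01]
  note h02 = homogeneous_weight_2[OF K_smooth(2) w02]
  note h12 = homogeneous_weight_1[OF K_smooth(4) w12]
  \<comment> \<open>the only constant that is prescribed: \<open>\<kappa>\<^sup>1\<close> is the identity between the cores\<close>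
  have core_id: "fst (K1 a 0) = a" for a
  proof -
    obtain r where r: "\<forall>c. r 0 (0, c) = c" "reduction1 H = {(A, (y, r y A)) | A y. True}"
      using H'(6) unfolding algebroid_pt_def by (elim exE conjE)
    \<comment> \<open>a curve whose velocity at \<open>S 0\<close> is related to the jet \<open>(0, a, 0)\<close>\<close>
    define c where "c = (\<lambda>t. S (0 + t *\<^sub>R K1 a 0))"
    have "c \<in> smooth_curve H"
      unfolding c_def by (intro smooth_curve_S smooth_intros)
    moreover have "kappa H (c 0) (jet2 (quadratic_curve 0 a 0)) = velocity H c"
      unfolding c_def velocity_line jet2_quadratic_curve by (simp add: k K1_def)
    ultimately have "(jet1 (quadratic_curve 0 a 0), jet1 (proj H \<circ> c)) \<in> reduction1 H"
      unfolding reduction1_def using smooth_quadratic_curve by blast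
    moreover have "jet1 (proj H \<circ> c) = (0, fst (K1 a 0))"
    proof -
      have "((\<lambda>t. t *\<^sub>R fst (K1 a 0)) has_vector_derivative fst (K1 a 0)) (at 0)"
        by (auto intro!: derivative_eq_intros)
      from jet1I[OF this] show ?thesis by (simp add: c_def o_def proj_S_fst)
    qed
    ultimately show ?thesis
      using r by (simp add: jet1_of_jet2[OF jet2_quadratic_curve])
  qed
  have "ha_coords H S b \<rho> d \<beta> \<omega>"
  proof (intro ha_coords.intro ha_coords_axioms.intro graded_coords_axioms)
    show "bilinear b"
      unfolding b_def by (intro bilinear_linearI h01(1) linear_fst_comp K_lin)
    show "bilinear \<rho>"
      unfolding \<rho>_def by (intro bilinear_linearI linear_compose_neg h02(1) linear_snd_comp K_lin)
    show "linear d" unfolding d_def by (intro linear_snd_comp K_lin)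
    show "bilinear \<beta>"
      unfolding \<beta>_def by (intro bilinear_linearI h12(1) linear_snd_comp K_lin)
    show "sym_bilin (\<omega> x)" for x unfolding \<omega>_def by (rule h02(2))
    show "linear (\<lambda>x. \<omega> x y z)" for y z
      unfolding \<omega>_def polar_form_def
      by (intro linear_compose_scale_right linear_compose_sub linear_snd_comp K_lin)
    fix p :: "'g \<times> 'c" and a0 a1 a2
    obtain y z where p: "p = (y, z)" by fastforce
    have "K0 a0 p = (b y a0, - \<rho> a0 z + \<omega> a0 y y)"
      unfolding p prod_eq_iff b_def \<rho>_def \<omega>_def
      using h01(2)[of a0 y z] h02(3)[of a0 y z] by simp
    moreover have "K1 a1 p = (a1, \<beta> y a1)"
      unfolding p prod_eq_iff \<beta>_def
      using homogeneous_weight_0[OF K_smooth(3) w11, of a1 "(y, z)"] core_id[of a1] h12(2)[of a1 y z] by simp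
    moreover have "K2 a2 p = (0, d a2)"
      unfolding p prod_eq_iff d_def
      using homogeneous_weight_0[OF K_smooth(6) w22, of a2 "(y, z)"]
        homogeneous_weight_minus_1[OF K_smooth(5) w21, of a2 "(y, z)"] by simp
    ultimately show "kappa H (S p) (a0, a1, a2) =
      tv S p (poly_field (\<lambda>y. b y a0) a1 (\<lambda>z. - \<rho> a0 z) (\<omega> a0) (\<lambda>y. \<beta> y a1) (d a2) p)"
      unfolding k k_sum p poly_field_apply by simp
  qed
  then show ?thesis by blast
qed

context ha_coords begin

lemma kappa_polynomial:
  "linear (\<lambda>y. b y a0)" "linear (\<lambda>z. - \<rho> a0 z)" "bilinear (\<omega> a0)" "linear (\<lambda>y. \<beta> y a1)"
  using bilinear_b bilinear_\<rho> bilinear_\<beta> sym_bilin_\<omega>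
  by (auto simp: bilinear_def sym_bilin_def intro: linear_compose_neg)

lemma ha_lift_eq:
  "ha_lift H 0 x = vf S (poly_field (\<lambda>y. b y x) 0 (\<lambda>z. - \<rho> x z) (\<omega> x) (\<lambda>y. \<beta> y 0) (d 0))"
  "ha_lift H (Suc 0) x = vf S (poly_field (\<lambda>y. b y 0) x (\<lambda>z. - \<rho> 0 z) (\<omega> 0) (\<lambda>y. \<beta> y x) (d 0))"
  "ha_lift H 2 x = vf S (poly_field (\<lambda>y. b y 0) 0 (\<lambda>z. - \<rho> 0 z) (\<omega> 0) (\<lambda>y. \<beta> y 0) (d (2 *\<^sub>R x)))"
  by (rule vf_eqI, unfold ha_lift_def jet2_const jet2_linear[unfolded One_nat_def] jet2_square kappa_S, rule refl)+

lemma reduction1_eq: "reduction1 H = {((a0, a1), (y, b y a0 + a1)) | a0 a1 y. True}"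
proof (intro equalityI subsetI)
  fix X assume "X \<in> reduction1 H"
  then obtain a \<gamma> where X: "X = (jet1 a, jet1 (proj H \<circ> \<gamma>))" and \<gamma>: "\<gamma> \<in> smooth_curve H"
    and eq: "kappa H (\<gamma> 0) (jet2 a) = velocity H \<gamma>"
    unfolding reduction1_def by blast
  obtain a0 a1 a2 where a: "jet2 a = (a0, a1, a2)" by (metis prod_cases3)
  define g where "g = inv S \<circ> \<gamma>"
  have g: "smooth g" and \<gamma>g: "\<gamma> = (\<lambda>t. S (g t))"
    using \<gamma> by (auto simp: g_def smooth_curve_iff)
  obtain y z where yz: "g 0 = (y, z)" by fastforce
  have "vector_derivative g (at 0) = poly_field (\<lambda>y. b y a0) a1 (\<lambda>z. - \<rho> a0 z) (\<omega> a0) (\<lambda>y. \<beta> y a1) (d a2) (g 0)"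
    using eq unfolding velocity_smooth_curve[OF \<gamma>] a unfolding g_def[symmetric] unfolding \<gamma>g kappa_S inv_S tv_eq_iff
    by (rule sym)
  then have fst': "fst (vector_derivative g (at 0)) = b y a0 + a1"
    by (simp add: yz poly_field_apply)
  have "((\<lambda>t. fst (g t)) has_vector_derivative fst (vector_derivative g (at 0))) (at 0)"
    by (intro bounded_linear.has_vector_derivative[OF bounded_linear_fst] smooth_has_vector_derivative g)
  from jet1I[OF this] have "jet1 (proj H \<circ> \<gamma>) = (y, b y a0 + a1)"
    by (simp add: \<gamma>g o_def proj_S_fst yz fst')
  then show "X \<in> {((a0, a1), (y, b y a0 + a1)) | a0 a1 y. True}"
    unfolding X jet1_of_jet2[OF a] by blast
next
  fix X assume "X \<in> {((a0, a1), (y, b y a0 + a1)) | a0 a1 y. True}"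
  then obtain a0 a1 y where X: "X = ((a0, a1), (y, b y a0 + a1))" by blast
  define w where "w = poly_field (\<lambda>y. b y a0) a1 (\<lambda>z. - \<rho> a0 z) (\<omega> a0) (\<lambda>y. \<beta> y a1) (d 0) (y, 0)"
  define \<gamma> where "\<gamma> = (\<lambda>t. S ((y, 0) + t *\<^sub>R w))"
  have "\<gamma> \<in> smooth_curve H"
    unfolding \<gamma>_def by (intro smooth_curve_S smooth_intros)
  moreover have "kappa H (\<gamma> 0) (jet2 (quadratic_curve a0 a1 0)) = velocity H \<gamma>"
    unfolding \<gamma>_def velocity_line jet2_quadratic_curve by (simp add: kappa_S w_def)
  ultimately have "(jet1 (quadratic_curve a0 a1 0), jet1 (proj H \<circ> \<gamma>)) \<in> reduction1 H"
    unfolding reduction1_def using smooth_quadratic_curve by blast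
  moreover have "jet1 (proj H \<circ> \<gamma>) = (y, b y a0 + a1)"
  proof -
    have "((\<lambda>t. y + t *\<^sub>R fst w) has_vector_derivative fst w) (at 0)"
      by (auto intro!: derivative_eq_intros)
    from jet1I[OF this] show ?thesis by (simp add: \<gamma>_def o_def proj_S_fst w_def poly_field_apply)
  qed
  ultimately show "X \<in> reduction1 H"
    by (simp add: X jet1_of_jet2[OF jet2_quadratic_curve])
qed

lemma sym_reduction1_iff: "sym (reduction1 H) \<longleftrightarrow> (\<forall>x y. b x y = - b y x)"
proof
  assume "sym (reduction1 H)"
  then have "((x, b x y + 0), (y, 0)) \<in> reduction1 H" for x y
    unfolding reduction1_eq by (intro symD[of _ "(y, 0)"]) auto
  then show "\<forall>x y. b x y = - b y x"
    unfolding reduction1_eq by (auto simp: eq_neg_iff_add_eq_0 add.commute)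
next
  assume skew: "\<forall>x y. b x y = - b y x"
  have *: "b x y + b y x = 0" for x y
    unfolding eq_neg_iff_add_eq_0[symmetric] using skew by blast
  show "sym (reduction1 H)"
    unfolding reduction1_eq sym_def by (auto simp: * add.assoc[symmetric])
qed

lemma lift_pt_eq: "lift_pt (reduction1 H) 0 x = (\<lambda>y. b y x)" "lift_pt (reduction1 H) 1 x = (\<lambda>y. x)"
proof -
  have "jet1 (\<lambda>t. t ^ 0 *\<^sub>R x) = (x, 0)" "jet1 (\<lambda>t. t ^ 1 *\<^sub>R x) = (0, x)"
    using jet1_of_jet2 jet2_const jet2_linear by blast+
  then show "lift_pt (reduction1 H) 0 x = (\<lambda>y. b y x)" "lift_pt (reduction1 H) 1 x = (\<lambda>y. x)"
    unfolding lift_pt_def reduction1_eq by (auto simp: bilinear_rzero[OF bilinear_b])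
qed

lemma ha_bracket_eq: "ha_bracket H x y = - b y x"
proof -
  have "frechet_derivative (\<lambda>y. b y x) (at p) = (\<lambda>y. b y x)" for p
    by (intro frechet_derivative_eqI bounded_linear_imp_has_derivative findim_linear_bounded
        kappa_polynomial)
  then have "vs_bracket (\<lambda>y. b y x) (\<lambda>_. y) = (\<lambda>_. - b y x)"
    by (simp add: vs_bracket_def)
  then have "bracket_pt (reduction1 H) x y = (THE z. (\<lambda>_. z) = (\<lambda>_::'g. - b y x))"
    unfolding bracket_pt_def lift_pt_eq by simp
  also have "\<dots> = - b y x" by (rule the_equality) (auto dest: fun_cong)
  finally show ?thesis by (simp add: ha_bracket_def)
qed

text \<open>
  At \<open>S (y, z)\<close> the two sides of the condition that defines \<open>\<Theta>\<^sup>2\<close> have components \<open>(x, \<beta> y x)\<close> and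
  \<open>(y, 2 z)\<close>.
\<close>

lemma Theta_eq: "Theta H (x, 0) = S (x, (1/2) *\<^sub>R \<beta> x x)"
proof -
  have iff: "kappa H (S (y, z)) (jet2 (\<lambda>t. t *\<^sub>R a t)) = weight_vf H (S (y, z))
      \<longleftrightarrow> y = x \<and> z = (1/2) *\<^sub>R \<beta> x x"
    if a: "smooth a" "jet1 a = (x, 0)" for a y z
  proof -
    have "kappa H (S (y, z)) (jet2 (\<lambda>t. t *\<^sub>R a t)) = tv S (y, z) (x, \<beta> y x)"
      unfolding jet2_times[OF a] kappa_S poly_field_apply
      using bilinear_rzero[OF bilinear_b] bilinear_lzero[OF bilinear_\<rho>] linear_0[OF linear_\<omega>] linear_0[OF linear_d]
      by simp
    moreover have "weight_vf H (S (y, z)) = tv S (y, z) (y, 2 *\<^sub>R z)"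
      by (simp add: weight_vf_eq)
    moreover have "\<beta> x x = 2 *\<^sub>R z \<longleftrightarrow> z = (1/2) *\<^sub>R \<beta> x x" by auto
    ultimately show ?thesis by auto
  qed
  have c: "smooth (\<lambda>t::real. x)" "jet1 (\<lambda>t::real. x) = (x, 0)"
    by (simp_all add: smooth_const jet1_def)
  show ?thesis unfolding Theta_def
  proof (rule the_equality)
    show "\<exists>a. smooth a \<and> jet1 a = (x, 0) \<and> kappa H (S (x, (1 / 2) *\<^sub>R \<beta> x x)) (jet2 (\<lambda>t. t *\<^sub>R a t))
        = weight_vf H (S (x, (1 / 2) *\<^sub>R \<beta> x x))"
      using c iff[OF c] by blast
  next
    fix V assume "\<exists>a. smooth a \<and> jet1 a = (x, 0) \<and> kappa H V (jet2 (\<lambda>t. t *\<^sub>R a t)) = weight_vf H V"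
    then obtain a where a: "smooth a" "jet1 a = (x, 0)" and eq: "kappa H V (jet2 (\<lambda>t. t *\<^sub>R a t)) = weight_vf H V"
      by blast
    obtain y z where V: "V = S (y, z)" by (metis S_inv surj_pair)
    show "V = S (x, (1 / 2) *\<^sub>R \<beta> x x)"
      using eq iff[OF a] unfolding V by simp
  qed
qed

lemma splitting_eq: "splitting H = (\<lambda>(x, c). S (x, c + (1/2) *\<^sub>R \<beta> x x))"
  unfolding splitting_def Theta_eq add_core_S by (simp add: add.commute)

lemma graded_splitting_splitting: "graded_splitting H (splitting H)"
proof -
  have "bilinear (\<lambda>x y. (1/2) *\<^sub>R \<beta> x y)"
    using bilinear_\<beta> by (auto simp: bilinear_def intro: linear_compose_scale_right)
  then show ?thesis unfolding splitting_eq by (rule shear_splitting)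
qed

end

section \<open>The normal form of a skew higher algebroid\<close>

text \<open>
  Skewness of \<open>b\<close> is the skewness of the higher algebroid; skewness of \<open>\<beta>\<close> singles out the canonical
  splitting among all splittings.
\<close>

locale ha_normal = ha_coords H S b \<rho> d \<beta> \<omega>
  for H :: "('e, 'g::findim, 'c::findim) ha2" and S b \<rho> d \<beta> \<omega> +
  assumes skew_b: "b x y = - b y x" and skew_\<beta>: "\<beta> x y = - \<beta> y x"

text \<open>
  Coefficients are computed twice: first in an arbitrary splitting, which shows that the canonical
  splitting is indeed a graded splitting, and then in the canonical splitting itself. There
  \<open>\<Theta>\<^sup>2 (x, 0)\<close> has the coordinates \<open>(x, 0)\<close> by definition and \<open>(x, \<beta> x x / 2)\<close> by \<open>Theta_eq\<close>, so that \<open>\<beta>\<close>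
  is alternating.
\<close>

lemma skew_ha2_normal:
  fixes H :: "('e, 'g::findim, 'c::findim) ha2"
  assumes "skew_ha2 H"
  shows "\<exists>b \<rho> d \<beta> \<omega>. ha_normal H (splitting H) b \<rho> d \<beta> \<omega>"
proof -
  have H: "higher_algebroid2 H" "sym (reduction1 H)" using assms by (auto simp: skew_ha2_def)
  then have "graded_bundle2 H" by (simp add: higher_algebroid2_def)
  then obtain S where "graded_splitting H S" using graded_bundle2_has_splitting by blast
  then obtain b \<rho> d \<beta> \<omega> where "ha_coords H S b \<rho> d \<beta> \<omega>"
    using higher_algebroid2_coords[OF H(1)] by blast
  then have "graded_splitting H (splitting H)" by (rule ha_coords.graded_splitting_splitting)
  then obtain b \<rho> d \<beta> \<omega> where c: "ha_coords H (splitting H) b \<rho> d \<beta> \<omega>"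
    using higher_algebroid2_coords[OF H(1)] by blast
  interpret ha_coords H "splitting H" b \<rho> d \<beta> \<omega> by (rule c)
  have "\<beta> x x = 0" for x
  proof -
    have "splitting H (x, 0) = splitting H (x, 0 + (1/2) *\<^sub>R \<beta> x x)"
      by (subst splitting_eq) simp
    then show ?thesis unfolding S_eq_iff by simp
  qed
  from skew_if_alternating[OF bilinear_\<beta> this] have "\<beta> x y = - \<beta> y x" for x y .
  moreover have "b x y = - b y x" for x y
    using H(2) sym_reduction1_iff by blast
  ultimately have "ha_normal H (splitting H) b \<rho> d \<beta> \<omega>"
    by (intro ha_normal.intro ha_normal_axioms.intro c)
  then show ?thesis by blast
qed

context ha_normal begin

lemma bilinear_\<omega>: "bilinear (\<omega> x)" and \<omega>_commute: "\<omega> x y z = \<omega> x z y"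
  using sym_bilin_\<omega>[of x] by (auto simp: sym_bilin_def)

lemmas multilinear_simps =
  bilinear_lsub[OF bilinear_b] bilinear_rsub[OF bilinear_b]
  bilinear_ladd[OF bilinear_b] bilinear_radd[OF bilinear_b] bilinear_lneg[OF bilinear_b] bilinear_rneg[OF bilinear_b]
  bilinear_lmul[OF bilinear_b] bilinear_rmul[OF bilinear_b] bilinear_lzero[OF bilinear_b] bilinear_rzero[OF bilinear_b]
  bilinear_lsub[OF bilinear_\<rho>] bilinear_rsub[OF bilinear_\<rho>]
  bilinear_ladd[OF bilinear_\<rho>] bilinear_radd[OF bilinear_\<rho>] bilinear_lneg[OF bilinear_\<rho>] bilinear_rneg[OF bilinear_\<rho>]
  bilinear_lmul[OF bilinear_\<rho>] bilinear_rmul[OF bilinear_\<rho>] bilinear_lzero[OF bilinear_\<rho>] bilinear_rzero[OF bilinear_\<rho>]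
  bilinear_lsub[OF bilinear_\<beta>] bilinear_rsub[OF bilinear_\<beta>]
  bilinear_ladd[OF bilinear_\<beta>] bilinear_radd[OF bilinear_\<beta>] bilinear_lneg[OF bilinear_\<beta>] bilinear_rneg[OF bilinear_\<beta>]
  bilinear_lmul[OF bilinear_\<beta>] bilinear_rmul[OF bilinear_\<beta>] bilinear_lzero[OF bilinear_\<beta>] bilinear_rzero[OF bilinear_\<beta>]
  bilinear_ladd[OF bilinear_\<omega>] bilinear_radd[OF bilinear_\<omega>] bilinear_lneg[OF bilinear_\<omega>] bilinear_rneg[OF bilinear_\<omega>]
  bilinear_lmul[OF bilinear_\<omega>] bilinear_rmul[OF bilinear_\<omega>] bilinear_lzero[OF bilinear_\<omega>] bilinear_rzero[OF bilinear_\<omega>]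
  linear_add[OF linear_\<omega>] linear_neg[OF linear_\<omega>] linear_scale[OF linear_\<omega>] linear_0[OF linear_\<omega>]
  linear_add[OF linear_d] linear_neg[OF linear_d] linear_scale[OF linear_d] linear_0[OF linear_d]

abbreviation "lift0 x \<equiv> poly_field (\<lambda>y. b y x) 0 (\<lambda>z. - \<rho> x z) (\<omega> x) (\<lambda>y. 0) 0"
abbreviation "lift1 x \<equiv> poly_field (\<lambda>y. 0) x (\<lambda>z::'c. 0) (\<lambda>y y'. 0) (\<lambda>y. \<beta> y x) 0"
abbreviation "lift2 x \<equiv> poly_field (\<lambda>y::'g. 0) (0::'g) (\<lambda>z::'c. 0) (\<lambda>y y'. 0) (\<lambda>y. 0) (2 *\<^sub>R d x)"
abbreviation "core_field v \<equiv> poly_field (\<lambda>y::'g. 0) (0::'g) (\<lambda>z::'c. 0) (\<lambda>y y'. 0) (\<lambda>y. 0) (v::'c)"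

lemma \<omega>_0: "\<omega> 0 = (\<lambda>y y'. 0)"
  by (auto simp: fun_eq_iff multilinear_simps)

lemma lifts: "ha_lift H 0 x = vf S (lift0 x)" "ha_lift H (Suc 0) x = vf S (lift1 x)"
    "ha_lift H 2 x = vf S (lift2 x)"
  unfolding ha_lift_eq by (simp_all add: multilinear_simps \<omega>_0)

lemma core_vf_poly_field: "core_vf H v = vf S (core_field v)"
  unfolding core_vf_eq poly_field_def by (simp add: case_prod_beta')

lemma vf_core_poly_field: "vf_core H (vf S (core_field v)) = v"
  using vf_core_vf[of v] core_vf_eq core_vf_poly_field by simp

lemma bilinear_0: "bilinear (\<lambda>y y'. 0)"
  by (simp add: bilinear_def linear_zero)

lemma linear_b: "linear (\<lambda>y. b y x)" and linear_\<rho>: "linear (\<lambda>z. - \<rho> x z)" and linear_\<beta>: "linear (\<lambda>y. \<beta> y x)"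
  using kappa_polynomial by blast+

lemma lift_smooth: "smooth (lift0 x)" "smooth (lift1 x)" "smooth (core_field v)"
  by (rule smooth_poly_field[OF linear_b linear_\<rho> bilinear_\<omega> linear_zero]
      smooth_poly_field[OF linear_zero linear_zero bilinear_0 linear_\<beta>]
      smooth_poly_field[OF linear_zero linear_zero bilinear_0 linear_zero])+

lemmas lift_bracket = vs_bracket_poly_field[OF linear_b linear_\<rho> bilinear_\<omega> linear_zero linear_b linear_\<rho> bilinear_\<omega> linear_zero]
  vs_bracket_poly_field[OF linear_b linear_\<rho> bilinear_\<omega> linear_zero linear_zero linear_zero bilinear_0 linear_\<beta>]
  vs_bracket_poly_field[OF linear_zero linear_zero bilinear_0 linear_\<beta> linear_zero linear_zero bilinear_0 linear_\<beta>]
  vs_bracket_poly_field[OF linear_b linear_\<rho> bilinear_\<omega> linear_zero linear_zero linear_zero bilinear_0 linear_zero]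

lemma bracket_0_0: "lie_bracket H (ha_lift H 0 x) (ha_lift H 0 x') = vf S (\<lambda>(y, z).
    (b (b y x) x' - b (b y x') x,
     \<rho> x' (\<rho> x z) - \<rho> x (\<rho> x' z) + (\<rho> x (\<omega> x' y y) - \<rho> x' (\<omega> x y y))
     + (2 *\<^sub>R \<omega> x' y (b y x) - 2 *\<^sub>R \<omega> x y (b y x'))))"
  unfolding lifts lie_bracket_vf[OF lift_smooth(1) lift_smooth(1)] vf_eq_iff
  by (auto simp: fun_eq_iff lift_bracket multilinear_simps scaleR_2 algebra_simps
      \<omega>_commute[of _ "b _ _"])

lemma bracket_0_1: "lie_bracket H (ha_lift H 0 x) (ha_lift H (Suc 0) x') = vf S (\<lambda>(y, z).
    (- b x' x, \<beta> (b y x) x' + \<rho> x (\<beta> y x') - 2 *\<^sub>R \<omega> x y x'))"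
  unfolding lifts lie_bracket_vf[OF lift_smooth(1) lift_smooth(2)] vf_eq_iff
  by (auto simp: fun_eq_iff lift_bracket multilinear_simps scaleR_2 algebra_simps \<omega>_commute[of x x'])

lemma bracket_1_1: "lie_bracket H (ha_lift H (Suc 0) x) (ha_lift H (Suc 0) x') = vf S (core_field (2 *\<^sub>R \<beta> x x'))"
  unfolding lifts lie_bracket_vf[OF lift_smooth(2) lift_smooth(2)] vf_eq_iff
  using skew_\<beta>[of x' x]
  by (auto simp: fun_eq_iff lift_bracket poly_field_apply multilinear_simps scaleR_2)

lemma bracket_0_core: "lie_bracket H (ha_lift H 0 x) (vf S (core_field v)) = vf S (core_field (\<rho> x v))"
  unfolding lifts lie_bracket_vf[OF lift_smooth(1) lift_smooth(3)] vf_eq_iff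
  by (auto simp: fun_eq_iff lift_bracket poly_field_apply multilinear_simps)

lemma scale_core_field: "scale_vf r (vf S (core_field v)) = vf S (core_field (r *\<^sub>R v))"
  unfolding scale_vf_vf vf_eq_iff by (auto simp: fun_eq_iff poly_field_apply)

lemma ha_bracket_normal: "ha_bracket H = b"
  by (intro ext) (metis ha_bracket_eq skew_b)

lemma ha_del_normal: "ha_del H = d"
  by (rule ext) (simp add: ha_del_def lifts scale_core_field vf_core_poly_field)

lemma ha_beta_normal: "ha_beta H = \<beta>"
  by (intro ext) (simp add: ha_beta_def bracket_1_1 scale_core_field vf_core_poly_field)

lemma ha_box_normal: "ha_box H = \<rho>"
  by (intro ext) (simp add: ha_box_def core_vf_poly_field bracket_0_core vf_core_poly_field)

lemma lie_bracket_flip: "lie_bracket H X Y = scale_vf (-1) (lie_bracket H Y X)"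
  by (auto simp: lie_bracket_def scale_vf_def fun_eq_iff)

lemma bracket_1_0_poly_field: "lie_bracket H (ha_lift H (Suc 0) x') (ha_lift H 0 x) =
    vf S (poly_field (\<lambda>y. 0) (b x' x) (\<lambda>z. 0) (\<lambda>y y'. 0)
      (\<lambda>y. - \<beta> (b y x) x' - \<rho> x (\<beta> y x') + 2 *\<^sub>R \<omega> x y x') 0)"
  unfolding lie_bracket_flip[of "ha_lift H (Suc 0) x'"] bracket_0_1 scale_vf_vf vf_eq_iff
  by (auto simp: fun_eq_iff poly_field_apply scaleR_2)

lemma double_bracket:
  "lie_bracket H (ha_lift H (Suc 0) s1) (lie_bracket H (ha_lift H (Suc 0) s2) (ha_lift H 0 s)) =
    vf S (core_field (2 *\<^sub>R \<omega> s s1 s2 - \<rho> s (\<beta> s1 s2) - \<beta> (b s1 s) s2 - \<beta> (b s2 s) s1))"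
proof -
  let ?F = "\<lambda>y. - \<beta> (b y s) s2 - \<rho> s (\<beta> y s2) + 2 *\<^sub>R \<omega> s y s2"
  have F: "linear ?F"
    by (simp add: linear_iff multilinear_simps algebra_simps)
  show ?thesis
    unfolding bracket_1_0_poly_field unfolding lifts(2)
      lie_bracket_vf[OF lift_smooth(2) smooth_poly_field[OF linear_zero linear_zero bilinear_0 F]] vf_eq_iff
  proof (rule ext)
    fix p :: "'g \<times> 'c"
    obtain y z where p: "p = (y, z)" by fastforce
    show "vs_bracket (lift1 s1) (poly_field (\<lambda>y. 0) (b s2 s) (\<lambda>z. 0) (\<lambda>y y'. 0) ?F 0) p
      = core_field (2 *\<^sub>R \<omega> s s1 s2 - \<rho> s (\<beta> s1 s2) - \<beta> (b s1 s) s2 - \<beta> (b s2 s) s1) p"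
      unfolding p poly_field_apply
        vs_bracket_poly_field[OF linear_zero linear_zero bilinear_0 linear_\<beta> linear_zero linear_zero bilinear_0 F]
      by (simp add: algebra_simps)
  qed
qed

text \<open>
  The summands besides \<open>\<omega>\<close> are skew in \<open>s1\<close>, \<open>s2\<close> and disappear under symmetrization.
\<close>

lemma ha_omega_normal:
  "ha_omega H s1 s2 s = \<omega> s s1 s2
     + (1/2) *\<^sub>R (\<beta> (b s2 s) s1 - \<beta> (b s1 s) s2 - \<rho> s (\<beta> s1 s2))"
proof -
  have half: "(1/2) *\<^sub>R (2 *\<^sub>R w - r - q - p) - (- p) = w + (1/2) *\<^sub>R (p - q - r)" for w r q p :: 'c
  proof -
    have "(1/2) *\<^sub>R (2 *\<^sub>R w - r - q - p) - (- p) = (1/2) *\<^sub>R ((2 *\<^sub>R w - r - q - p) + (p + p))"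
      by (simp only: scaleR_right_distrib[of _ _ "p + p"] scaleR_half_double diff_minus_eq_add)
    also have "(2 *\<^sub>R w - r - q - p) + (p + p) = (w + w) + (p - q - r)"
      by (simp add: scaleR_2)
    also have "(1/2) *\<^sub>R ((w + w) + (p - q - r)) = w + (1/2) *\<^sub>R (p - q - r)"
      by (simp only: scaleR_right_distrib[of _ "w + w"] scaleR_half_double)
    finally show ?thesis .
  qed
  show ?thesis
    unfolding ha_omega_def One_nat_def double_bracket scale_core_field vf_core_poly_field ha_beta_normal
      ha_bracket_normal skew_\<beta>[of s1 "b s2 s"]
    by (rule half)
qed

lemma ha_omega_sym_normal: "ha_omega_sym H = \<omega>"
proof (intro ext)
  fix s x y
  have "\<rho> s (\<beta> x y) + \<rho> s (\<beta> y x) = 0"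
    using skew_\<beta>[of x y] by (simp add: multilinear_simps)
  moreover have "ha_omega H x y s + ha_omega H y x s
      = 2 *\<^sub>R \<omega> s x y - (1/2) *\<^sub>R (\<rho> s (\<beta> x y) + \<rho> s (\<beta> y x))"
    unfolding ha_omega_normal \<omega>_commute[of s y x] by (simp add: algebra_simps scaleR_2)
  ultimately have "(1/2) *\<^sub>R (ha_omega H x y s + ha_omega H y x s) = \<omega> s x y" by simp
  then show "ha_omega_sym H s x y = \<omega> s x y"
    by (simp add: ha_omega_sym_def scaleR_right_distrib)
qed

lemma splitting_normal: "splitting H = S"
proof -
  have "\<beta> x x = 0" for x
    using skew_\<beta>[of x x] by (simp add: eq_neg_iff_add_eq_0 flip: scaleR_2)
  then show ?thesis by (auto simp: splitting_eq)
qed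

lemma lift_weights:
  assumes "\<alpha> \<le> 2"
  shows "ha_lift H \<alpha> x \<in> vf_of_weight H (- real \<alpha>)"
proof -
  have W: "(\<lambda>(y, z). (y, 2 *\<^sub>R z)) = poly_field (\<lambda>y. y) 0 (\<lambda>z::'c. 2 *\<^sub>R z) (\<lambda>y y'. 0) (\<lambda>y::'g. 0) 0"
    by (auto simp: poly_field_def)
  have lin: "linear (\<lambda>y::'g. y)" "linear (\<lambda>z::'c. 2 *\<^sub>R z)"
    by (auto simp: linear_iff scaleR_right_distrib)
  note br = vs_bracket_poly_field[OF lin bilinear_0 linear_zero]
  consider "\<alpha> = 0" | "\<alpha> = Suc 0" | "\<alpha> = 2" using assms by linarith
  then show ?thesis
  proof cases
    case 1
    show ?thesis unfolding 1 lifts vf_of_weight_iff[OF lift_smooth(1)] W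
      by (auto simp: fun_eq_iff br[OF linear_b linear_\<rho> bilinear_\<omega> linear_zero] poly_field_apply
          multilinear_simps algebra_simps scaleR_2 zero_prod_def)
  next
    case 2
    show ?thesis unfolding 2 lifts vf_of_weight_iff[OF lift_smooth(2)] W
      by (auto simp: fun_eq_iff br[OF linear_zero linear_zero bilinear_0 linear_\<beta>] poly_field_apply
          multilinear_simps algebra_simps scaleR_2 zero_prod_def)
  next
    case 3
    show ?thesis unfolding 3 lifts vf_of_weight_iff[OF lift_smooth(3)] W
      by (auto simp: fun_eq_iff br[OF linear_zero linear_zero bilinear_0 linear_zero] poly_field_apply
          multilinear_simps algebra_simps scaleR_2 zero_prod_def)
  qed
qed

lemma skew_ha2: "skew_ha2 H"
proof -
  have "kappa H e A \<in> tangent_space H e" for e A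
  proof -
    obtain p where e: "e = S p" by (metis S_inv)
    obtain a0 a1 a2 where A: "A = (a0, a1, a2)" by (metis prod_cases3)
    show ?thesis unfolding e A kappa_S tangent_space_S by blast
  qed
  moreover have "linear (\<lambda>A. kappa H e A f)" for e f
  proof -
    obtain y z where e: "e = S (y, z)" by (metis S_inv surj_pair)
    have "linear (\<lambda>(a0, a1, a2). (b y a0 + a1, - \<rho> a0 z + \<omega> a0 y y + \<beta> y a1 + d a2))"
      by (auto simp: linear_iff multilinear_simps algebra_simps)
    from linear_compose[OF this linear_tv[of "(y, z)" f]] show ?thesis
      unfolding e o_def by (simp add: kappa_S poly_field_apply case_prod_unfold linear_iff)
  qed
  moreover have "(\<lambda>e. kappa H e A f) \<in> smooth_fun H" if f: "f \<in> smooth_fun H" for A f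
  proof -
    obtain a0 a1 a2 where A: "A = (a0, a1, a2)" by (metis prod_cases3)
    have "(\<lambda>e. kappa H e A)
        = vf S (poly_field (\<lambda>y. b y a0) a1 (\<lambda>z. - \<rho> a0 z) (\<omega> a0) (\<lambda>y. \<beta> y a1) (d a2))"
      unfolding A by (rule vf_eqI) (rule kappa_S)
    from fun_cong[OF this] show ?thesis
      using smooth_fun_vf(1)[OF smooth_poly_field[OF linear_b linear_\<rho> bilinear_\<omega> linear_\<beta>] f] by (simp only:)
  qed
  moreover have "kappa H (act H s e) (jet2 (\<lambda>t. a (s * t))) = push H (act H s) (kappa H e (jet2 a))"
    if a: "smooth a" for s e a
  proof -
    obtain y z where e: "e = S (y, z)" by (metis S_inv surj_pair)
    obtain a0 a1 a2 where A: "jet2 a = (a0, a1, a2)" by (metis prod_cases3)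
    show ?thesis
      unfolding jet2_reparam[OF a A] A e act_S kappa_S poly_field_apply push_act tv_eq_iff
      by (simp add: multilinear_simps algebra_simps power2_eq_square)
  qed
  moreover have "algebroid_pt (reduction1 H)"
    unfolding algebroid_pt_def
  proof (intro exI[of _ "\<lambda>y (a0, a1). b y a0 + a1"] conjI allI)
    show "linear (\<lambda>(a0, a1). b y a0 + a1)" for y
      by (auto simp: linear_iff multilinear_simps algebra_simps)
    show "smooth (\<lambda>y. case A of (a0, a1) \<Rightarrow> b y a0 + a1)" for A
      by (cases A) (simp, intro smooth_intros smooth_linear linear_b)
    show "reduction1 H = {(A, (y, case A of (a0, a1) \<Rightarrow> b y a0 + a1)) | A y. True}"
      unfolding reduction1_eq by auto
  qed (auto simp: multilinear_simps algebra_simps)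
  moreover have "sym (reduction1 H)"
    unfolding sym_reduction1_iff using skew_b by blast
  ultimately show ?thesis
    using graded by (simp add: skew_ha2_def higher_algebroid2_def)
qed

end

section \<open>Lie higher algebroids\<close>

context ha_normal begin

lemma lift_uminus:
  assumes "\<alpha> \<le> 2"
  shows "ha_lift H \<alpha> (- x) = scale_vf (-1) (ha_lift H \<alpha> x)"
proof -
  consider "\<alpha> = 0" | "\<alpha> = Suc 0" | "\<alpha> = 2" using assms by linarith
  then show ?thesis
  proof cases
    case 1
    show ?thesis unfolding 1 lifts scale_vf_vf vf_eq_iff
      by (auto simp: fun_eq_iff poly_field_apply multilinear_simps)
  next
    case 2
    show ?thesis unfolding 2 lifts scale_vf_vf vf_eq_iff
      by (auto simp: fun_eq_iff poly_field_apply multilinear_simps)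
  next
    case 3
    show ?thesis unfolding 3 lifts scale_vf_vf vf_eq_iff
      by (auto simp: fun_eq_iff poly_field_apply multilinear_simps)
  qed
qed

lemma bracket_flip:
  assumes "\<alpha> + \<beta>' \<le> 2"
    and "lie_bracket H (ha_lift H \<alpha> x) (ha_lift H \<beta>' y) = ha_lift H (\<alpha> + \<beta>') (b x y)"
  shows "lie_bracket H (ha_lift H \<beta>' y) (ha_lift H \<alpha> x) = ha_lift H (\<beta>' + \<alpha>) (b y x)"
  unfolding lie_bracket_flip[of "ha_lift H \<beta>' y"] assms(2) skew_b[of y x] add.commute[of \<beta>' \<alpha>]
  by (rule lift_uminus[OF assms(1), symmetric])

lemma lie_ha2_iff_brackets:
  "lie_ha2 H \<longleftrightarrow> (\<forall>x y.
     lie_bracket H (ha_lift H 0 x) (ha_lift H 0 y) = ha_lift H 0 (b x y) \<and>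
     lie_bracket H (ha_lift H 0 x) (ha_lift H (Suc 0) y) = ha_lift H (Suc 0) (b x y) \<and>
     lie_bracket H (ha_lift H 0 x) (ha_lift H 2 y) = ha_lift H 2 (b x y) \<and>
     lie_bracket H (ha_lift H (Suc 0) x) (ha_lift H (Suc 0) y) = ha_lift H 2 (b x y))"
  (is "_ \<longleftrightarrow> (\<forall>x y. ?P x y)")
proof
  assume "lie_ha2 H"
  then have *: "lie_bracket H (ha_lift H \<alpha> x) (ha_lift H \<beta>' y) = ha_lift H (\<alpha> + \<beta>') (b x y)"
    if "\<alpha> + \<beta>' \<le> 2" for \<alpha> \<beta>' x y
    using that by (simp add: lie_ha2_def ha_bracket_normal)
  show "\<forall>x y. ?P x y"
    using *[of 0 0] *[of 0 "Suc 0"] *[of 0 2] *[of "Suc 0" "Suc 0"] by (simp add: numeral_2_eq_2)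
next
  assume P: "\<forall>x y. ?P x y"
  have "lie_bracket H (ha_lift H \<alpha> x) (ha_lift H \<beta>' y) = ha_lift H (\<alpha> + \<beta>') (b x y)"
    if "\<alpha> + \<beta>' \<le> 2" for \<alpha> \<beta>' x y
  proof -
    have up: "lie_bracket H (ha_lift H \<alpha> x) (ha_lift H \<beta>' y) = ha_lift H (\<alpha> + \<beta>') (b x y)"
      if "\<alpha> \<le> \<beta>'" "\<alpha> + \<beta>' \<le> 2" for \<alpha> \<beta>' x y
    proof -
      have "\<alpha> = 0 \<and> \<beta>' = 0 \<or> \<alpha> = 0 \<and> \<beta>' = Suc 0 \<or> \<alpha> = 0 \<and> \<beta>' = 2 \<or> \<alpha> = Suc 0 \<and> \<beta>' = Suc 0"
        using that by presburger
      then show ?thesis by (elim disjE conjE) (use P in \<open>simp_all add: numeral_2_eq_2\<close>)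
    qed
    show ?thesis
    proof (cases "\<alpha> \<le> \<beta>'")
      case False
      with that show ?thesis
        by (intro bracket_flip[OF _ up]) simp_all
    qed (rule up, assumption, rule that)
  qed
  then show "lie_ha2 H" by (simp add: lie_ha2_def skew_ha2 ha_bracket_normal)
qed

lemma bracket_0_0_iff:
  "lie_bracket H (ha_lift H 0 x) (ha_lift H 0 x') = ha_lift H 0 (b x x') \<longleftrightarrow>
   (\<forall>y z. b (b y x) x' - b (b y x') x = b y (b x x') \<and>
     \<rho> x' (\<rho> x z) - \<rho> x (\<rho> x' z) + (\<rho> x (\<omega> x' y y) - \<rho> x' (\<omega> x y y))
       + (2 *\<^sub>R \<omega> x' y (b y x) - 2 *\<^sub>R \<omega> x y (b y x')) = - \<rho> (b x x') z + \<omega> (b x x') y y)"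
  unfolding bracket_0_0 unfolding lifts vf_eq_iff by (auto simp: fun_eq_iff poly_field_apply)

lemma bracket_0_1_iff:
  "lie_bracket H (ha_lift H 0 x) (ha_lift H (Suc 0) x') = ha_lift H (Suc 0) (b x x') \<longleftrightarrow>
   (\<forall>y. \<beta> (b y x) x' + \<rho> x (\<beta> y x') - 2 *\<^sub>R \<omega> x y x' = \<beta> y (b x x'))"
proof -
  have "- b x' x = b x x'" by (rule skew_b[symmetric])
  then show ?thesis
    unfolding bracket_0_1 unfolding lifts vf_eq_iff by (auto simp: fun_eq_iff poly_field_apply)
qed

lemma bracket_0_2_iff:
  "lie_bracket H (ha_lift H 0 x) (ha_lift H 2 x') = ha_lift H 2 (b x x') \<longleftrightarrow> \<rho> x (d x') = d (b x x')"
  unfolding lifts(3) bracket_0_core vf_eq_iff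
  by (auto simp: fun_eq_iff poly_field_apply multilinear_simps)

lemma bracket_1_1_iff:
  "lie_bracket H (ha_lift H (Suc 0) x) (ha_lift H (Suc 0) x') = ha_lift H 2 (b x x') \<longleftrightarrow> \<beta> x x' = d (b x x')"
  unfolding lifts(3) bracket_1_1 vf_eq_iff
  by (auto simp: fun_eq_iff poly_field_apply)

text \<open>
  For \<open>\<omega> = 0\<close> the identity from \<open>bracket_0_1_iff\<close> is used together with the one where \<open>y\<close> and \<open>x'\<close> are
  exchanged: in the sum of the two all terms with \<open>\<beta>\<close> cancel, and \<open>4 \<omega>\<close> remains. In the converse
  direction the same identity for \<open>\<beta> = d \<circ> b\<close> is the image under \<open>d\<close> of the Jacobi identity.
\<close>

lemma lie_ha2_iff:
  "lie_ha2 H \<longleftrightarrow> lie_algebra b \<and> lie_module b \<rho> \<and> module_morphism b \<rho> d \<and>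
     (\<forall>e y z. \<omega> e y z = 0) \<and> (\<forall>x y. \<beta> x y = d (b x y))"
proof
  assume "lie_ha2 H"
  then have r00: "b (b y x) x' - b (b y x') x = b y (b x x')"
      "\<rho> x' (\<rho> x z) - \<rho> x (\<rho> x' z) + (\<rho> x (\<omega> x' y y) - \<rho> x' (\<omega> x y y))
       + (2 *\<^sub>R \<omega> x' y (b y x) - 2 *\<^sub>R \<omega> x y (b y x')) = - \<rho> (b x x') z + \<omega> (b x x') y y"
    and r01: "\<beta> (b y x) x' + \<rho> x (\<beta> y x') - 2 *\<^sub>R \<omega> x y x' = \<beta> y (b x x')"
    and r02: "\<rho> x (d x') = d (b x x')" and r11: "\<beta> x x' = d (b x x')" for x x' y z
    unfolding lie_ha2_iff_brackets bracket_0_0_iff bracket_0_1_iff bracket_0_2_iff bracket_1_1_iff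
    by blast+
  have "b x (b y z) + b y (b z x) + b z (b x y) = 0" for x y z
  proof -
    have "b y (b z x) = - b (b z x) y" "b z (b x y) = b (b y x) z"
      using skew_b[of y "b z x"] skew_b[of z "b x y"] skew_b[of x y] by (simp_all add: multilinear_simps)
    moreover have "b (b x y) z - b (b x z) y = b x (b y z)" by (rule r00(1))
    moreover have "b (b z x) y = - b (b x z) y" "b (b y x) z = - b (b x y) z"
      using skew_b[of z x] skew_b[of y x] by (simp_all add: multilinear_simps)
    ultimately show ?thesis by (simp add: algebra_simps)
  qed
  moreover have "\<rho> (b x y) v = \<rho> x (\<rho> y v) - \<rho> y (\<rho> x v)" for x y v
    using r00(2)[of y x v 0] by (simp add: multilinear_simps algebra_simps)
  moreover have "\<omega> x y x' = 0" for x y x'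
  proof -
    have 1: "2 *\<^sub>R \<omega> x y x' = \<beta> (b y x) x' + \<rho> x (\<beta> y x') - \<beta> y (b x x')" for y x'
      using r01[of y x x'] by (simp add: algebra_simps)
    have "\<beta> (b x' x) y = \<beta> y (b x x')" "\<beta> x' (b x y) = \<beta> (b y x) x'" "\<rho> x (\<beta> x' y) = - \<rho> x (\<beta> y x')"
      using skew_\<beta>[of "b x' x" y] skew_\<beta>[of x' "b x y"] skew_\<beta>[of x' y] skew_b[of x x'] skew_b[of y x]
      by (simp_all add: multilinear_simps)
    then have "2 *\<^sub>R \<omega> x y x' + 2 *\<^sub>R \<omega> x x' y = 0"
      unfolding 1 by simp
    then show ?thesis
      unfolding \<omega>_commute[of x x' y] by (simp flip: scaleR_left_distrib)
  qed
  ultimately show "lie_algebra b \<and> lie_module b \<rho> \<and> module_morphism b \<rho> d \<and>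
     (\<forall>e y z. \<omega> e y z = 0) \<and> (\<forall>x y. \<beta> x y = d (b x y))"
    using bilinear_b bilinear_\<rho> linear_d skew_b r02[symmetric] r11
    unfolding lie_algebra_def lie_module_def module_morphism_def skew_bilin_def
    by (intro conjI allI)
next
  assume "lie_algebra b \<and> lie_module b \<rho> \<and> module_morphism b \<rho> d \<and>
     (\<forall>e y z. \<omega> e y z = 0) \<and> (\<forall>x y. \<beta> x y = d (b x y))"
  then have jac: "b x (b y z) + b y (b z x) + b z (b x y) = 0"
    and mod: "\<rho> (b x y) v = \<rho> x (\<rho> y v) - \<rho> y (\<rho> x v)"
    and mor: "d (b x y) = \<rho> x (d y)"
    and \<omega>0: "\<omega> x y z = 0" and \<beta>d: "\<beta> x y = d (b x y)" for x y z v
    by (auto simp: lie_algebra_def lie_module_def module_morphism_def)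
  have r00: "b (b y x) x' - b (b y x') x = b y (b x x')" for x x' y
  proof -
    have "b (b y x) x' - b (b y x') x = - b x' (b y x) - b x (b x' y)"
      using skew_b[of "b y x" x'] skew_b[of "b y x'" x] skew_b[of y x'] by (simp add: multilinear_simps)
    also have "\<dots> = b y (b x x') - (b y (b x x') + b x (b x' y) + b x' (b y x))" by simp
    also have "\<dots> = b y (b x x')" unfolding jac by simp
    finally show ?thesis .
  qed
  have r01: "\<beta> (b y x) x' + \<rho> x (\<beta> y x') = \<beta> y (b x x')" for x x' y
  proof -
    have "\<beta> (b y x) x' + \<rho> x (\<beta> y x') = d (b (b y x) x' + b x (b y x'))"
      by (simp add: \<beta>d mor[symmetric] multilinear_simps)
    also have "b x (b y x') = - b (b y x') x" by (rule skew_b)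
    also have "b (b y x) x' + - b (b y x') x = b y (b x x')" using r00[of y x x'] by simp
    finally show ?thesis by (simp add: \<beta>d)
  qed
  show "lie_ha2 H"
    unfolding lie_ha2_iff_brackets bracket_0_0_iff bracket_0_1_iff bracket_0_2_iff bracket_1_1_iff
    by (intro allI conjI; (simp only: r00 mor \<beta>d; fail)?)
      (simp_all add: mod \<omega>0 r01 multilinear_simps)
qed

lemma structure_properties:
  "graded_splitting H (splitting H)" "skew_bilin (ha_bracket H)" "linear (ha_del H)"
  "skew_bilin (ha_beta H)" "bilinear (ha_box H)" "linear (\<lambda>e. ha_omega_sym H e y z)"
  "sym_bilin (ha_omega_sym H e)"
  unfolding splitting_normal ha_bracket_normal ha_del_normal ha_beta_normal ha_box_normal ha_omega_sym_normal
  by (fact splits linear_d bilinear_\<rho> linear_\<omega> sym_bilin_\<omega>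
      | unfold skew_bilin_def, intro conjI allI; fact bilinear_b bilinear_\<beta> skew_b skew_\<beta>)+

lemma lift_fields:
  "ha_lift H 0 e = field0 H (\<lambda>y. ha_bracket H y e) (ha_box H (- e)) (\<lambda>y z. 2 *\<^sub>R ha_omega_sym H e y z)"
  "ha_lift H 1 e = field1 H e (\<lambda>y. ha_beta H y e)"
  "ha_lift H 2 e = field2 H (2 *\<^sub>R ha_del H e)"
proof -
  have "graded_coords H (splitting H)" unfolding splitting_normal by (rule graded_coords_axioms)
  note sp = split_vf_eq[OF this, unfolded splitting_normal]
  show "ha_lift H 0 e = field0 H (\<lambda>y. ha_bracket H y e) (ha_box H (- e)) (\<lambda>y z. 2 *\<^sub>R ha_omega_sym H e y z)"
    "ha_lift H 1 e = field1 H e (\<lambda>y. ha_beta H y e)"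
    "ha_lift H 2 e = field2 H (2 *\<^sub>R ha_del H e)"
    unfolding field0_def field1_def field2_def sp One_nat_def lifts vf_eq_iff
      ha_bracket_normal ha_del_normal ha_beta_normal ha_box_normal ha_omega_sym_normal
    by (simp_all add: poly_field_def multilinear_simps)
qed

end

section \<open>Isomorphisms of skew higher algebroids\<close>

locale ha_normal_pair =
  H: ha_normal H S b \<rho> d \<beta> \<omega> + H': ha_normal H' S' b' \<rho>' d' \<beta>' \<omega>'
  for H :: "('e, 'g::findim, 'c::findim) ha2" and S b \<rho> d \<beta> \<omega>
    and H' :: "('f, 'h::findim, 'd::findim) ha2" and S' b' \<rho>' d' \<beta>' \<omega>' +
  fixes A :: "'g \<Rightarrow> 'h" and B :: "'c \<Rightarrow> 'd"
  assumes linear_A: "linear A" and bij_A: "bij A" and linear_B: "linear B" and bij_B: "bij B"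
begin

lemma same_structure_maps_iff: "same_structure_maps H H' A B \<longleftrightarrow>
     (\<forall>x y. A (b x y) = b' (A x) (A y)) \<and> (\<forall>x. B (d x) = d' (A x)) \<and>
     (\<forall>x y. B (\<beta> x y) = \<beta>' (A x) (A y)) \<and> (\<forall>x c. B (\<rho> x c) = \<rho>' (A x) (B c)) \<and>
     (\<forall>x y z. B (\<omega> x y z) = \<omega>' (A x) (A y) (A z))"
  unfolding same_structure_maps_def H.ha_bracket_normal H.ha_del_normal H.ha_beta_normal
    H.ha_box_normal H.ha_omega_sym_normal H'.ha_bracket_normal H'.ha_del_normal H'.ha_beta_normal
    H'.ha_box_normal H'.ha_omega_sym_normal ..

text \<open>
  Homogeneity makes \<open>\<Phi>\<close> quadratic, and the normal forms of source and target leave no room for a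
  quadratic term, since both \<open>\<beta>\<close> and \<open>\<beta>'\<close> vanish on the diagonal.
\<close>

lemma iso_in_coordinates:
  assumes iso: "ha2_iso H H' A B \<Phi>"
  shows "\<Phi> (S (y, z)) = S' (A y, B z)" "same_structure_maps H H' A B"
proof -
  have sm: "smooth_map H H' \<Phi>" and act: "\<And>t e. \<Phi> (act H t e) = act H' t (\<Phi> e)"
    and pr: "\<And>e. proj H' (\<Phi> e) = A (proj H e)" and co: "\<And>c. \<Phi> (core H c) = core H' (B c)"
    and ka: "\<And>e a. smooth a \<Longrightarrow> kappa H' (\<Phi> e) (jet2 (A \<circ> a)) = push H' \<Phi> (kappa H e (jet2 a))"
    using iso by (simp_all add: ha2_iso_def)
  define F where "F p = inv S' (\<Phi> (S p))" for p
  have \<Phi>S: "\<Phi> (S p) = S' (F p)" for p by (simp add: F_def)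
  have smooth_F: "smooth F"
  proof (rule smooth_if_functionals_smooth)
    fix l :: "'h \<times> 'd \<Rightarrow> real" assume l: "linear l"
    have "l \<circ> inv S' \<circ> S' = l" by (auto simp: fun_eq_iff)
    then have "l \<circ> inv S' \<in> smooth_fun H'"
      unfolding H'.smooth_fun_iff using smooth_linear[OF l] by simp
    then have "smooth (l \<circ> inv S' \<circ> \<Phi> \<circ> S)"
      using sm unfolding smooth_map_def H.smooth_fun_iff by blast
    then show "smooth (\<lambda>p. l (F p))" by (simp add: F_def o_def)
  qed
  have F_fst: "fst (F (y, z)) = A y" for y z
    using pr[of "S (y, z)"] by (simp add: \<Phi>S H'.proj_S_fst)
  have F_core: "F (0, z) = (0, B z)" for z
    using co[of z] unfolding H.S_core[symmetric] H'.S_core[symmetric] \<Phi>S H'.S_eq_iff .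
  have F_snd: "snd (F (s *\<^sub>R y, s\<^sup>2 *\<^sub>R z)) = s\<^sup>2 *\<^sub>R snd (F (y, z))" for s y z
  proof -
    obtain u w where F: "F (y, z) = (u, w)" by fastforce
    have "F (s *\<^sub>R y, s\<^sup>2 *\<^sub>R z) = (s *\<^sub>R u, s\<^sup>2 *\<^sub>R w)"
      using act[of s "S (y, z)"] unfolding H.act_S \<Phi>S F H'.act_S H'.S_eq_iff .
    then show ?thesis by (simp add: F)
  qed
  define Q where "Q = polar_form (\<lambda>y. snd (F (y, 0)))"
  note w2 = homogeneous_weight_2[OF smooth_snd[OF smooth_F] F_snd]
  have sQ: "sym_bilin Q" unfolding Q_def by (rule w2(2))
  then have bQ: "bilinear Q" and Q_comm: "\<And>x y. Q x y = Q y x" by (auto simp: sym_bilin_def)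
  have F_eq: "F (y, z) = (A y, B z + Q y y)" for y z
    using w2(3)[of y z] by (simp add: prod_eq_iff F_fst F_core Q_def)
  have dF: "frechet_derivative F (at (y, z)) = (\<lambda>(u, w). (A u, B w + (Q y u + Q u y)))" for y z
  proof -
    note L = bounded_linear.has_derivative[OF findim_linear_bounded]
    have "F = (\<lambda>p. (A (fst p), B (snd p) + Q (fst p) (fst p)))"
      by (auto simp: F_eq fun_eq_iff)
    moreover have "((\<lambda>p. (A (fst p), B (snd p) + Q (fst p) (fst p))) has_derivative
      (\<lambda>p. (A (fst p), B (snd p) + (Q (fst (y, z)) (fst p) + Q (fst p) (fst (y, z)))))) (at (y, z))"
      by (intro has_derivative_Pair has_derivative_add L[OF linear_A] L[OF linear_B]
          has_derivative_fst has_derivative_snd has_derivative_ident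
          bounded_bilinear.FDERIV[OF findim_bilinear_bounded[OF bQ]])
    ultimately have "(F has_derivative
      (\<lambda>p. (A (fst p), B (snd p) + (Q (fst (y, z)) (fst p) + Q (fst p) (fst (y, z)))))) (at (y, z))"
      by (simp only:)
    from frechet_derivative_eqI[OF this] show ?thesis by (simp add: case_prod_beta')
  qed
  \<comment> \<open>the intertwining condition, evaluated on the jet \<open>(a0, a1, a2)\<close> at \<open>S (y, z)\<close>; setting all but one of the parameters to zero isolates the structure maps\<close>
  have K: "b' (A y) (A a0) + A a1 = A (b y a0 + a1)"
    "- \<rho>' (A a0) (B z + Q y y) + \<omega>' (A a0) (A y) (A y) + \<beta>' (A y) (A a1) + d' (A a2)
       = B (- \<rho> a0 z + \<omega> a0 y y + \<beta> y a1 + d a2) + (Q y (b y a0 + a1) + Q (b y a0 + a1) y)"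
    for y z a0 a1 a2
  proof -
    note j = jet2_quadratic_curve[of a0 a1 a2]
    note sq = smooth_quadratic_curve[of a0 a1 a2]
    note p = push_tv[OF H.graded_coords_axioms H'.graded_coords_axioms smooth_F \<Phi>S]
    have "(b' (A y) (A a0) + A a1, - \<rho>' (A a0) (B z + Q y y) + \<omega>' (A a0) (A y) (A y) + \<beta>' (A y) (A a1) + d' (A a2))
     = (A (b y a0 + a1), B (- \<rho> a0 z + \<omega> a0 y y + \<beta> y a1 + d a2) + (Q y (b y a0 + a1) + Q (b y a0 + a1) y))"
      using ka[OF sq, of "S (y, z)"]
      unfolding jet2_linear_comp[OF linear_A sq j] j \<Phi>S H.kappa_S H'.kappa_S p H'.tv_eq_iff dF F_eq
        poly_field_apply split .
    then show "b' (A y) (A a0) + A a1 = A (b y a0 + a1)"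
      "- \<rho>' (A a0) (B z + Q y y) + \<omega>' (A a0) (A y) (A y) + \<beta>' (A y) (A a1) + d' (A a2)
       = B (- \<rho> a0 z + \<omega> a0 y y + \<beta> y a1 + d a2) + (Q y (b y a0 + a1) + Q (b y a0 + a1) y)"
      by blast+
  qed
  note zeros = H.multilinear_simps(7,8) linear_0[OF linear_A] linear_0[OF linear_B] linear_0[OF H.linear_d]
    linear_0[OF H'.linear_d] linear_0[OF H.linear_\<omega>] linear_0[OF H'.linear_\<omega>]
    bilinear_lzero[OF H.bilinear_\<rho>] bilinear_rzero[OF H.bilinear_\<rho>] bilinear_lzero[OF H'.bilinear_\<rho>] bilinear_rzero[OF H'.bilinear_\<rho>]
    bilinear_lzero[OF H.bilinear_\<beta>] bilinear_rzero[OF H.bilinear_\<beta>] bilinear_lzero[OF H'.bilinear_\<beta>] bilinear_rzero[OF H'.bilinear_\<beta>]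
    bilinear_lzero[OF H.bilinear_b] bilinear_rzero[OF H.bilinear_b] bilinear_lzero[OF H'.bilinear_b] bilinear_rzero[OF H'.bilinear_b]
    bilinear_lzero[OF H.bilinear_\<omega>] bilinear_lzero[OF H'.bilinear_\<omega>]
    bilinear_lzero[OF bQ] bilinear_rzero[OF bQ] linear_neg[OF linear_B]
  have alt: "\<beta> x x = 0" "\<beta>' u u = 0" for x u
    using H.skew_\<beta>[of x x] H'.skew_\<beta>[of u u] by (simp_all add: eq_neg_iff_add_eq_0 flip: scaleR_2)
  have "Q y y = 0" for y
    using K(2)[where y=y and z=0 and ?a0.0=0 and ?a1.0=y and ?a2.0=0] by (simp add: zeros alt flip: scaleR_2)
  then have Q0: "Q x y = 0" for x y
    using skew_if_alternating[OF bQ, of x y] Q_comm[of x y] by (simp add: eq_neg_iff_add_eq_0 flip: scaleR_2)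
  show "\<Phi> (S (y, z)) = S' (A y, B z)"
    by (simp add: \<Phi>S F_eq Q0)
  have "A (b x y) = b' (A x) (A y)" for x y
    using K(1)[where y=x and ?a0.0=y and ?a1.0=0] by (simp add: zeros)
  moreover have "B (d x) = d' (A x)" for x
    using K(2)[where y=0 and z=0 and ?a0.0=0 and ?a1.0=0 and ?a2.0=x] by (simp add: zeros Q0)
  moreover have "B (\<beta> x y) = \<beta>' (A x) (A y)" for x y
    using K(2)[where y=x and z=0 and ?a0.0=0 and ?a1.0=y and ?a2.0=0] by (simp add: zeros Q0)
  moreover have "B (\<rho> x c) = \<rho>' (A x) (B c)" for x c
    using K(2)[where y=0 and z=c and ?a0.0=x and ?a1.0=0 and ?a2.0=0] by (simp add: zeros Q0)
  moreover have "B (\<omega> x y z) = \<omega>' (A x) (A y) (A z)" for x y z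
  proof (rule sym_bilin_eq_if_diagonal_eq[where f = "\<lambda>y z. B (\<omega> x y z)" and g = "\<lambda>y z. \<omega>' (A x) (A y) (A z)"])
    show "sym_bilin (\<lambda>y z. B (\<omega> x y z))"
      using H.sym_bilin_\<omega>[of x] linear_B unfolding sym_bilin_def bilinear_def
      by (auto intro: linear_compose[unfolded o_def, of _ B])
    show "sym_bilin (\<lambda>y z. \<omega>' (A x) (A y) (A z))"
      using H'.sym_bilin_\<omega>[of "A x"] linear_A unfolding sym_bilin_def bilinear_def
      by (auto intro: linear_compose[unfolded o_def, of A])
    show "B (\<omega> x y y) = \<omega>' (A x) (A y) (A y)" for y
      using K(2)[where y=y and z=0 and ?a0.0=x and ?a1.0=0 and ?a2.0=0] by (simp add: zeros Q0)
  qed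
  ultimately show "same_structure_maps H H' A B"
    unfolding same_structure_maps_iff by blast
qed

definition product_map :: "'e \<Rightarrow> 'f" where
  "product_map e = S' (A (fst (inv S e)), B (snd (inv S e)))"

lemma product_map_S: "product_map (S p) = S' (A (fst p), B (snd p))"
  by (simp add: product_map_def)

lemma product_map_iso:
  assumes same: "same_structure_maps H H' A B"
  shows "ha2_iso H H' A B product_map"
proof -
  have same': "A (b x y) = b' (A x) (A y)" "B (d x) = d' (A x)" "B (\<beta> x y) = \<beta>' (A x) (A y)"
    "B (\<rho> x c) = \<rho>' (A x) (B c)" "B (\<omega> x y z) = \<omega>' (A x) (A y) (A z)" for x y z c
    using same unfolding same_structure_maps_iff by blast+
  let ?F = "\<lambda>p. (A (fst p), B (snd p))" and ?G = "\<lambda>p. (inv A (fst p), inv B (snd p))"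
  have inv: "inv A (A x) = x" "inv B (B c) = c" "A (inv A u) = u" "B (inv B v) = v" for x c u v
    using bij_A bij_B by (simp_all add: bij_is_inj bij_is_surj surj_f_inv_f)
  have linF: "linear ?F" using linear_A linear_B by (simp add: linear_iff)
  have linG: "linear ?G"
    using linear_inv_of_bij[OF linear_A bij_A] linear_inv_of_bij[OF linear_B bij_B] by (simp add: linear_iff)
  have bij: "bij product_map"
  proof (rule bij_betw_byWitness[where f' = "\<lambda>e. S (?G (inv S' e))"])
  qed (auto simp: product_map_def inv)
  have invG: "inv product_map (S' q) = S (?G q)" for q
    by (rule inv_f_eq) (use bij in \<open>auto simp: bij_is_inj product_map_S inv\<close>)
  have dF: "frechet_derivative ?F (at p) = ?F" for p
    by (intro frechet_derivative_eqI bounded_linear_imp_has_derivative findim_linear_bounded linF)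
  have "smooth_map H H' product_map"
    unfolding smooth_map_def H.smooth_fun_iff H'.smooth_fun_iff
  proof (intro allI impI ballI)
    fix f assume "f \<in> smooth_fun H'"
    then have "smooth (\<lambda>p. (f \<circ> S') (?F p))"
      unfolding H'.smooth_fun_iff by (rule smooth_compose) (rule smooth_linear[OF linF])
    then show "smooth (f \<circ> product_map \<circ> S)" by (simp add: o_def product_map_S)
  qed
  moreover have "smooth_map H' H (inv product_map)"
    unfolding smooth_map_def H.smooth_fun_iff H'.smooth_fun_iff
  proof (intro allI impI ballI)
    fix f assume "f \<in> smooth_fun H"
    then have "smooth (\<lambda>p. (f \<circ> S) (?G p))"
      unfolding H.smooth_fun_iff by (rule smooth_compose) (rule smooth_linear[OF linG])
    then show "smooth (f \<circ> inv product_map \<circ> S')" by (simp add: o_def invG)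
  qed
  moreover have "product_map (act H t e) = act H' t (product_map e)" for t e
  proof -
    obtain y z where e: "e = S (y, z)" by (metis H.S_inv surj_pair)
    show ?thesis unfolding e H.act_S product_map_S
      by (simp add: H'.act_S linear_scale[OF linear_A] linear_scale[OF linear_B])
  qed
  moreover have "proj H' (product_map e) = A (proj H e)" for e
  proof -
    obtain p where e: "e = S p" by (metis H.S_inv)
    show ?thesis unfolding e product_map_S H'.proj_S_fst H.proj_S_fst by simp
  qed
  moreover have "product_map (core H c) = core H' (B c)" for c
    unfolding H.S_core[symmetric] H'.S_core[symmetric] product_map_S by (simp add: linear_0[OF linear_A])
  moreover have "kappa H' (product_map e) (jet2 (A \<circ> a)) = push H' product_map (kappa H e (jet2 a))"
    if a: "smooth a" for e a
  proof -
    obtain y z where e: "e = S (y, z)" by (metis H.S_inv surj_pair)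
    obtain a0 a1 a2 where j: "jet2 a = (a0, a1, a2)" by (metis prod_cases3)
    have pm: "product_map (S p) = S' (?F p)" for p by (rule product_map_S)
    note p = push_tv[OF H.graded_coords_axioms H'.graded_coords_axioms smooth_linear[OF linF] pm]
    show ?thesis
      unfolding jet2_linear_comp[OF linear_A a j] j e pm H.kappa_S H'.kappa_S p H'.tv_eq_iff dF
      by (simp add: poly_field_apply linear_add[OF linear_A] linear_add[OF linear_B] linear_diff[OF linear_B]
          linear_neg[OF linear_B] same')
  qed
  ultimately show ?thesis using bij unfolding ha2_iso_def by blast
qed

lemma iso_unique:
  assumes "ha2_iso H H' A B \<Phi>"
  shows "\<Phi> = product_map"
proof
  fix e
  obtain y z where e: "e = S (y, z)" by (metis H.S_inv surj_pair)
  show "\<Phi> e = product_map e"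
    unfolding e product_map_S iso_in_coordinates(1)[OF assms] by simp
qed

end

section \<open>The canonically split model\<close>

text \<open>
  The normal form read as a definition: arbitrary coefficients, with the identity as splitting.
\<close>

definition split_ha :: "('g::findim \<Rightarrow> 'g \<Rightarrow> 'g) \<Rightarrow> ('g \<Rightarrow> 'c::findim \<Rightarrow> 'c) \<Rightarrow> ('g \<Rightarrow> 'c)
    \<Rightarrow> ('g \<Rightarrow> 'g \<Rightarrow> 'c) \<Rightarrow> ('g \<Rightarrow> 'g \<Rightarrow> 'g \<Rightarrow> 'c) \<Rightarrow> ('g \<times> 'c, 'g, 'c) ha2" where
  "split_ha b \<rho> d \<beta> \<omega> = \<lparr>charts = {id}, proj = fst, core = Pair 0,
     kappa = (\<lambda>p (a0, a1, a2).
       tv id p (poly_field (\<lambda>y. b y a0) a1 (\<lambda>z. - \<rho> a0 z) (\<omega> a0) (\<lambda>y. \<beta> y a1) (d a2) p))\<rparr>"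

lemma split_ha_normal:
  assumes b: "skew_bilin b" and \<rho>: "bilinear \<rho>" and d: "linear d" and \<beta>: "skew_bilin \<beta>"
    and \<omega>: "\<And>x. sym_bilin (\<omega> x)" "\<And>y z. linear (\<lambda>x. \<omega> x y z)"
  shows "ha_normal (split_ha b \<rho> d \<beta> \<omega>) id b \<rho> d \<beta> \<omega>"
proof -
  have gp: "graded_poly (id :: 'a \<times> 'b \<Rightarrow> 'a \<times> 'b)"
    unfolding graded_poly_def
    by (intro exI[of _ id] exI[of _ "\<lambda>x y. 0"]) (auto simp: linear_iff bilinear_def)
  have lid: "linear (id :: 'x::real_vector \<Rightarrow> 'x)" by (simp add: linear_iff)
  have "graded_bundle2 (split_ha b \<rho> d \<beta> \<omega>)"
    unfolding graded_bundle2_def split_ha_def by (auto simp: gp intro!: exI[of _ id] lid)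
  moreover have "graded_splitting (split_ha b \<rho> d \<beta> \<omega>) id"
    unfolding graded_splitting_def split_ha_def by (simp add: gp)
  moreover have "kappa (split_ha b \<rho> d \<beta> \<omega>) (id p) (a0, a1, a2) =
      tv id p (poly_field (\<lambda>y. b y a0) a1 (\<lambda>z. - \<rho> a0 z) (\<omega> a0) (\<lambda>y. \<beta> y a1) (d a2) p)" for p a0 a1 a2
    by (simp add: split_ha_def)
  ultimately show ?thesis
    using assms unfolding skew_bilin_def
    by (intro ha_normal.intro ha_coords.intro graded_coords.intro ha_coords_axioms.intro ha_normal_axioms.intro)
      blast+
qed

lemma (in ha_normal) split_ha_normal_self: "ha_normal (split_ha b \<rho> d \<beta> \<omega>) id b \<rho> d \<beta> \<omega>"
  by (intro split_ha_normal bilinear_\<rho> linear_d sym_bilin_\<omega> linear_\<omega>;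
      unfold skew_bilin_def; intro conjI allI bilinear_b skew_b bilinear_\<beta> skew_\<beta>)

lemma canonically_split_split_ha:
  assumes "ha_normal (split_ha b \<rho> d \<beta> \<omega>) id b \<rho> d \<beta> \<omega>"
  shows "canonically_split (split_ha b \<rho> d \<beta> \<omega>)"
  using ha_normal.splitting_normal[OF assms] by (simp add: canonically_split_def split_ha_def)

text \<open>
  Charts, projection and core inclusion are prescribed, and the normal form expresses \<open>\<kappa>\<^sup>2\<close> by the
  structure maps.
\<close>

lemma canonically_split_eq:
  assumes K: "skew_ha2 K" "canonically_split K"
  shows "K = split_ha (ha_bracket K) (ha_box K) (ha_del K) (ha_beta K) (ha_omega_sym K)"
proof -
  have id: "splitting K = id" and fields: "charts K = {id}" "proj K = fst" "core K = Pair 0"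
    using K(2) by (simp_all add: canonically_split_def)
  obtain b \<rho> d \<beta> \<omega> where n: "ha_normal K (splitting K) b \<rho> d \<beta> \<omega>"
    using skew_ha2_normal[OF K(1)] by blast
  interpret ha_normal K "splitting K" b \<rho> d \<beta> \<omega> by (rule n)
  have "kappa K = (\<lambda>p (a0, a1, a2).
      tv id p (poly_field (\<lambda>y. b y a0) a1 (\<lambda>z. - \<rho> a0 z) (\<omega> a0) (\<lambda>y. \<beta> y a1) (d a2) p))"
    using kappa_S[unfolded id] by (auto simp: fun_eq_iff)
  then show ?thesis
    unfolding ha_bracket_normal ha_del_normal ha_beta_normal ha_box_normal ha_omega_sym_normal
    by (simp add: split_ha_def fields)
qed

lemma structure_properties_of_skew_ha2:
  assumes "skew_ha2 H"
  shows "graded_splitting H (splitting H) \<and>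
        skew_bilin (ha_bracket H) \<and> linear (ha_del H) \<and> skew_bilin (ha_beta H) \<and> bilinear (ha_box H) \<and>
        (\<forall>y z. linear (\<lambda>e. ha_omega_sym H e y z)) \<and> (\<forall>e. sym_bilin (ha_omega_sym H e)) \<and>
        (\<forall>\<alpha>\<le>2. \<forall>e. ha_lift H \<alpha> e \<in> vf_of_weight H (- real \<alpha>)) \<and>
        (\<forall>e. ha_lift H 0 e =
           field0 H (\<lambda>y. ha_bracket H y e) (ha_box H (- e)) (\<lambda>y z. 2 *\<^sub>R ha_omega_sym H e y z)) \<and>
        (\<forall>e. ha_lift H 1 e = field1 H e (\<lambda>y. ha_beta H y e)) \<and>
        (\<forall>e. ha_lift H 2 e = field2 H (2 *\<^sub>R ha_del H e))"
proof -
  obtain b \<rho> d \<beta> \<omega> where n: "ha_normal H (splitting H) b \<rho> d \<beta> \<omega>"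
    using skew_ha2_normal[OF assms] by blast
  show ?thesis
    by (intro conjI allI impI ha_normal.structure_properties[OF n] ha_normal.lift_weights[OF n]
        ha_normal.lift_fields[OF n])
qed

lemma iso_iff_same_structure_maps:
  fixes H :: "('e, 'g::findim, 'c::findim) ha2" and H' :: "('f, 'h::findim, 'd::findim) ha2"
  assumes "skew_ha2 H" "skew_ha2 H'" "linear A" "bij A" "linear B" "bij B"
  shows "(\<exists>\<Phi>. ha2_iso H H' A B \<Phi>) \<Longrightarrow> same_structure_maps H H' A B"
    and "same_structure_maps H H' A B \<Longrightarrow> \<exists>!\<Phi>. ha2_iso H H' A B \<Phi>"
proof -
  obtain b \<rho> d \<beta> \<omega> where n: "ha_normal H (splitting H) b \<rho> d \<beta> \<omega>"
    using skew_ha2_normal[OF assms(1)] by blast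
  obtain b' \<rho>' d' \<beta>' \<omega>' where n': "ha_normal H' (splitting H') b' \<rho>' d' \<beta>' \<omega>'"
    using skew_ha2_normal[OF assms(2)] by blast
  interpret ha_normal_pair H "splitting H" b \<rho> d \<beta> \<omega> H' "splitting H'" b' \<rho>' d' \<beta>' \<omega>' A B
    by (intro ha_normal_pair.intro ha_normal_pair_axioms.intro n n' assms)
  show "(\<exists>\<Phi>. ha2_iso H H' A B \<Phi>) \<Longrightarrow> same_structure_maps H H' A B"
    "same_structure_maps H H' A B \<Longrightarrow> \<exists>!\<Phi>. ha2_iso H H' A B \<Phi>"
    using iso_in_coordinates(2) product_map_iso iso_unique by blast+
qed

lemma lie_ha2_iff_structure_maps:
  assumes "skew_ha2 H"
  shows "lie_ha2 H \<longleftrightarrow>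
           lie_algebra (ha_bracket H) \<and> lie_module (ha_bracket H) (ha_box H) \<and>
           module_morphism (ha_bracket H) (ha_box H) (ha_del H) \<and>
           (\<forall>e y z. ha_omega_sym H e y z = 0) \<and>
           (\<forall>x y. ha_beta H x y = ha_del H (ha_bracket H x y))"
proof -
  obtain b \<rho> d \<beta> \<omega> where n: "ha_normal H (splitting H) b \<rho> d \<beta> \<omega>"
    using skew_ha2_normal[OF assms] by blast
  interpret ha_normal H "splitting H" b \<rho> d \<beta> \<omega> by (rule n)
  show ?thesis
    unfolding ha_bracket_normal ha_del_normal ha_beta_normal ha_box_normal ha_omega_sym_normal
    by (rule lie_ha2_iff)
qed

lemma lie_skew: "lie_ha2 H \<Longrightarrow> skew_ha2 H"
  by (simp add: lie_ha2_def)

lemma same_structure_maps_id_iff: "same_structure_maps H K id id \<longleftrightarrow>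
    ha_bracket H = ha_bracket K \<and> ha_del H = ha_del K \<and> ha_beta H = ha_beta K \<and>
    ha_box H = ha_box K \<and> ha_omega_sym H = ha_omega_sym K"
  by (simp add: same_structure_maps_def fun_eq_iff)

lemma ex1_canonically_split_model:
  fixes H :: "('e, 'g::findim, 'c::findim) ha2"
  assumes H: "lie_ha2 H"
  shows "\<exists>!K :: ('g \<times> 'c, 'g, 'c) ha2. lie_ha2 K \<and> canonically_split K \<and> (\<exists>\<Phi>. ha2_iso H K id id \<Phi>)"
proof -
  note skew = lie_skew[OF H]
  obtain b \<rho> d \<beta> \<omega> where n: "ha_normal H (splitting H) b \<rho> d \<beta> \<omega>"
    using skew_ha2_normal[OF skew] by blast
  interpret H: ha_normal H "splitting H" b \<rho> d \<beta> \<omega> by (rule n)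
  let ?K = "split_ha b \<rho> d \<beta> \<omega>"
  interpret K: ha_normal ?K id b \<rho> d \<beta> \<omega> by (rule H.split_ha_normal_self)
  have lin: "linear (id :: 'x::real_vector \<Rightarrow> 'x)" by (simp add: linear_iff)
  have iso: "(\<exists>\<Phi>. ha2_iso H K id id \<Phi>) \<longleftrightarrow> same_structure_maps H K id id"
    if "skew_ha2 K" for K :: "('g \<times> 'c, 'g, 'c) ha2"
    using iso_iff_same_structure_maps[OF skew that lin bij_id lin bij_id] by blast
  have same: "same_structure_maps H ?K id id"
    unfolding same_structure_maps_id_iff H.ha_bracket_normal H.ha_del_normal H.ha_beta_normal
      H.ha_box_normal H.ha_omega_sym_normal K.ha_bracket_normal K.ha_del_normal K.ha_beta_normal
      K.ha_box_normal K.ha_omega_sym_normal by simp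
  show ?thesis
  proof (intro ex1I conjI)
    show "lie_ha2 ?K" using H unfolding H.lie_ha2_iff K.lie_ha2_iff .
    show "canonically_split ?K" by (rule canonically_split_split_ha[OF H.split_ha_normal_self])
    show "\<exists>\<Phi>. ha2_iso H ?K id id \<Phi>" using same iso[OF K.skew_ha2] by blast
    fix K :: "('g \<times> 'c, 'g, 'c) ha2"
    assume K: "lie_ha2 K \<and> canonically_split K \<and> (\<exists>\<Phi>. ha2_iso H K id id \<Phi>)"
    then have sK: "skew_ha2 K" by (simp add: lie_skew)
    have "same_structure_maps H K id id" using K iso[OF sK] by blast
    then have eq: "ha_bracket K = b" "ha_del K = d" "ha_beta K = \<beta>" "ha_box K = \<rho>" "ha_omega_sym K = \<omega>"
      unfolding same_structure_maps_id_iff H.ha_bracket_normal H.ha_del_normal H.ha_beta_normal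
      H.ha_box_normal H.ha_omega_sym_normal by simp_all
    show "K = ?K"
      using canonically_split_eq[OF sK] K unfolding eq by blast
  qed
qed

text \<open>
  In the Lie case \<open>\<beta>\<close> and \<open>\<omega>\<^sup>s\<^sup>y\<^sup>m\<close> are determined by the other structure maps.
\<close>

lemma bij_betw_lie_ha2_module_morphisms:
  "bij_betw (\<lambda>K :: ('g::findim \<times> 'c::findim, 'g, 'c) ha2. (ha_bracket K, ha_box K, ha_del K))
        {K. lie_ha2 K \<and> canonically_split K}
        {(b, \<rho>, d). lie_algebra b \<and> lie_module b \<rho> \<and> module_morphism b \<rho> d}"
proof (rule bij_betwI')
  fix K K' :: "('g \<times> 'c, 'g, 'c) ha2"
  assume K: "K \<in> {K. lie_ha2 K \<and> canonically_split K}" and K': "K' \<in> {K. lie_ha2 K \<and> canonically_split K}"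
  have model: "L = split_ha (ha_bracket L) (ha_box L) (ha_del L)
      (\<lambda>x y. ha_del L (ha_bracket L x y)) (\<lambda>x y z. 0)"
    if "L \<in> {K. lie_ha2 K \<and> canonically_split K}" for L :: "('g \<times> 'c, 'g, 'c) ha2"
  proof -
    have s: "skew_ha2 L" "lie_ha2 L" "canonically_split L" using that by (auto dest: lie_skew)
    have "ha_beta L = (\<lambda>x y. ha_del L (ha_bracket L x y))" "ha_omega_sym L = (\<lambda>x y z. 0)"
      using s(2) unfolding lie_ha2_iff_structure_maps[OF s(1)] by (auto simp: fun_eq_iff)
    then show ?thesis using canonically_split_eq[OF s(1,3)] by metis
  qed
  show "(ha_bracket K, ha_box K, ha_del K) = (ha_bracket K', ha_box K', ha_del K') \<longleftrightarrow> K = K'"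
  proof
    assume "(ha_bracket K, ha_box K, ha_del K) = (ha_bracket K', ha_box K', ha_del K')"
    then have "ha_bracket K = ha_bracket K'" "ha_box K = ha_box K'" "ha_del K = ha_del K'" by simp_all
    then show "K = K'" using model[OF K] model[OF K'] by metis
  qed simp
next
  fix K :: "('g \<times> 'c, 'g, 'c) ha2" assume "K \<in> {K. lie_ha2 K \<and> canonically_split K}"
  then have "lie_ha2 K" by simp
  with lie_ha2_iff_structure_maps[OF lie_skew[OF this]]
  show "(ha_bracket K, ha_box K, ha_del K) \<in> {(b, \<rho>, d). lie_algebra b \<and> lie_module b \<rho> \<and> module_morphism b \<rho> d}"
    by simp
next
  fix t :: "('g \<Rightarrow> 'g \<Rightarrow> 'g) \<times> ('g \<Rightarrow> 'c \<Rightarrow> 'c) \<times> ('g \<Rightarrow> 'c)"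
  assume "t \<in> {(b, \<rho>, d). lie_algebra b \<and> lie_module b \<rho> \<and> module_morphism b \<rho> d}"
  then obtain b \<rho> d where t: "t = (b, \<rho>, d)" and L: "lie_algebra b" "lie_module b \<rho>" "module_morphism b \<rho> d"
    by auto
  define \<beta> where "\<beta> x y = d (b x y)" for x y
  define \<omega> :: "'g \<Rightarrow> 'g \<Rightarrow> 'g \<Rightarrow> 'c" where "\<omega> x y z = 0" for x y z
  have b: "skew_bilin b" and d: "linear d" and \<rho>: "bilinear \<rho>"
    using L unfolding lie_algebra_def lie_module_def module_morphism_def by blast+
  have \<beta>: "skew_bilin \<beta>"
    unfolding skew_bilin_def bilinear_def
  proof (intro conjI allI)
    have "linear (b x)" "linear (\<lambda>x. b x y)" for x y
      using b unfolding skew_bilin_def bilinear_def by blast+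
    from this[THEN linear_compose, OF d]
    show "linear (\<beta> x)" "linear (\<lambda>x. \<beta> x y)" for x y
      by (simp_all add: \<beta>_def[abs_def] o_def)
    show "\<beta> x y = - \<beta> y x" for x y
    proof -
      have "b x y = - b y x" using b unfolding skew_bilin_def by blast
      then show ?thesis unfolding \<beta>_def by (simp only: linear_neg[OF d])
    qed
  qed
  have \<omega>: "sym_bilin (\<omega> x)" "linear (\<lambda>x. \<omega> x y z)" for x y z
    by (simp_all add: \<omega>_def[abs_def] sym_bilin_def bilinear_def linear_zero)
  let ?K = "split_ha b \<rho> d \<beta> \<omega>"
  have n: "ha_normal ?K id b \<rho> d \<beta> \<omega>" by (rule split_ha_normal[OF b \<rho> d \<beta> \<omega>])
  interpret ha_normal ?K id b \<rho> d \<beta> \<omega> by (rule n)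
  have "lie_ha2 ?K" unfolding lie_ha2_iff using L by (simp add: \<beta>_def \<omega>_def)
  moreover have "canonically_split ?K" by (rule canonically_split_split_ha[OF n])
  moreover have "t = (ha_bracket ?K, ha_box ?K, ha_del ?K)"
    by (simp add: t ha_bracket_normal ha_box_normal ha_del_normal)
  ultimately show "\<exists>K\<in>{K. lie_ha2 K \<and> canonically_split K}. t = (ha_bracket K, ha_box K, ha_del K)"
    by blast
qed

theorem theorem3p15:
  fixes H :: "('e, 'g::findim, 'c::findim) ha2"
    and H' :: "('f, 'h::findim, 'd::findim) ha2"
  shows
    "(skew_ha2 H \<longrightarrow>
        graded_splitting H (splitting H) \<and>
        skew_bilin (ha_bracket H) \<and> linear (ha_del H) \<and> skew_bilin (ha_beta H) \<and> bilinear (ha_box H) \<and>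
        (\<forall>y z. linear (\<lambda>e. ha_omega_sym H e y z)) \<and> (\<forall>e. sym_bilin (ha_omega_sym H e)) \<and>
        (\<forall>\<alpha>\<le>2. \<forall>e. ha_lift H \<alpha> e \<in> vf_of_weight H (- real \<alpha>)) \<and>
        (\<forall>e. ha_lift H 0 e =
           field0 H (\<lambda>y. ha_bracket H y e) (ha_box H (- e)) (\<lambda>y z. 2 *\<^sub>R ha_omega_sym H e y z)) \<and>
        (\<forall>e. ha_lift H 1 e = field1 H e (\<lambda>y. ha_beta H y e)) \<and>
        (\<forall>e. ha_lift H 2 e = field2 H (2 *\<^sub>R ha_del H e)))
   \<and> (skew_ha2 H \<and> skew_ha2 H' \<longrightarrow>
        (\<forall>A B. linear A \<and> bij A \<and> linear B \<and> bij B \<longrightarrow>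
           ((\<exists>\<Phi>. ha2_iso H H' A B \<Phi>) \<longrightarrow> same_structure_maps H H' A B) \<and>
           (same_structure_maps H H' A B \<longrightarrow> (\<exists>!\<Phi>. ha2_iso H H' A B \<Phi>))))
   \<and> (skew_ha2 H \<longrightarrow>
        (lie_ha2 H \<longleftrightarrow>
           lie_algebra (ha_bracket H) \<and> lie_module (ha_bracket H) (ha_box H) \<and>
           module_morphism (ha_bracket H) (ha_box H) (ha_del H) \<and>
           (\<forall>e y z. ha_omega_sym H e y z = 0) \<and>
           (\<forall>x y. ha_beta H x y = ha_del H (ha_bracket H x y))))
   \<and> (lie_ha2 H \<longrightarrow>
        (\<exists>!K :: ('g \<times> 'c, 'g, 'c) ha2. lie_ha2 K \<and> canonically_split K \<and>
           (\<exists>\<Phi>. ha2_iso H K id id \<Phi>)))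
   \<and> bij_betw (\<lambda>K :: ('g \<times> 'c, 'g, 'c) ha2. (ha_bracket K, ha_box K, ha_del K))
        {K. lie_ha2 K \<and> canonically_split K}
        {(b, \<rho>, d). lie_algebra b \<and> lie_module b \<rho> \<and> module_morphism b \<rho> d}"
proof (intro conjI)
  show "skew_ha2 H \<and> skew_ha2 H' \<longrightarrow>
        (\<forall>A B. linear A \<and> bij A \<and> linear B \<and> bij B \<longrightarrow>
           ((\<exists>\<Phi>. ha2_iso H H' A B \<Phi>) \<longrightarrow> same_structure_maps H H' A B) \<and>
           (same_structure_maps H H' A B \<longrightarrow> (\<exists>!\<Phi>. ha2_iso H H' A B \<Phi>)))"
    using iso_iff_same_structure_maps[of H H'] by simp
qed (intro impI structure_properties_of_skew_ha2 lie_ha2_iff_structure_maps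
    ex1_canonically_split_model bij_betw_lie_ha2_module_morphisms; assumption)+

end
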